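(* Let $R$ be an LG-ring, let $q_1$ and $q_2$ be nonsingular quadratic forms over $R$ and let $q_3$ be a regular quadratic form over $R$. Then $$q_1\perp q_3\cong q_2\perp q_3\implies q_1\cong q_2,$$ where $\cong$ denotes isometry.
   Context: A commutative ring $R$ is an LG-ring if for every $n$ and every $f\in R[X_1,\dots,X_n]$ the following holds: there exists $r\in R^n$ with $f(r)\in R^\times$ if and only if for every maximal ideal $\mathfrak{m}$ of $R$ there exists $x\in (R/\mathfrak{m})^n$ with $f(x)\neq 0$ in $R/\mathfrak{m}$. A quadratic form over $R$ is a pair $(M,q)$ (often written $q$) with $M$ a finitely generated projective $R$-module and $q:M\to R$ a map with $q(rm)=r^2q(m)$ and such that the polar form $b_q(m,m')=q(m+m')-q(m)-q(m')$ is bilinear. For a commutative $R$-algebra $T$ there is a unique base change quadratic form $q_T$ on $M\otimes_RT$ with $q_T(m\otimes t)=q(m)t^2$ and polar form the base change of $b_q$. The radical is $\mathrm{rad}(q)=\{m\in M: q(m)=0 \text{ and } b_q(m,M)=0\}$. The form $q$ is regular if $M\to \mathrm{Hom}_R(M,R)$, $m\mapsto b_q(m,-)$, is bijective. It is nonsingular if $\mathrm{rad}(q_F)=0$ for all fields $F$ that are $R$-algebras. An isometry $(M_1,q_1)\to (M_2,q_2)$ is an $R$-linear isomorphism $f$ with $q_2\circ f=q_1$. The orthogonal sum $q_1\perp q_2$ on $M_1\oplus M_2$ is $(m_1,m_2)\mapsto q_1(m_1)+q_2(m_2)$. *)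

theory Defs
  imports "HOL-Algebra.QuotRing" "HOL-Algebra.Indexed_Polynomials"
    "HOL-Algebra.Free_Abelian_Groups"
begin

section \<open>LG-rings\<close>

text \<open>
  Polynomials in $X_0,\dots,X_{n-1}$ over \<open>R\<close> are the elements of
  \<^const>\<open>ring.indexed_pset\<close> for the index set \<open>{..<n}\<close>: finitely supported coefficient
  functions on monomials, a monomial being the multiset of its variables.
\<close>

definition mpoly_eval ::
  "('a, 'r) ring_scheme \<Rightarrow> nat \<Rightarrow> (nat multiset \<Rightarrow> 'a) \<Rightarrow> (nat \<Rightarrow> 'a) \<Rightarrow> 'a" where
  "mpoly_eval R n f x =
    (\<Oplus>\<^bsub>R\<^esub>\<mu> \<in> {\<mu>. f \<mu> \<noteq> \<zero>\<^bsub>R\<^esub>}. f \<mu> \<otimes>\<^bsub>R\<^esub> (\<Otimes>\<^bsub>R\<^esub>i \<in> {..<n}. x i [^]\<^bsub>R\<^esub> count \<mu> i))"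

definition LG_ring :: "('a, 'r) ring_scheme \<Rightarrow> bool" where
  "LG_ring R \<longleftrightarrow> cring R \<and>
    (\<forall>n. \<forall>f \<in> ring.indexed_pset R {..<n} (carrier R).
      (\<exists>r \<in> {..<n} \<rightarrow> carrier R. mpoly_eval R n f r \<in> Units R) \<longleftrightarrow>
      (\<forall>I. maximalideal I R \<longrightarrow>
        (\<exists>x \<in> {..<n} \<rightarrow> carrier (R Quot I).
          mpoly_eval (R Quot I) n (\<lambda>\<mu>. I +>\<^bsub>R\<^esub> f \<mu>) x \<noteq> \<zero>\<^bsub>R Quot I\<^esub>)))"


section \<open>Finitely generated projective modules\<close>

text \<open>
  The record type \<^typ>\<open>('a, 'm) module\<close> extends rings, so it has fields \<open>mult\<close> and \<open>one\<close> that
  the locale \<^locale>\<open>module\<close> ignores; they carry no meaning for the modules below.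
\<close>

definition linear_map ::
  "('a, 'r) ring_scheme \<Rightarrow> ('a, 'm) module \<Rightarrow> ('a, 'n) module \<Rightarrow> ('m \<Rightarrow> 'n) \<Rightarrow> bool" where
  "linear_map R M N f \<longleftrightarrow> f \<in> carrier M \<rightarrow> carrier N \<and>
    (\<forall>x \<in> carrier M. \<forall>y \<in> carrier M. f (x \<oplus>\<^bsub>M\<^esub> y) = f x \<oplus>\<^bsub>N\<^esub> f y) \<and>
    (\<forall>r \<in> carrier R. \<forall>x \<in> carrier M. f (r \<odot>\<^bsub>M\<^esub> x) = r \<odot>\<^bsub>N\<^esub> f x)"

definition finitely_generated_module ::
  "('a, 'r) ring_scheme \<Rightarrow> ('a, 'm) module \<Rightarrow> bool" where
  "finitely_generated_module R M \<longleftrightarrow>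
    (\<exists>S. finite S \<and> S \<subseteq> carrier M \<and>
      (\<forall>x \<in> carrier M. \<exists>c \<in> S \<rightarrow> carrier R. x = (\<Oplus>\<^bsub>M\<^esub>s \<in> S. c s \<odot>\<^bsub>M\<^esub> s)))"

definition free_module :: "('a, 'r) ring_scheme \<Rightarrow> 'i set \<Rightarrow> ('a, 'i \<Rightarrow> 'a) module" where
  "free_module R I =
    \<lparr>carrier = {v \<in> I \<rightarrow>\<^sub>E carrier R. finite {i \<in> I. v i \<noteq> \<zero>\<^bsub>R\<^esub>}},
     monoid.mult = undefined, monoid.one = undefined,
     ring.zero = (\<lambda>i \<in> I. \<zero>\<^bsub>R\<^esub>), ring.add = (\<lambda>v w. \<lambda>i \<in> I. v i \<oplus>\<^bsub>R\<^esub> w i),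
     module.smult = (\<lambda>r v. \<lambda>i \<in> I. r \<otimes>\<^bsub>R\<^esub> v i)\<rparr>"

text \<open>
  Projective: a direct summand of a free module. Index sets \<open>I\<close> inside the type of \<open>M\<close> suffice,
  because a projective \<open>M\<close> is a direct summand of the free module on its own elements.
\<close>

definition projective_module :: "('a, 'r) ring_scheme \<Rightarrow> ('a, 'm) module \<Rightarrow> bool" where
  "projective_module R M \<longleftrightarrow>
    (\<exists>(I :: 'm set) i p. linear_map R M (free_module R I) i \<and>
      linear_map R (free_module R I) M p \<and> (\<forall>x \<in> carrier M. p (i x) = x))"


section \<open>Quadratic forms\<close>

definition polar ::
  "('a, 'r) ring_scheme \<Rightarrow> ('a, 'm) module \<Rightarrow> ('m \<Rightarrow> 'a) \<Rightarrow> 'm \<Rightarrow> 'm \<Rightarrow> 'a" where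
  "polar R M q x y = q (x \<oplus>\<^bsub>M\<^esub> y) \<ominus>\<^bsub>R\<^esub> q x \<ominus>\<^bsub>R\<^esub> q y"

definition self_module :: "('a, 'r) ring_scheme \<Rightarrow> ('a, 'a) module" where
  "self_module R =
    \<lparr>carrier = carrier R, monoid.mult = monoid.mult R, monoid.one = \<one>\<^bsub>R\<^esub>,
     ring.zero = \<zero>\<^bsub>R\<^esub>, ring.add = ring.add R, module.smult = monoid.mult R\<rparr>"

definition bilinear_form ::
  "('a, 'r) ring_scheme \<Rightarrow> ('a, 'm) module \<Rightarrow> ('m \<Rightarrow> 'm \<Rightarrow> 'a) \<Rightarrow> bool" where
  "bilinear_form R M b \<longleftrightarrow>
    (\<forall>x \<in> carrier M. linear_map R M (self_module R) (\<lambda>y. b x y)) \<and>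
    (\<forall>y \<in> carrier M. linear_map R M (self_module R) (\<lambda>x. b x y))"

definition quadratic_map ::
  "('a, 'r) ring_scheme \<Rightarrow> ('a, 'm) module \<Rightarrow> ('m \<Rightarrow> 'a) \<Rightarrow> bool" where
  "quadratic_map R M q \<longleftrightarrow> q \<in> carrier M \<rightarrow> carrier R \<and>
    (\<forall>r \<in> carrier R. \<forall>x \<in> carrier M. q (r \<odot>\<^bsub>M\<^esub> x) = r [^]\<^bsub>R\<^esub> (2::nat) \<otimes>\<^bsub>R\<^esub> q x) \<and>
    bilinear_form R M (polar R M q)"

definition quadratic_form ::
  "('a, 'r) ring_scheme \<Rightarrow> ('a, 'm) module \<Rightarrow> ('m \<Rightarrow> 'a) \<Rightarrow> bool" where
  "quadratic_form R M q \<longleftrightarrow> module R M \<and> finitely_generated_module R M \<and>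
    projective_module R M \<and> quadratic_map R M q"

definition radical ::
  "('a, 'r) ring_scheme \<Rightarrow> ('a, 'm) module \<Rightarrow> ('m \<Rightarrow> 'a) \<Rightarrow> 'm set" where
  "radical R M q = {x \<in> carrier M. q x = \<zero>\<^bsub>R\<^esub> \<and> (\<forall>y \<in> carrier M. polar R M q x y = \<zero>\<^bsub>R\<^esub>)}"

text \<open>Linear forms are made extensional so that a form is one element of the dual.\<close>

definition dual_carrier :: "('a, 'r) ring_scheme \<Rightarrow> ('a, 'm) module \<Rightarrow> ('m \<Rightarrow> 'a) set" where
  "dual_carrier R M = {\<phi> \<in> extensional (carrier M). linear_map R M (self_module R) \<phi>}"

definition regular_form ::
  "('a, 'r) ring_scheme \<Rightarrow> ('a, 'm) module \<Rightarrow> ('m \<Rightarrow> 'a) \<Rightarrow> bool" where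
  "regular_form R M q \<longleftrightarrow> quadratic_form R M q \<and>
    bij_betw (\<lambda>x. \<lambda>y \<in> carrier M. polar R M q x y) (carrier M) (dual_carrier R M)"


section \<open>Base change\<close>

text \<open>
  \<open>M \<otimes>\<^sub>R T\<close> for a commutative \<open>R\<close>-algebra \<open>T\<close>: the free abelian group on pairs \<open>(m, t)\<close> modulo
  biadditivity and \<open>R\<close>-balancedness, with \<open>T\<close> acting on the second factor.
\<close>

definition tensor_relations ::
  "('a, 'r) ring_scheme \<Rightarrow> ('a, 'm) module \<Rightarrow> ('a, 't) module \<Rightarrow> ('m \<times> 't \<Rightarrow>\<^sub>0 int) set" where
  "tensor_relations R M T =
    {frag_of (m \<oplus>\<^bsub>M\<^esub> m', t) - frag_of (m, t) - frag_of (m', t) | m m' t.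
      m \<in> carrier M \<and> m' \<in> carrier M \<and> t \<in> carrier T} \<union>
    {frag_of (m, t \<oplus>\<^bsub>T\<^esub> t') - frag_of (m, t) - frag_of (m, t') | m t t'.
      m \<in> carrier M \<and> t \<in> carrier T \<and> t' \<in> carrier T} \<union>
    {frag_of (r \<odot>\<^bsub>M\<^esub> m, t) - frag_of (m, r \<odot>\<^bsub>T\<^esub> t) | r m t.
      r \<in> carrier R \<and> m \<in> carrier M \<and> t \<in> carrier T}"

definition tensor_free ::
  "('a, 'm) module \<Rightarrow> ('a, 't) module \<Rightarrow> ('m \<times> 't \<Rightarrow>\<^sub>0 int) monoid" where
  "tensor_free M T = free_Abelian_group (carrier M \<times> carrier T)"

definition tensor_kernel ::
  "('a, 'r) ring_scheme \<Rightarrow> ('a, 'm) module \<Rightarrow> ('a, 't) module \<Rightarrow> ('m \<times> 't \<Rightarrow>\<^sub>0 int) set" where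
  "tensor_kernel R M T = generate (tensor_free M T) (tensor_relations R M T)"

definition tensor_group ::
  "('a, 'r) ring_scheme \<Rightarrow> ('a, 'm) module \<Rightarrow> ('a, 't) module \<Rightarrow> ('m \<times> 't \<Rightarrow>\<^sub>0 int) set monoid"
  where "tensor_group R M T = tensor_free M T Mod tensor_kernel R M T"

definition pure_tensor ::
  "('a, 'r) ring_scheme \<Rightarrow> ('a, 'm) module \<Rightarrow> ('a, 't) module \<Rightarrow>
    'm \<Rightarrow> 't \<Rightarrow> ('m \<times> 't \<Rightarrow>\<^sub>0 int) set" where
  "pure_tensor R M T m t = tensor_kernel R M T #>\<^bsub>tensor_free M T\<^esub> frag_of (m, t)"

text \<open>
  The scalar \<open>s\<close> sends the class of \<open>c\<close> to the class of the image of \<open>c\<close> under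
  \<open>(m, t) \<mapsto> (m, s t)\<close>; the union below is over representatives, all giving the same coset.
\<close>

definition base_change_module ::
  "('a, 'r) ring_scheme \<Rightarrow> ('a, 'm) module \<Rightarrow> ('a, 't) module \<Rightarrow>
    ('t, ('m \<times> 't \<Rightarrow>\<^sub>0 int) set) module" where
  "base_change_module R M T =
    \<lparr>carrier = carrier (tensor_group R M T), monoid.mult = undefined, monoid.one = undefined,
     ring.zero = monoid.one (tensor_group R M T), ring.add = monoid.mult (tensor_group R M T),
     module.smult = (\<lambda>s C. \<Union>c \<in> C. tensor_kernel R M T #>\<^bsub>tensor_free M T\<^esub>
       frag_extend (\<lambda>(m, t). frag_of (m, s \<otimes>\<^bsub>T\<^esub> t)) c)\<rparr>"

definition base_change_form ::
  "('a, 'r) ring_scheme \<Rightarrow> ('a, 'm) module \<Rightarrow> ('m \<Rightarrow> 'a) \<Rightarrow> ('a, 't) module \<Rightarrow>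
    ('m \<times> 't \<Rightarrow>\<^sub>0 int) set \<Rightarrow> 't" where
  "base_change_form R M q T =
    (THE Q. Q \<in> extensional (carrier (base_change_module R M T)) \<and>
      quadratic_map T (base_change_module R M T) Q \<and>
      (\<forall>m \<in> carrier M. \<forall>t \<in> carrier T.
        Q (pure_tensor R M T m t) = q m \<odot>\<^bsub>T\<^esub> (t [^]\<^bsub>T\<^esub> (2::nat))) \<and>
      (\<forall>m \<in> carrier M. \<forall>m' \<in> carrier M. \<forall>t \<in> carrier T. \<forall>t' \<in> carrier T.
        polar T (base_change_module R M T) Q (pure_tensor R M T m t) (pure_tensor R M T m' t')
          = polar R M q m m' \<odot>\<^bsub>T\<^esub> (t \<otimes>\<^bsub>T\<^esub> t')))"

text \<open>
  HOL cannot quantify over all types of a field \<open>F\<close>, so carriers are taken in \<^typ>\<open>'a list\<close>, which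
  has at least $\max(|R|,\aleph_0)$ elements. This is no restriction: a nonzero \<open>x\<close> in the radical
  of \<open>q\<^sub>F\<close> for any field \<open>F\<close> already comes from \<open>M \<otimes>\<^sub>R K\<close>, where \<open>K \<subseteq> F\<close> is the subfield generated
  by the image of \<open>R\<close> and the finitely many scalars occurring in an expression for \<open>x\<close>.
  Since \<open>M \<otimes>\<^sub>R K \<longrightarrow> M \<otimes>\<^sub>R F\<close> is injective, \<open>x\<close> also is a nonzero element of the radical of \<open>q\<^sub>K\<close>,
  and $|K| \le \max(|R|,\aleph_0)$, so \<open>K\<close> is isomorphic to a field with carrier in \<^typ>\<open>'a list\<close>.
\<close>

definition nonsingular_form ::
  "('a, 'r) ring_scheme \<Rightarrow> ('a, 'm) module \<Rightarrow> ('m \<Rightarrow> 'a) \<Rightarrow> bool" where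
  "nonsingular_form R M q \<longleftrightarrow> quadratic_form R M q \<and>
    (\<forall>F :: ('a, 'a list) module. algebra R F \<and> field F \<longrightarrow>
      radical F (base_change_module R M F) (base_change_form R M q F)
        = {\<zero>\<^bsub>base_change_module R M F\<^esub>})"


section \<open>Orthogonal sums and isometries\<close>

definition direct_sum :: "('a, 'm) module \<Rightarrow> ('a, 'n) module \<Rightarrow> ('a, 'm \<times> 'n) module" where
  "direct_sum M N =
    \<lparr>carrier = carrier M \<times> carrier N, monoid.mult = undefined, monoid.one = undefined,
     ring.zero = (\<zero>\<^bsub>M\<^esub>, \<zero>\<^bsub>N\<^esub>),
     ring.add = (\<lambda>(x, y) (x', y'). (x \<oplus>\<^bsub>M\<^esub> x', y \<oplus>\<^bsub>N\<^esub> y')),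
     module.smult = (\<lambda>r (x, y). (r \<odot>\<^bsub>M\<^esub> x, r \<odot>\<^bsub>N\<^esub> y))\<rparr>"

definition orthogonal_sum ::
  "('a, 'r) ring_scheme \<Rightarrow> ('m \<Rightarrow> 'a) \<Rightarrow> ('n \<Rightarrow> 'a) \<Rightarrow> 'm \<times> 'n \<Rightarrow> 'a" where
  "orthogonal_sum R q q' = (\<lambda>(x, y). q x \<oplus>\<^bsub>R\<^esub> q' y)"

definition isometry ::
  "('a, 'r) ring_scheme \<Rightarrow> ('a, 'm) module \<Rightarrow> ('m \<Rightarrow> 'a) \<Rightarrow>
    ('a, 'n) module \<Rightarrow> ('n \<Rightarrow> 'a) \<Rightarrow> ('m \<Rightarrow> 'n) \<Rightarrow> bool" where
  "isometry R M q N q' f \<longleftrightarrow> linear_map R M N f \<and> bij_betw f (carrier M) (carrier N) \<and>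
    (\<forall>x \<in> carrier M. q' (f x) = q x)"

definition isometric ::
  "('a, 'r) ring_scheme \<Rightarrow> ('a, 'm) module \<Rightarrow> ('m \<Rightarrow> 'a) \<Rightarrow>
    ('a, 'n) module \<Rightarrow> ('n \<Rightarrow> 'a) \<Rightarrow> bool" where
  "isometric R M q N q' \<longleftrightarrow> (\<exists>f. isometry R M q N q' f)"

end

theory Submission
  imports Defs
begin

text \<open>
  The form \<open>q\<^sub>3\<close> is first traded for hyperbolic planes, and these are then cancelled one at a time.

  \<^bold>\<open>Trading.\<close> A finitely generated projective module has a dual basis \<open>g\<^sub>i, \<phi>\<^sub>i\<close>. Expanding
  \<open>q\<^sub>3(\<Sum>\<^sub>i \<phi>\<^sub>i(x) g\<^sub>i)\<close> writes \<open>q\<^sub>3(x)\<close> as \<open>\<Sum>\<^sub>i \<phi>\<^sub>i(x) \<psi>\<^sub>i(x)\<close> with linear \<open>\<psi>\<^sub>i\<close>, so \<open>M\<^sub>3\<close> embeds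
  isometrically into the hyperbolic space \<open>H\<^sup>n = R\<^sup>n \<oplus> R\<^sup>n\<close> (\<open>regular_embeds_hyperbolic\<close>).
  Regularity makes the image an orthogonal summand, and adding its complement on both sides gives
  \<open>q\<^sub>1 \<bottom> H\<^sup>n \<cong> q\<^sub>2 \<bottom> H\<^sup>n\<close> (\<open>isometric_orthogonal_sum_enlarge\<close>).

  \<^bold>\<open>Cancelling.\<close> It remains to see that two hyperbolic pairs \<open>(u, v)\<close> and \<open>(e, f)\<close> of the same
  quadratic space have isometric orthogonal complements. The complement of a pair \<open>(u, v)\<close> with
  \<open>u\<close> isotropic and \<open>b(u, v)\<close> a unit is isometric to \<open>u\<^sup>\<bottom>/Ru\<close>, hence does not depend on \<open>v\<close>
  (\<open>perp_isometric_common\<close>). So it suffices to find an isotropic \<open>w\<close> pairing to a unit with both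
  \<open>u\<close> and \<open>e\<close>. The vectors \<open>w = f + m - q(m) e\<close> with \<open>m\<close> orthogonal to \<open>e\<close> and \<open>f\<close> are isotropic with
  \<open>b(e, w) = 1\<close>, and \<open>b(u, w)\<close> is a polynomial in the coordinates of \<open>m\<close>. The LG property reduces the
  search for \<open>m\<close> to the residue fields (\<open>unit_partner\<close>). There it succeeds unless \<open>b(u, f) = 0\<close> and
  \<open>q\<close> vanishes on the complement of \<open>(e, f)\<close> (\<open>partner_pairing_not_in_maximal\<close>).

  \<^bold>\<open>The exceptional locus.\<close> When nothing but \<open>q\<^sub>2\<close> is left beside the last plane, nonsingularity
  says that \<open>q\<^sub>2\<close> vanishes modulo a maximal ideal \<open>I\<close> only if \<open>M\<^sub>2 = I M\<^sub>2\<close>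
  (\<open>nonsingular_form_zero_mod_maximal\<close>). Since \<open>M\<^sub>2\<close> is projective, these \<open>I\<close> form an open and
  closed set, cut out by an idempotent \<open>a\<close> with \<open>a M\<^sub>2 = 0\<close> (\<open>annihilating_idempotent\<close>). On this set
  the whole space is a hyperbolic plane, with just two isotropic lines, and \<open>u\<close> is made to
  lie on the correct one by swapping \<open>u\<close> and \<open>v\<close> where necessary (\<open>idempotent_mixing\<close>).
\<close>

section \<open>Polynomial functions on an LG-ring\<close>

context cring
begin

lemma indexed_pset_finite_support:
  "f \<in> indexed_pset I (carrier R) \<Longrightarrow> finite {\<mu>. f \<mu> \<noteq> \<zero>}"
proof (induction rule: indexed_pset.induct)
  case (indexed_const k)
  show ?case by (rule finite_subset[of _ "{{#}}"]) (auto simp: indexed_const_def)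
next
  case (indexed_padd P Q)
  show ?case
    by (rule finite_subset[OF _ finite_UnI[OF indexed_padd.IH]]) (auto simp: indexed_padd_def)
next
  case (indexed_pmult P i)
  show ?case
  proof (rule finite_subset[OF _ finite_imageI[OF indexed_pmult.IH, of "add_mset i"]])
    show "{\<mu>. (P \<Otimes> i) \<mu> \<noteq> \<zero>} \<subseteq> add_mset i ` {\<mu>. P \<mu> \<noteq> \<zero>}"
      by (auto simp: indexed_pmult_def image_iff split: if_splits intro!: exI[of _ "_ - {#i#}"])
  qed
qed

text \<open>Supports of different polynomials are compared by summing over a common finite set.\<close>

lemma mpoly_eval_superset:
  assumes A: "finite A" "{\<mu>. f \<mu> \<noteq> \<zero>} \<subseteq> A" and f: "\<And>\<mu>. f \<mu> \<in> carrier R"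
    and x: "x \<in> {..<n} \<rightarrow> carrier R"
  shows "mpoly_eval R n f x = (\<Oplus>\<mu> \<in> A. f \<mu> \<otimes> (\<Otimes>i \<in> {..<n}. x i [^] count \<mu> i))"
proof -
  have t: "(\<Otimes>i \<in> {..<n}. x i [^] count \<mu> i) \<in> carrier R" for \<mu>
    using x by (intro finprod_closed) auto
  show ?thesis unfolding mpoly_eval_def
    by (rule add.finprod_mono_neutral_cong_left) (use A f t in auto)
qed

lemma mpoly_eval_const:
  assumes "k \<in> carrier R" "x \<in> {..<n} \<rightarrow> carrier R"
  shows "mpoly_eval R n (indexed_const k) x = k"
proof -
  have "mpoly_eval R n (indexed_const k) x = (\<Oplus>\<mu> \<in> {{#}}. indexed_const k \<mu> \<otimes> (\<Otimes>i \<in> {..<n}. x i [^] count \<mu> i))"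
    using assms by (intro mpoly_eval_superset) (auto simp: indexed_const_def)
  also have "\<dots> = k" using assms by (simp add: indexed_const_def)
  finally show ?thesis .
qed

lemma indexed_pset_coeff: "f \<in> indexed_pset I (carrier R) \<Longrightarrow> f \<mu> \<in> carrier R"
  using indexed_pset_in_carrier[of "carrier R" f I] carrier_coeffE by auto

lemma mpoly_eval_padd:
  assumes P: "P \<in> indexed_pset I (carrier R)" and Q: "Q \<in> indexed_pset I (carrier R)"
    and x: "x \<in> {..<n} \<rightarrow> carrier R"
  shows "mpoly_eval R n (P \<Oplus> Q) x = mpoly_eval R n P x \<oplus> mpoly_eval R n Q x"
proof -
  define A where "A = {\<mu>. P \<mu> \<noteq> \<zero>} \<union> {\<mu>. Q \<mu> \<noteq> \<zero>}"
  have A: "finite A" using P Q by (auto simp: A_def indexed_pset_finite_support)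
  note c = indexed_pset_coeff[OF P] indexed_pset_coeff[OF Q]
  have t: "(\<Otimes>i \<in> {..<n}. x i [^] count \<mu> i) \<in> carrier R" for \<mu>
    using x by (intro finprod_closed) auto
  have "mpoly_eval R n (P \<Oplus> Q) x = (\<Oplus>\<mu> \<in> A. (P \<Oplus> Q) \<mu> \<otimes> (\<Otimes>i \<in> {..<n}. x i [^] count \<mu> i))"
    using A c x by (intro mpoly_eval_superset) (auto simp: A_def indexed_padd_def)
  also have "\<dots> = (\<Oplus>\<mu> \<in> A. P \<mu> \<otimes> (\<Otimes>i \<in> {..<n}. x i [^] count \<mu> i)
      \<oplus> Q \<mu> \<otimes> (\<Otimes>i \<in> {..<n}. x i [^] count \<mu> i))"
    using c t by (simp add: indexed_padd_def l_distr)
  also have "\<dots> = (\<Oplus>\<mu> \<in> A. P \<mu> \<otimes> (\<Otimes>i \<in> {..<n}. x i [^] count \<mu> i))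
      \<oplus> (\<Oplus>\<mu> \<in> A. Q \<mu> \<otimes> (\<Otimes>i \<in> {..<n}. x i [^] count \<mu> i))"
    using c t by (intro finsum_addf) auto
  also have "(\<Oplus>\<mu> \<in> A. P \<mu> \<otimes> (\<Otimes>i \<in> {..<n}. x i [^] count \<mu> i)) = mpoly_eval R n P x"
    using A c x by (intro mpoly_eval_superset[symmetric]) (auto simp: A_def)
  also have "(\<Oplus>\<mu> \<in> A. Q \<mu> \<otimes> (\<Otimes>i \<in> {..<n}. x i [^] count \<mu> i)) = mpoly_eval R n Q x"
    using A c x by (intro mpoly_eval_superset[symmetric]) (auto simp: A_def)
  finally show ?thesis .
qed

lemma mpoly_eval_pmult:
  assumes P: "P \<in> indexed_pset I (carrier R)" and i: "i < n"
    and x: "x \<in> {..<n} \<rightarrow> carrier R"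
  shows "mpoly_eval R n (P \<Otimes> i) x = mpoly_eval R n P x \<otimes> x i"
proof -
  define A where "A = {\<mu>. P \<mu> \<noteq> \<zero>}"
  have A: "finite A" using P by (auto simp: A_def indexed_pset_finite_support)
  note c = indexed_pset_coeff[OF P]
  have xi: "x i \<in> carrier R" using x i by auto
  have t: "(\<Otimes>j \<in> {..<n}. x j [^] count \<mu> j) \<in> carrier R" for \<mu>
    using x by (intro finprod_closed) auto
  have step: "(\<Otimes>j \<in> {..<n}. x j [^] count (add_mset i \<mu>) j) = (\<Otimes>j \<in> {..<n}. x j [^] count \<mu> j) \<otimes> x i" for \<mu>
  proof -
    have "(\<Otimes>j \<in> {..<n}. x j [^] count (add_mset i \<mu>) j)
      = (\<Otimes>j \<in> {..<n}. x j [^] count \<mu> j \<otimes> (if j = i then x j else \<one>))"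
      using x xi by (intro finprod_cong') (auto simp: Pi_def)
    also have "\<dots> = (\<Otimes>j \<in> {..<n}. x j [^] count \<mu> j) \<otimes> (\<Otimes>j \<in> {..<n}. if j = i then x j else \<one>)"
      using x by (intro finprod_multf) auto
    also have "(\<Otimes>j \<in> {..<n}. if j = i then x j else \<one>) = x i"
      using x i by (intro finprod_singleton_swap) auto
    finally show ?thesis .
  qed
  have "mpoly_eval R n (P \<Otimes> i) x = (\<Oplus>\<mu> \<in> add_mset i ` A. (P \<Otimes> i) \<mu> \<otimes> (\<Otimes>j \<in> {..<n}. x j [^] count \<mu> j))"
    using A c x
    by (intro mpoly_eval_superset)
      (auto simp: A_def indexed_pmult_def image_iff split: if_splits intro!: exI[of _ "_ - {#i#}"])
  also have "\<dots> = (\<Oplus>\<mu> \<in> A. (P \<Otimes> i) (add_mset i \<mu>) \<otimes> (\<Otimes>j \<in> {..<n}. x j [^] count (add_mset i \<mu>) j))"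
    using c t by (intro finsum_reindex) (auto simp: indexed_pmult_def inj_on_def)
  also have "\<dots> = (\<Oplus>\<mu> \<in> A. (P \<mu> \<otimes> (\<Otimes>j \<in> {..<n}. x j [^] count \<mu> j)) \<otimes> x i)"
    using c t xi unfolding step
    by (intro finsum_cong') (auto simp: indexed_pmult_def m_assoc)
  also have "\<dots> = (\<Oplus>\<mu> \<in> A. P \<mu> \<otimes> (\<Otimes>j \<in> {..<n}. x j [^] count \<mu> j)) \<otimes> x i"
    using A c t xi by (intro finsum_ldistr[symmetric]) auto
  also have "(\<Oplus>\<mu> \<in> A. P \<mu> \<otimes> (\<Otimes>j \<in> {..<n}. x j [^] count \<mu> j)) = mpoly_eval R n P x"
    using A c x by (intro mpoly_eval_superset[symmetric]) (auto simp: A_def)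
  finally show ?thesis .
qed

lemma mpoly_eval_Quot:
  assumes I: "ideal I R" and f: "f \<in> indexed_pset J (carrier R)" and x: "x \<in> {..<n} \<rightarrow> carrier R"
  shows "mpoly_eval (R Quot I) n (\<lambda>\<mu>. I +> f \<mu>) (\<lambda>i. I +> x i) = I +> mpoly_eval R n f x"
proof -
  interpret h: ring_hom_cring R "R Quot I" "(+>) I"
    using ideal.rcos_ring_hom_cring[OF I] is_cring by simp
  define A where "A = {\<mu>. f \<mu> \<noteq> \<zero>}"
  have A: "finite A" using f by (auto simp: A_def indexed_pset_finite_support)
  note c = indexed_pset_coeff[OF f]
  have t: "(\<Otimes>j \<in> {..<n}. x j [^] count \<mu> j) \<in> carrier R" for \<mu>
    using x by (intro finprod_closed) auto
  have "mpoly_eval (R Quot I) n (\<lambda>\<mu>. I +> f \<mu>) (\<lambda>i. I +> x i)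
    = (\<Oplus>\<^bsub>R Quot I\<^esub>\<mu> \<in> A. (I +> f \<mu>) \<otimes>\<^bsub>R Quot I\<^esub> (\<Otimes>\<^bsub>R Quot I\<^esub>j \<in> {..<n}. (I +> x j) [^]\<^bsub>R Quot I\<^esub> count \<mu> j))"
    using A c x h.hom_zero by (intro h.S.mpoly_eval_superset) (auto simp: A_def)
  also have "\<dots> = (\<Oplus>\<^bsub>R Quot I\<^esub>\<mu> \<in> A. I +> (f \<mu> \<otimes> (\<Otimes>j \<in> {..<n}. x j [^] count \<mu> j)))"
  proof (intro h.S.finsum_cong' refl)
    show "(\<lambda>\<mu>. I +> f \<mu> \<otimes> (\<Otimes>j\<in>{..<n}. x j [^] count \<mu> j)) \<in> A \<rightarrow> carrier (R Quot I)"
      using c t by auto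
    fix \<mu>
    have "(\<Otimes>\<^bsub>R Quot I\<^esub>j \<in> {..<n}. (I +> x j) [^]\<^bsub>R Quot I\<^esub> count \<mu> j) = I +> (\<Otimes>j\<in>{..<n}. x j [^] count \<mu> j)"
      using x by (subst h.hom_finprod) (fastforce, rule h.S.finprod_cong', auto simp: Pi_def)
    then show "(I +> f \<mu>) \<otimes>\<^bsub>R Quot I\<^esub> (\<Otimes>\<^bsub>R Quot I\<^esub>j \<in> {..<n}. (I +> x j) [^]\<^bsub>R Quot I\<^esub> count \<mu> j)
      = I +> (f \<mu> \<otimes> (\<Otimes>j \<in> {..<n}. x j [^] count \<mu> j))"
      using c t by simp
  qed
  also have "\<dots> = I +> mpoly_eval R n f x"
    unfolding mpoly_eval_def A_def[symmetric]
    using c t by (subst h.hom_finsum) (auto simp: o_def)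
  finally show ?thesis .
qed

definition polyfun :: "nat \<Rightarrow> ((nat \<Rightarrow> 'a) \<Rightarrow> 'a) \<Rightarrow> bool" where
  "polyfun n F \<longleftrightarrow> (\<exists>f \<in> indexed_pset {..<n} (carrier R).
    \<forall>x \<in> {..<n} \<rightarrow> carrier R. mpoly_eval R n f x = F x)"

lemma polyfun_const: "k \<in> carrier R \<Longrightarrow> polyfun n (\<lambda>x. k)"
  unfolding polyfun_def
  by (rule bexI[of _ "indexed_const k"]) (auto simp: mpoly_eval_const indexed_pset.indexed_const)

lemma polyfun_add:
  assumes "polyfun n F" "polyfun n G" shows "polyfun n (\<lambda>x. F x \<oplus> G x)"
proof -
  obtain f g where "f \<in> indexed_pset {..<n} (carrier R)" "g \<in> indexed_pset {..<n} (carrier R)"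
    "\<forall>x \<in> {..<n} \<rightarrow> carrier R. mpoly_eval R n f x = F x"
    "\<forall>x \<in> {..<n} \<rightarrow> carrier R. mpoly_eval R n g x = G x"
    using assms unfolding polyfun_def by auto
  then show ?thesis unfolding polyfun_def
    by (intro bexI[of _ "f \<Oplus> g"]) (auto simp: mpoly_eval_padd indexed_pset.indexed_padd)
qed

lemma polyfun_mult_var:
  assumes "polyfun n F" "i < n" shows "polyfun n (\<lambda>x. F x \<otimes> x i)"
proof -
  obtain f where "f \<in> indexed_pset {..<n} (carrier R)"
    "\<forall>x \<in> {..<n} \<rightarrow> carrier R. mpoly_eval R n f x = F x"
    using assms unfolding polyfun_def by auto
  then show ?thesis unfolding polyfun_def using assms(2)
    by (intro bexI[of _ "f \<Otimes> i"]) (auto simp: mpoly_eval_pmult indexed_pset.indexed_pmult)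
qed

lemma polyfun_cong:
  assumes "polyfun n F" "\<And>x. x \<in> {..<n} \<rightarrow> carrier R \<Longrightarrow> F x = G x" shows "polyfun n G"
  using assms unfolding polyfun_def by auto

text \<open>
  This is the form in which the LG property is used: since a tuple over \<open>R/I\<close> lifts to \<open>R\<close>, both
  sides of its defining equivalence can be read off from the values of \<open>F\<close> on tuples over \<open>R\<close>.
\<close>

lemma polyfun_unit_value:
  assumes LG: "LG_ring R" and F: "polyfun n F"
    and loc: "\<And>I. maximalideal I R \<Longrightarrow> \<exists>x \<in> {..<n} \<rightarrow> carrier R. F x \<notin> I"
  shows "\<exists>x \<in> {..<n} \<rightarrow> carrier R. F x \<in> Units R"
proof -
  obtain f where f: "f \<in> indexed_pset {..<n} (carrier R)"
    and fF: "\<And>x. x \<in> {..<n} \<rightarrow> carrier R \<Longrightarrow> mpoly_eval R n f x = F x"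
    using F unfolding polyfun_def by auto
  have "\<exists>x \<in> {..<n} \<rightarrow> carrier (R Quot I).
      mpoly_eval (R Quot I) n (\<lambda>\<mu>. I +> f \<mu>) x \<noteq> \<zero>\<^bsub>R Quot I\<^esub>" if I: "maximalideal I R" for I
  proof -
    interpret maximalideal I R by fact
    obtain x where x: "x \<in> {..<n} \<rightarrow> carrier R" and FxI: "F x \<notin> I"
      using loc[OF I] by auto
    have "mpoly_eval R n f x \<in> carrier R" unfolding mpoly_eval_def
      using x indexed_pset_coeff[OF f] by (intro finsum_closed Pi_I m_closed finprod_closed) auto
    then have "F x \<in> carrier R" using fF[OF x] by simp
    then have "I +> F x \<noteq> \<zero>\<^bsub>R Quot I\<^esub>"
      using FxI rcos_const_imp_mem by (auto simp: FactRing_def)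
    then have "mpoly_eval (R Quot I) n (\<lambda>\<mu>. I +> f \<mu>) (\<lambda>i. I +> x i) \<noteq> \<zero>\<^bsub>R Quot I\<^esub>"
      using mpoly_eval_Quot[OF is_ideal f x] fF[OF x] by simp
    moreover have "(\<lambda>i. I +> x i) \<in> {..<n} \<rightarrow> carrier (R Quot I)"
      using x by (auto simp: FactRing_def A_RCOSETS_def RCOSETS_def a_r_coset_def)
    ultimately show ?thesis by blast
  qed
  then have "\<exists>x \<in> {..<n} \<rightarrow> carrier R. mpoly_eval R n f x \<in> Units R"
    using LG f unfolding LG_ring_def by blast
  then show ?thesis using fF by auto
qed

end

section \<open>Quadratic spaces and complements of pairs of vectors\<close>

locale quadratic_space = module R M for R (structure) and M :: "('a, 'c) module" (structure) +
  fixes q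
  assumes quadratic: "quadratic_map R M q"
begin

abbreviation b where "b \<equiv> polar R M q"

lemma q_closed [simp, intro]: "x \<in> carrier M \<Longrightarrow> q x \<in> carrier R"
  using quadratic by (auto simp: quadratic_map_def)

lemma q_smult: "\<lbrakk>r \<in> carrier R; x \<in> carrier M\<rbrakk> \<Longrightarrow> q (r \<odot>\<^bsub>M\<^esub> x) = r [^] (2::nat) \<otimes> q x"
  using quadratic by (auto simp: quadratic_map_def)

lemma b_closed [simp, intro]: "\<lbrakk>x \<in> carrier M; y \<in> carrier M\<rbrakk> \<Longrightarrow> b x y \<in> carrier R"
  by (simp add: polar_def)

lemma b_add_right: "\<lbrakk>x \<in> carrier M; y \<in> carrier M; z \<in> carrier M\<rbrakk> \<Longrightarrow>
    b x (y \<oplus>\<^bsub>M\<^esub> z) = b x y \<oplus> b x z"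
  using quadratic by (auto simp: quadratic_map_def bilinear_form_def linear_map_def self_module_def)

lemma b_add_left: "\<lbrakk>x \<in> carrier M; y \<in> carrier M; z \<in> carrier M\<rbrakk> \<Longrightarrow>
    b (x \<oplus>\<^bsub>M\<^esub> y) z = b x z \<oplus> b y z"
  using quadratic by (auto simp: quadratic_map_def bilinear_form_def linear_map_def self_module_def)

lemma b_smult_right: "\<lbrakk>r \<in> carrier R; x \<in> carrier M; y \<in> carrier M\<rbrakk> \<Longrightarrow>
    b x (r \<odot>\<^bsub>M\<^esub> y) = r \<otimes> b x y"
  using quadratic by (auto simp: quadratic_map_def bilinear_form_def linear_map_def self_module_def)

lemma b_smult_left: "\<lbrakk>r \<in> carrier R; x \<in> carrier M; y \<in> carrier M\<rbrakk> \<Longrightarrow>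
    b (r \<odot>\<^bsub>M\<^esub> x) y = r \<otimes> b x y"
  using quadratic by (auto simp: quadratic_map_def bilinear_form_def linear_map_def self_module_def)

lemma b_commute: "\<lbrakk>x \<in> carrier M; y \<in> carrier M\<rbrakk> \<Longrightarrow> b x y = b y x"
  unfolding polar_def using M.a_comm[of x y]
  by (simp add: R.minus_eq R.a_assoc) (simp add: R.a_comm)

lemma q_add: "\<lbrakk>x \<in> carrier M; y \<in> carrier M\<rbrakk> \<Longrightarrow> q (x \<oplus>\<^bsub>M\<^esub> y) = q x \<oplus> q y \<oplus> b x y"
proof -
  assume x: "x \<in> carrier M" and y: "y \<in> carrier M"
  have "q (x \<oplus>\<^bsub>M\<^esub> y) \<in> carrier R" "q x \<in> carrier R" "q y \<in> carrier R"
    using x y by auto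
  then show ?thesis unfolding polar_def by algebra
qed

lemma q_zero [simp]: "q \<zero>\<^bsub>M\<^esub> = \<zero>"
  using q_smult[of \<zero> "\<zero>\<^bsub>M\<^esub>"] by (simp add: numeral_2_eq_2)

lemma b_zero_right [simp]: "x \<in> carrier M \<Longrightarrow> b x \<zero>\<^bsub>M\<^esub> = \<zero>"
  using b_smult_right[of \<zero> x "\<zero>\<^bsub>M\<^esub>"] by simp

lemma b_zero_left [simp]: "x \<in> carrier M \<Longrightarrow> b \<zero>\<^bsub>M\<^esub> x = \<zero>"
  using b_smult_left[of \<zero> "\<zero>\<^bsub>M\<^esub>" x] by simp

lemma b_self: assumes x: "x \<in> carrier M" shows "b x x = q x \<oplus> q x"
proof -
  have xx: "x \<oplus>\<^bsub>M\<^esub> x = (\<one> \<oplus> \<one>) \<odot>\<^bsub>M\<^esub> x"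
    using x by (simp add: smult_l_distr)
  have "q (x \<oplus>\<^bsub>M\<^esub> x) = (q x \<oplus> q x) \<oplus> (q x \<oplus> q x)"
    unfolding xx using x by (simp add: q_smult numeral_2_eq_2 R.l_distr R.r_distr)
  moreover have "q x \<in> carrier R" using x by simp
  ultimately show ?thesis unfolding polar_def
    by (simp add: R.minus_eq R.a_assoc R.r_neg R.r_neg1 R.r_neg2)
qed

lemma b_isotropic: "\<lbrakk>x \<in> carrier M; q x = \<zero>\<rbrakk> \<Longrightarrow> b x x = \<zero>"
  by (simp add: b_self)

lemmas b_simps = b_add_right b_add_left b_smult_right b_smult_left

definition perp :: "'c \<Rightarrow> 'c \<Rightarrow> 'c set" where
  "perp u v = {x \<in> carrier M. b u x = \<zero> \<and> b v x = \<zero>}"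

lemma perp_commute: "perp u v = perp v u"
  by (auto simp: perp_def)

abbreviation perp_isometric where
  "perp_isometric u v u' v' \<equiv> isometric R (M\<lparr>carrier := perp u v\<rparr>) q (M\<lparr>carrier := perp u' v'\<rparr>) q"

lemma M_add_cancel: "\<lbrakk>x \<in> carrier M; y \<in> carrier M; r \<in> carrier R\<rbrakk> \<Longrightarrow>
  (x \<oplus>\<^bsub>M\<^esub> r \<odot>\<^bsub>M\<^esub> y) \<oplus>\<^bsub>M\<^esub> (\<ominus> r) \<odot>\<^bsub>M\<^esub> y = x"
  by (simp add: M.a_assoc M.r_neg smult_l_minus)

lemma M_add_cancel': "\<lbrakk>x \<in> carrier M; y \<in> carrier M; r \<in> carrier R\<rbrakk> \<Longrightarrow>
  (x \<oplus>\<^bsub>M\<^esub> (\<ominus> r) \<odot>\<^bsub>M\<^esub> y) \<oplus>\<^bsub>M\<^esub> r \<odot>\<^bsub>M\<^esub> y = x"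
  by (simp add: M.a_assoc M.l_neg smult_l_minus)

text \<open>
  Both complements map isomorphically to \<open>u\<^sup>\<bottom>/Ru\<close>; the map moves \<open>x\<close> inside its class modulo \<open>u\<close>.
\<close>

lemma perp_isometric_common:
  assumes u: "u \<in> carrier M" and v: "v \<in> carrier M" and w: "w \<in> carrier M"
    and qu: "q u = \<zero>" and uv: "b u v \<in> Units R" and uw: "b u w \<in> Units R"
  shows "perp_isometric u v u w"
proof -
  define s where "s y x = \<ominus> (inv (b u y) \<otimes> b y x)" for y x
  define f where "f y x = x \<oplus>\<^bsub>M\<^esub> s y x \<odot>\<^bsub>M\<^esub> u" for y x
  have s[simp]: "s y x \<in> carrier R" if "y \<in> carrier M" "b u y \<in> Units R" "x \<in> carrier M" for y x
    using that by (simp add: s_def)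
  have bu: "b u u = \<zero>" using u qu by (rule b_isotropic)
  have qf: "q (f y x) = q x"
    if "y \<in> carrier M" "b u y \<in> Units R" "x \<in> carrier M" "b u x = \<zero>" for y x
    using that u unfolding f_def
    by (simp add: q_add q_smult b_smult_right qu b_commute[of x u])
  have buf: "b u (f y x) = \<zero>"
    if "y \<in> carrier M" "b u y \<in> Units R" "x \<in> carrier M" "b u x = \<zero>" for y x
    using that u unfolding f_def by (simp add: b_simps bu)
  have byf: "b y (f y x) = \<zero>"
    if y: "y \<in> carrier M" "b u y \<in> Units R" "x \<in> carrier M" for y x
  proof -
    have "s y x \<otimes> b u y = \<ominus> b y x"
      using y u unfolding s_def
      by (simp add: R.l_minus R.m_assoc R.m_comm[of "b y x"])
        (simp add: R.m_assoc[symmetric])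
    then show ?thesis using y u unfolding f_def
      by (simp add: b_simps b_commute[of y u] R.r_neg)
  qed
  have fp: "f y x \<in> perp u y" if "y \<in> carrier M" "b u y \<in> Units R" "x \<in> carrier M" "b u x = \<zero>" for y x
    using that u buf byf by (auto simp: perp_def) (simp add: f_def)
  have inv: "f y (f z x) = x" if y: "y \<in> carrier M" "b u y \<in> Units R" 
    and z: "z \<in> carrier M" "b u z \<in> Units R" and x: "x \<in> perp u y" for x y z
  proof -
    have x': "x \<in> carrier M" "b u x = \<zero>" "b y x = \<zero>" using x by (auto simp: perp_def)
    have "s y (f z x) = \<ominus> s z x"
      unfolding s_def[of y] f_def using y z x' u
      by (simp add: b_simps b_commute[of y u] R.m_comm[of "s z x"]) (simp add: R.m_assoc[symmetric])
    then show ?thesis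
      unfolding f_def[of y] unfolding f_def using x' u z by (simp add: M_add_cancel)
  qed
  have "isometry R (M\<lparr>carrier := perp u v\<rparr>) q (M\<lparr>carrier := perp u w\<rparr>) q (f w)"
    unfolding isometry_def linear_map_def
  proof (intro conjI ballI)
    show "f w \<in> carrier (M\<lparr>carrier := perp u v\<rparr>) \<rightarrow> carrier (M\<lparr>carrier := perp u w\<rparr>)"
      using fp[OF w uw] by (auto simp: perp_def)
    show "bij_betw (f w) (carrier (M\<lparr>carrier := perp u v\<rparr>)) (carrier (M\<lparr>carrier := perp u w\<rparr>))"
      using fp[OF w uw] fp[OF v uv] inv[OF w uw v uv] inv[OF v uv w uw]
      by (intro bij_betw_byWitness[where f' = "f v"]) (auto, auto simp: perp_def)
  next
    fix x y assume x: "x \<in> carrier (M\<lparr>carrier := perp u v\<rparr>)" and y: "y \<in> carrier (M\<lparr>carrier := perp u v\<rparr>)"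
    then have x: "x \<in> carrier M" and y: "y \<in> carrier M" by (auto simp: perp_def)
    have i: "b u w \<in> carrier R" "inv (b u w) \<in> carrier R" using uw by auto
    have bw: "b w x \<in> carrier R" "b w y \<in> carrier R" using x y w by auto
    have "s w (x \<oplus>\<^bsub>M\<^esub> y) = s w x \<oplus> s w y"
      using i bw x y w unfolding s_def by (simp add: b_simps R.r_distr R.minus_add)
    then show "f w (x \<oplus>\<^bsub>M\<lparr>carrier := perp u v\<rparr>\<^esub> y) = f w x \<oplus>\<^bsub>M\<lparr>carrier := perp u w\<rparr>\<^esub> f w y"
      using x y w u uw by (simp add: f_def smult_l_distr M.a_ac)
  next
    fix r x assume r: "r \<in> carrier R" and x: "x \<in> carrier (M\<lparr>carrier := perp u v\<rparr>)"
    then have x: "x \<in> carrier M" by (auto simp: perp_def)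
    have i: "b u w \<in> carrier R" "inv (b u w) \<in> carrier R" using uw by auto
    have bw: "b w x \<in> carrier R" using x w by auto
    have "s w (r \<odot>\<^bsub>M\<^esub> x) = r \<otimes> s w x"
      using i bw x w r unfolding s_def by (simp add: b_simps R.r_minus R.m_lcomm)
    then show "f w (r \<odot>\<^bsub>M\<lparr>carrier := perp u v\<rparr>\<^esub> x) = r \<odot>\<^bsub>M\<lparr>carrier := perp u w\<rparr>\<^esub> f w x"
      using x r w u uw by (simp add: f_def smult_r_distr smult_assoc1)
  next
    fix x assume "x \<in> carrier (M\<lparr>carrier := perp u v\<rparr>)"
    then show "q (f w x) = q x" using qf[OF w uw] by (auto simp: perp_def)
  qed
  then show ?thesis unfolding isometric_def by blast
qed

end

lemma isometricI: "isometry R M q N q' f \<Longrightarrow> isometric R M q N q'"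
  by (auto simp: isometric_def)

lemma isometric_trans:
  assumes "isometric R M q N q'" "isometric R N q' P q''"
  shows "isometric R M q P q''"
proof -
  obtain f g where f: "isometry R M q N q' f" and g: "isometry R N q' P q'' g"
    using assms by (auto simp: isometric_def)
  have fN: "f x \<in> carrier N" if "x \<in> carrier M" for x
    using f that by (auto simp: isometry_def linear_map_def)
  have "isometry R M q P q'' (g \<circ> f)"
    using f g fN unfolding isometry_def linear_map_def
    by (auto intro: bij_betw_trans)
  then show ?thesis by (auto simp: isometric_def)
qed

context quadratic_space
begin

text \<open>
  The vector \<open>w\<close> is the image of \<open>f\<close> under the Eichler transformation that fixes \<open>e\<close> and is
  determined by \<open>m\<close>.
\<close>

lemma hyperbolic_partner:
  assumes e: "e \<in> carrier M" and f: "f \<in> carrier M" and qe: "q e = \<zero>" and qf: "q f = \<zero>"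
    and ef: "b e f = \<one>" and m: "m \<in> perp e f"
    and w: "w = f \<oplus>\<^bsub>M\<^esub> m \<oplus>\<^bsub>M\<^esub> (\<ominus> q m) \<odot>\<^bsub>M\<^esub> e"
  shows "w \<in> carrier M" "q w = \<zero>" "b e w = \<one>"
    "u \<in> carrier M \<Longrightarrow> b u w = b u f \<oplus> b u m \<ominus> q m \<otimes> b u e"
proof -
  have m': "m \<in> carrier M" "b e m = \<zero>" "b f m = \<zero>" using m by (auto simp: perp_def)
  have fe: "b f e = \<one>" using ef e f b_commute by simp
  have me: "b m e = \<zero>" using m' e b_commute by simp
  show "w \<in> carrier M" using w m' e f by simp
  show "q w = \<zero>" unfolding w using m' e f qe qf
    by (simp add: q_add q_smult b_simps fe me R.r_neg)
  show "b e w = \<one>" unfolding w using m' e f ef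
    by (simp add: b_simps b_isotropic qe)
  show "b u w = b u f \<oplus> b u m \<ominus> q m \<otimes> b u e" if "u \<in> carrier M"
    unfolding w using that m' e f by (simp add: b_simps R.minus_eq R.l_minus)
qed

end

section \<open>Quadratic forms on linear combinations\<close>

context "module"
begin

primrec lincomb :: "nat \<Rightarrow> (nat \<Rightarrow> 'c) \<Rightarrow> (nat \<Rightarrow> 'a) \<Rightarrow> 'c" where
  "lincomb 0 g x = \<zero>\<^bsub>M\<^esub>"
| "lincomb (Suc n) g x = x n \<odot>\<^bsub>M\<^esub> g n \<oplus>\<^bsub>M\<^esub> lincomb n g x"

lemma lincomb_closed:
  "\<lbrakk>x \<in> {..<n} \<rightarrow> carrier R; g \<in> {..<n} \<rightarrow> carrier M\<rbrakk> \<Longrightarrow> lincomb n g x \<in> carrier M"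
  by (induction n) (auto simp: Pi_def)

end

context quadratic_space
begin

lemma polyfun_polar_lincomb:
  assumes y: "y \<in> carrier M" and g: "g \<in> {..<n} \<rightarrow> carrier M" and t: "t \<in> carrier R"
  shows "j \<le> n \<Longrightarrow> R.polyfun n (\<lambda>x. t \<otimes> b y (lincomb j g x))"
proof (induction j)
  case 0
  then show ?case using y t R.polyfun_const[of \<zero>] by simp
next
  case (Suc j)
  have gj: "g j \<in> carrier M" using g Suc.prems by auto
  have "R.polyfun n (\<lambda>x. (t \<otimes> b y (g j)) \<otimes> x j \<oplus> t \<otimes> b y (lincomb j g x))"
    using Suc t y gj by (intro R.polyfun_add R.polyfun_mult_var R.polyfun_const) auto
  then show ?case
  proof (rule R.polyfun_cong)
    fix x assume x: "x \<in> {..<n} \<rightarrow> carrier R"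
    then have x': "x j \<in> carrier R" and l: "lincomb j g x \<in> carrier M"
      using Suc.prems g by (auto intro!: lincomb_closed)
    show "t \<otimes> b y (g j) \<otimes> x j \<oplus> t \<otimes> b y (lincomb j g x) = t \<otimes> b y (lincomb (Suc j) g x)"
      using x' l gj y t by (simp add: b_simps R.r_distr R.m_ac)
  qed
qed

text \<open>
  Adding one vector at a time, the cross term is the linear polynomial of
  \<open>polyfun_polar_lincomb\<close> multiplied by one more variable, so no general products of polynomials
  occur.
\<close>

lemma polyfun_form_lincomb:
  assumes g: "g \<in> {..<n} \<rightarrow> carrier M" and t: "t \<in> carrier R"
  shows "j \<le> n \<Longrightarrow> R.polyfun n (\<lambda>x. t \<otimes> q (lincomb j g x))"
proof (induction j)
  case 0
  then show ?case using t R.polyfun_const[of \<zero>] by simp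
next
  case (Suc j)
  have gj: "g j \<in> carrier M" using g Suc.prems by auto
  have "R.polyfun n (\<lambda>x. ((t \<otimes> q (g j)) \<otimes> x j) \<otimes> x j \<oplus> t \<otimes> q (lincomb j g x) 
      \<oplus> (t \<otimes> b (g j) (lincomb j g x)) \<otimes> x j)"
    using Suc t gj g
    by (intro R.polyfun_add R.polyfun_mult_var R.polyfun_const polyfun_polar_lincomb) auto
  then show ?case
  proof (rule R.polyfun_cong)
    fix x assume x: "x \<in> {..<n} \<rightarrow> carrier R"
    then have x': "x j \<in> carrier R" and l: "lincomb j g x \<in> carrier M"
      using Suc.prems g by (auto intro!: lincomb_closed)
    have c: "q (g j) \<in> carrier R" "q (lincomb j g x) \<in> carrier R" "b (g j) (lincomb j g x) \<in> carrier R"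
      using l gj by auto
    show "((t \<otimes> q (g j)) \<otimes> x j) \<otimes> x j \<oplus> t \<otimes> q (lincomb j g x) 
      \<oplus> (t \<otimes> b (g j) (lincomb j g x)) \<otimes> x j = t \<otimes> q (lincomb (Suc j) g x)"
      using x' l gj c t
      by (simp add: q_add q_smult b_simps R.r_distr R.m_ac numeral_2_eq_2)
  qed
qed

end

section \<open>Cancelling one hyperbolic plane\<close>

lemma (in ideal) minus_memD:
  assumes "x \<ominus> y \<in> I" "y \<in> I" "x \<in> carrier R" shows "x \<in> I"
proof -
  have "y \<in> carrier R" using assms(2) a_subset by auto
  then have "x = (x \<ominus> y) \<oplus> y" using assms(3) by (simp add: minus_eq a_assoc l_neg)
  then show ?thesis using additive_subgroup.a_closed[OF is_additive_subgroup assms(1,2)] by simp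
qed

lemma (in ideal) add_memD:
  assumes "x \<oplus> y \<in> I" "y \<in> I" "x \<in> carrier R" shows "x \<in> I"
proof (rule minus_memD)
  show "x \<ominus> (\<ominus> y) \<in> I" using assms a_subset by (auto simp: minus_eq)
qed (use assms in auto)

lemma (in cring) polarize_linear_quadratic:
  assumes "l \<in> carrier R" "l' \<in> carrier R" "q \<in> carrier R" "q' \<in> carrier R" "p \<in> carrier R" "c \<in> carrier R"
  shows "(l \<oplus> l' \<ominus> (q \<oplus> q' \<oplus> p) \<otimes> c) \<oplus> p \<otimes> c = (l \<ominus> q \<otimes> c) \<oplus> (l' \<ominus> q' \<otimes> c)"
  using assms by (simp add: minus_eq l_distr minus_add a_ac r_neg r_neg1 r_neg2)

context quadratic_space
begin

lemma perp_subset: "perp e f \<subseteq> carrier M"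
  by (auto simp: perp_def)

lemma perp_zero: "\<lbrakk>e \<in> carrier M; f \<in> carrier M\<rbrakk> \<Longrightarrow> \<zero>\<^bsub>M\<^esub> \<in> perp e f"
  by (auto simp: perp_def)

lemma perp_add: "\<lbrakk>e \<in> carrier M; f \<in> carrier M; x \<in> perp e f; y \<in> perp e f\<rbrakk> \<Longrightarrow> x \<oplus>\<^bsub>M\<^esub> y \<in> perp e f"
  by (auto simp: perp_def b_simps)

lemma perp_smult: "\<lbrakk>e \<in> carrier M; f \<in> carrier M; x \<in> perp e f; r \<in> carrier R\<rbrakk> \<Longrightarrow> r \<odot>\<^bsub>M\<^esub> x \<in> perp e f"
  by (auto simp: perp_def b_simps)

lemma perp_lincomb:
  assumes "e \<in> carrier M" "f \<in> carrier M"
  shows "\<lbrakk>x \<in> {..<n} \<rightarrow> carrier R; g \<in> {..<n} \<rightarrow> perp e f\<rbrakk> \<Longrightarrow> lincomb n g x \<in> perp e f"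
proof (induction n)
  case 0
  then show ?case using assms by (simp add: perp_zero)
next
  case (Suc n)
  have "lincomb n g x \<in> perp e f" using Suc by (auto simp: Pi_def)
  then show ?case using assms Suc.prems by (auto intro!: perp_add perp_smult)
qed

lemma perp_decomposition:
  assumes e: "e \<in> carrier M" and f: "f \<in> carrier M" and qe: "q e = \<zero>" and qf: "q f = \<zero>"
    and ef: "b e f = \<one>" and z: "z \<in> carrier M"
  obtains m where "m \<in> perp e f" "z = b z f \<odot>\<^bsub>M\<^esub> e \<oplus>\<^bsub>M\<^esub> b z e \<odot>\<^bsub>M\<^esub> f \<oplus>\<^bsub>M\<^esub> m"
proof
  define m where "m = z \<oplus>\<^bsub>M\<^esub> (\<ominus> b z f) \<odot>\<^bsub>M\<^esub> e \<oplus>\<^bsub>M\<^esub> (\<ominus> b z e) \<odot>\<^bsub>M\<^esub> f"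
  have fe: "b f e = \<one>" using ef e f b_commute by simp
  show "m \<in> perp e f" unfolding perp_def m_def
    using e f z by (auto simp: b_simps b_isotropic qe qf ef fe b_commute[of e z] b_commute[of f z] R.r_neg)
  have mc: "m \<in> carrier M" using e f z by (simp add: m_def)
  have "m \<oplus>\<^bsub>M\<^esub> b z e \<odot>\<^bsub>M\<^esub> f \<oplus>\<^bsub>M\<^esub> b z f \<odot>\<^bsub>M\<^esub> e = z"
    using e f z by (simp add: m_def M_add_cancel')
  then show "z = b z f \<odot>\<^bsub>M\<^esub> e \<oplus>\<^bsub>M\<^esub> b z e \<odot>\<^bsub>M\<^esub> f \<oplus>\<^bsub>M\<^esub> m"
    using mc e f z by (simp add: M.a_ac)
qed

text \<open>
  Suppose that all values \<open>b(u, f) + b(u, m) - q(m) b(u, e)\<close> lie in \<open>I\<close>; then \<open>b(u, f)\<close> does. If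
  \<open>b(u, e)\<close> also lies in \<open>I\<close>, then so do all \<open>b(u, m)\<close>, and \<open>u\<close> is orthogonal to everything modulo
  \<open>I\<close>, against \<open>b(u, v) = 1\<close>. Otherwise polarization puts \<open>b(m, m')\<close> into \<open>I\<close> for all \<open>m, m'\<close>,
  hence \<open>b(u, m)\<close> and finally \<open>q(m)\<close>.
\<close>

lemma partner_pairing_not_in_maximal:
  assumes e: "e \<in> carrier M" and f: "f \<in> carrier M" and qe: "q e = \<zero>" and qf: "q f = \<zero>"
    and ef: "b e f = \<one>"
    and u: "u \<in> carrier M" and v: "v \<in> carrier M" and uv: "b u v = \<one>"
    and I: "maximalideal I R"
    and good: "b u f \<in> I \<Longrightarrow> \<exists>x \<in> perp e f. q x \<notin> I"
  shows "\<exists>m \<in> perp e f. b u f \<oplus> b u m \<ominus> q m \<otimes> b u e \<notin> I"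
proof (rule ccontr)
  assume "\<not> ?thesis"
  then have H: "b u f \<oplus> b u m \<ominus> q m \<otimes> b u e \<in> I" if "m \<in> perp e f" for m using that by auto
  interpret I: maximalideal I R by fact
  interpret P: primeideal I R using R.maximalideal_prime[OF I] .
  have uf: "b u f \<in> I" using H[OF perp_zero[OF e f]] u f e by (simp add: R.minus_eq)
  have H': "b u m \<ominus> q m \<otimes> b u e \<in> I" if m: "m \<in> perp e f" for m
  proof (rule I.add_memD[OF _ uf])
    have m': "m \<in> carrier M" using m by (auto simp: perp_def)
    show c: "b u m \<ominus> q m \<otimes> b u e \<in> carrier R" using m' u e by simp
    show "b u m \<ominus> q m \<otimes> b u e \<oplus> b u f \<in> I"
      using H[OF m] m' u e f by (simp add: R.minus_eq R.a_ac)
  qed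
  show False
  proof (cases "b u e \<in> I")
    case True
    have um: "b u m \<in> I" if m: "m \<in> perp e f" for m
    proof (rule I.minus_memD[OF H'[OF m]])
      show "q m \<otimes> b u e \<in> I" "b u m \<in> carrier R"
        using True m u by (auto simp: perp_def intro: I.I_l_closed)
    qed
    obtain m where m: "m \<in> perp e f" and v_eq: "v = b v f \<odot>\<^bsub>M\<^esub> e \<oplus>\<^bsub>M\<^esub> b v e \<odot>\<^bsub>M\<^esub> f \<oplus>\<^bsub>M\<^esub> m"
      using perp_decomposition[OF e f qe qf ef v] .
    have m': "m \<in> carrier M" using m by (auto simp: perp_def)
    have "b u v = b v f \<otimes> b u e \<oplus> b v e \<otimes> b u f \<oplus> b u m"
      using e f m' u v by (subst v_eq) (simp add: b_simps)
    also have "\<dots> \<in> I" using True uf um[OF m] v f e by (auto intro!: I.a_closed I.I_l_closed)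
    finally show False using uv I.one_imp_carrier I.I_notcarr by simp
  next
    case False
    have polar_in: "b m m' \<in> I" if m: "m \<in> perp e f" and m': "m' \<in> perp e f" for m m'
    proof -
      have c: "m \<in> carrier M" "m' \<in> carrier M" using m m' by (auto simp: perp_def)
      define A where "A z = b u z \<ominus> q z \<otimes> b u e" for z
      have "A (m \<oplus>\<^bsub>M\<^esub> m') \<oplus> b m m' \<otimes> b u e = A m \<oplus> A m'"
      proof -
        have cc: "b u m \<in> carrier R" "b u m' \<in> carrier R" "q m \<in> carrier R" "q m' \<in> carrier R"
          "b m m' \<in> carrier R" "b u e \<in> carrier R" using c u e by auto
        show ?thesis
          using R.polarize_linear_quadratic[OF cc(1-6)] c u e
          unfolding A_def by (simp add: q_add b_simps)
      qed
      moreover have "A m \<in> I" "A m' \<in> I" "A (m \<oplus>\<^bsub>M\<^esub> m') \<in> I"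
        using H' m m' perp_add[OF e f m m'] unfolding A_def by auto
      ultimately have "b m m' \<otimes> b u e \<in> I"
        using I.add_memD[of "b m m' \<otimes> b u e" "A (m \<oplus>\<^bsub>M\<^esub> m')"] c u e
        by (simp add: R.a_comm A_def)
      then show ?thesis using False P.I_prime[of "b m m'" "b u e"] c u e by auto
    qed
    obtain m0 where m0: "m0 \<in> perp e f" and u_eq: "u = b u f \<odot>\<^bsub>M\<^esub> e \<oplus>\<^bsub>M\<^esub> b u e \<odot>\<^bsub>M\<^esub> f \<oplus>\<^bsub>M\<^esub> m0"
      using perp_decomposition[OF e f qe qf ef u] .
    have "q m \<in> I" if m: "m \<in> perp e f" for m
    proof -
      have c: "m \<in> carrier M" "m0 \<in> carrier M" "b e m = \<zero>" "b f m = \<zero>" using m m0 by (auto simp: perp_def)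
      have "b u m = b m0 m" using c e f u by (subst u_eq) (simp add: b_simps)
      then have um: "b u m \<in> I" using polar_in[OF m0 m] by simp
      have "\<ominus> (b u m \<ominus> q m \<otimes> b u e) \<oplus> b u m = q m \<otimes> b u e"
      proof -
        have cc: "b u m \<in> carrier R" "q m \<in> carrier R" "b u e \<in> carrier R" using c u e by auto
        then show ?thesis by (simp add: R.minus_eq R.minus_add R.a_assoc R.a_comm[of "q m \<otimes> b u e"] R.r_neg2 R.r_neg1)
      qed
      then have "q m \<otimes> b u e \<in> I" using I.a_closed[OF I.a_inv_closed[OF H'[OF m]] um] by simp
      then show ?thesis using False P.I_prime[of "q m" "b u e"] c u e by auto
    qed
    then show False using good[OF uf] by auto
  qed
qed

lemma unit_partner:
  assumes LG: "LG_ring R"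
    and e: "e \<in> carrier M" and f: "f \<in> carrier M" and qe: "q e = \<zero>" and qf: "q f = \<zero>"
    and ef: "b e f = \<one>"
    and u: "u \<in> carrier M" and v: "v \<in> carrier M" and uv: "b u v = \<one>"
    and g: "g \<in> {..<n} \<rightarrow> perp e f"
    and span: "\<And>s. s \<in> perp e f \<Longrightarrow> \<exists>x \<in> {..<n} \<rightarrow> carrier R. s = lincomb n g x"
    and good: "\<And>I. \<lbrakk>maximalideal I R; b u f \<in> I\<rbrakk> \<Longrightarrow> \<exists>x \<in> perp e f. q x \<notin> I"
  shows "\<exists>w \<in> carrier M. q w = \<zero> \<and> b e w = \<one> \<and> b u w \<in> Units R"
proof -
  define F where "F x = b u f \<oplus> \<one> \<otimes> b u (lincomb n g x) \<oplus> (\<ominus> b u e) \<otimes> q (lincomb n g x)" for x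
  have gM: "g \<in> {..<n} \<rightarrow> carrier M" using g perp_subset by blast
  have F_eq: "F x = b u f \<oplus> b u (lincomb n g x) \<ominus> q (lincomb n g x) \<otimes> b u e"
    if "x \<in> {..<n} \<rightarrow> carrier R" for x
    using lincomb_closed[OF that gM] u e f
    by (simp add: F_def R.minus_eq R.l_minus R.r_minus R.m_comm)
  have "R.polyfun n F" unfolding F_def
    using u e f gM
    by (intro R.polyfun_add R.polyfun_const polyfun_polar_lincomb polyfun_form_lincomb) auto
  then have "\<exists>x \<in> {..<n} \<rightarrow> carrier R. F x \<in> Units R"
  proof (rule R.polyfun_unit_value[OF LG])
    fix I assume I: "maximalideal I R"
    obtain m where "m \<in> perp e f" "b u f \<oplus> b u m \<ominus> q m \<otimes> b u e \<notin> I"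
      using partner_pairing_not_in_maximal[OF e f qe qf ef u v uv I good[OF I]] by auto
    then show "\<exists>x \<in> {..<n} \<rightarrow> carrier R. F x \<notin> I" using span[of m] F_eq by metis
  qed
  then obtain x where x: "x \<in> {..<n} \<rightarrow> carrier R" and Fx: "F x \<in> Units R"
    by blast
  have m: "lincomb n g x \<in> perp e f" using perp_lincomb[OF e f x g] .
  show ?thesis
    using hyperbolic_partner[OF e f qe qf ef m refl] u Fx F_eq[OF x] by auto
qed

text \<open>Where \<open>d\<close> is \<open>0\<close> the pair is left as it is, where \<open>d\<close> is \<open>1\<close> its members are swapped.\<close>

lemma idempotent_mixing:
  assumes u: "u \<in> carrier M" and v: "v \<in> carrier M" and qu: "q u = \<zero>" and qv: "q v = \<zero>"
    and uv: "b u v = \<one>" and d: "d \<in> carrier R" "d \<otimes> d = d"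
    and u': "u' = (\<one> \<ominus> d) \<odot>\<^bsub>M\<^esub> u \<oplus>\<^bsub>M\<^esub> d \<odot>\<^bsub>M\<^esub> v"
    and v': "v' = d \<odot>\<^bsub>M\<^esub> u \<oplus>\<^bsub>M\<^esub> (\<one> \<ominus> d) \<odot>\<^bsub>M\<^esub> v"
  shows "q u' = \<zero>" "q v' = \<zero>" "b u' v' = \<one>" "perp u' v' = perp u v"
proof -
  have vu: "b v u = \<one>" using uv b_commute u v by simp
  have d': "\<one> \<ominus> d \<in> carrier R" using d by simp
  have dd: "(\<one> \<ominus> d) \<otimes> d = \<zero>" "d \<otimes> (\<one> \<ominus> d) = \<zero>"
    using d by (simp_all add: R.minus_eq R.l_distr R.r_distr R.l_minus R.r_minus R.r_neg)
  have dd': "(\<one> \<ominus> d) \<otimes> (\<one> \<ominus> d) = \<one> \<ominus> d"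
    using dd d by (subst R.minus_eq) (simp add: R.l_distr R.l_minus dd)
  have sum1: "(\<one> \<ominus> d) \<oplus> d = \<one>" "d \<oplus> (\<one> \<ominus> d) = \<one>"
    using d by (simp_all add: R.minus_eq R.a_assoc R.l_neg R.a_lcomm[of d] R.r_neg)
  show "q u' = \<zero>" unfolding u' using u v d d' qu qv uv dd
    by (simp add: q_add q_smult b_simps)
  show "q v' = \<zero>" unfolding v' using u v d d' qu qv uv dd
    by (simp add: q_add q_smult b_simps)
  show "b u' v' = \<one>" unfolding u' v' using u v d d' qu qv uv vu dd dd' sum1
    by (simp add: b_simps b_isotropic)
  show "perp u' v' = perp u v"
  proof (intro equalityI subsetI)
    fix x assume "x \<in> perp u v"
    then show "x \<in> perp u' v'" unfolding u' v' using u v d d' by (auto simp: perp_def b_simps)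
  next
    fix x assume x: "x \<in> perp u' v'"
    then have xM: "x \<in> carrier M" by (auto simp: perp_def)
    have bu: "b u x \<in> carrier R" and bv: "b v x \<in> carrier R" using u v xM by auto
    have 1: "(\<one> \<ominus> d) \<otimes> b u x \<oplus> d \<otimes> b v x = \<zero>" and 2: "d \<otimes> b u x \<oplus> (\<one> \<ominus> d) \<otimes> b v x = \<zero>"
      using x u v d d' unfolding u' v' by (auto simp: perp_def b_simps)
    have "b u x = ((\<one> \<ominus> d) \<otimes> (\<one> \<ominus> d) \<oplus> d \<otimes> d) \<otimes> b u x" using d dd' sum1 bu by simp
    also have "\<dots> = (\<one> \<ominus> d) \<otimes> ((\<one> \<ominus> d) \<otimes> b u x \<oplus> d \<otimes> b v x) \<oplus> d \<otimes> (d \<otimes> b u x \<oplus> (\<one> \<ominus> d) \<otimes> b v x)"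
      using d d' bu bv dd by (simp add: R.l_distr R.r_distr R.m_assoc[symmetric] R.a_ac)
    also have "\<dots> = \<zero>" using 1 2 d d' by simp
    finally have u0: "b u x = \<zero>" .
    have "b v x = (d \<otimes> d \<oplus> (\<one> \<ominus> d) \<otimes> (\<one> \<ominus> d)) \<otimes> b v x" using d dd' sum1 bv by simp
    also have "\<dots> = d \<otimes> ((\<one> \<ominus> d) \<otimes> b u x \<oplus> d \<otimes> b v x) \<oplus> (\<one> \<ominus> d) \<otimes> (d \<otimes> b u x \<oplus> (\<one> \<ominus> d) \<otimes> b v x)"
      using d d' bu bv dd by (simp add: R.l_distr R.r_distr R.m_assoc[symmetric] R.a_ac)
    also have "\<dots> = \<zero>" using 1 2 d d' by simp
    finally show "x \<in> perp u v" using u0 xM by (auto simp: perp_def)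
  qed
qed

text \<open>
  Where \<open>a = 1\<close>, the space is the plane spanned by \<open>e\<close> and \<open>f\<close>, and \<open>u\<close> is a multiple of \<open>e\<close> or of
  \<open>f\<close>. In the second case \<open>u\<close> and \<open>v\<close> have to be swapped. The products \<open>a b(u, f) b(v, e)\<close> and
  \<open>d = a b(u, e) b(v, f)\<close> are orthogonal idempotents with sum \<open>a\<close>, and \<open>d\<close> marks the second case.
\<close>

theorem hyperbolic_pair_complements_isometric:
  assumes LG: "LG_ring R"
    and e: "e \<in> carrier M" and f: "f \<in> carrier M" and qe: "q e = \<zero>" and qf: "q f = \<zero>"
    and ef: "b e f = \<one>"
    and u: "u \<in> carrier M" and v: "v \<in> carrier M" and qu: "q u = \<zero>" and qv: "q v = \<zero>"
    and uv: "b u v = \<one>"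
    and g: "g \<in> {..<n} \<rightarrow> perp e f"
    and span: "\<And>s. s \<in> perp e f \<Longrightarrow> \<exists>x \<in> {..<n} \<rightarrow> carrier R. s = lincomb n g x"
    and a: "a \<in> carrier R" "a \<otimes> a = a" and ann: "\<And>x. x \<in> perp e f \<Longrightarrow> a \<odot>\<^bsub>M\<^esub> x = \<zero>\<^bsub>M\<^esub>"
    and supp: "\<And>I. \<lbrakk>maximalideal I R; a \<in> I\<rbrakk> \<Longrightarrow> \<exists>x \<in> perp e f. q x \<notin> I"
  shows "perp_isometric u v e f"
proof -
  define d where "d = a \<otimes> (b u e \<otimes> b v f)"
  define u' where "u' = (\<one> \<ominus> d) \<odot>\<^bsub>M\<^esub> u \<oplus>\<^bsub>M\<^esub> d \<odot>\<^bsub>M\<^esub> v"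
  define v' where "v' = d \<odot>\<^bsub>M\<^esub> u \<oplus>\<^bsub>M\<^esub> (\<one> \<ominus> d) \<odot>\<^bsub>M\<^esub> v"
  have c: "b u e \<in> carrier R" "b u f \<in> carrier R" "b v e \<in> carrier R" "b v f \<in> carrier R"
    using u v e f by auto
  have dR: "d \<in> carrier R" using c a by (simp add: d_def)
  have fe: "b f e = \<one>" using ef e f b_commute by simp
  obtain m where m: "m \<in> perp e f" and u_eq: "u = b u f \<odot>\<^bsub>M\<^esub> e \<oplus>\<^bsub>M\<^esub> b u e \<odot>\<^bsub>M\<^esub> f \<oplus>\<^bsub>M\<^esub> m"
    using perp_decomposition[OF e f qe qf ef u] .
  have mM: "m \<in> carrier M" and em: "b e m = \<zero>" and fm: "b f m = \<zero>" using m by (auto simp: perp_def)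
  have a_iso: "a \<otimes> (b u f \<otimes> b u e) = \<zero>"
  proof -
    have "q u = b u f \<otimes> b u e \<oplus> q m"
      using e f mM u c by (subst u_eq) (simp add: q_add q_smult b_simps qe qf ef em fm R.m_comm)
    then have "a \<otimes> \<zero> = a \<otimes> (b u f \<otimes> b u e \<oplus> q m)" using qu by simp
    also have "\<dots> = a \<otimes> (b u f \<otimes> b u e) \<oplus> a \<otimes> q m" using a c mM by (simp add: R.r_distr)
    also have "a \<otimes> q m = a [^] (2::nat) \<otimes> q m" using a by (simp add: numeral_2_eq_2)
    also have "\<dots> = \<zero>" using q_smult[OF a(1) mM] ann[OF m] by simp
    finally show ?thesis using a c by simp
  qed
  have a_sum: "a = a \<otimes> (b u f \<otimes> b v e) \<oplus> d"
  proof -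
    have "b u v = b u f \<otimes> b v e \<oplus> b u e \<otimes> b v f \<oplus> b m v"
      using e f mM v c u by (subst u_eq) (simp add: b_simps b_commute[of _ v])
    then have "a \<otimes> \<one> = a \<otimes> (b u f \<otimes> b v e \<oplus> b u e \<otimes> b v f \<oplus> b m v)" using uv by simp
    also have "\<dots> = a \<otimes> (b u f \<otimes> b v e) \<oplus> d \<oplus> a \<otimes> b m v"
      using a c mM v by (simp add: R.r_distr d_def)
    also have "a \<otimes> b m v = \<zero>" using b_smult_left[OF a(1) mM v] ann[OF m] v by simp
    finally show ?thesis using a c dR by simp
  qed
  have "d \<otimes> d = d"
  proof -
    have "(a \<otimes> (b u f \<otimes> b v e)) \<otimes> d = (a \<otimes> (b u f \<otimes> b u e)) \<otimes> (a \<otimes> (b v e \<otimes> b v f))"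
      unfolding d_def using a c by (simp add: R.m_ac)
    then have z: "(a \<otimes> (b u f \<otimes> b v e)) \<otimes> d = \<zero>" using a_iso a c by simp
    have "a \<otimes> d = d" using a c by (simp add: d_def R.m_assoc[symmetric])
    then have "d = (a \<otimes> (b u f \<otimes> b v e) \<oplus> d) \<otimes> d" using a_sum by simp
    then show ?thesis using z a c dR by (simp add: R.l_distr)
  qed
  note mix = idempotent_mixing[OF u v qu qv uv dR this u'_def v'_def]
  have u'M: "u' \<in> carrier M" and v'M: "v' \<in> carrier M" using u v dR by (simp_all add: u'_def v'_def)
  have good: "\<exists>x \<in> perp e f. q x \<notin> I" if I: "maximalideal I R" and uf: "b u' f \<in> I" for I
  proof (cases "a \<in> I")
    case True
    then show ?thesis using supp I by auto
  next
    case False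
    interpret I: maximalideal I R by fact
    interpret P: primeideal I R using R.maximalideal_prime[OF I] .
    have u'f: "(\<one> \<ominus> d) \<otimes> b u f \<oplus> d \<otimes> b v f \<in> I"
      using uf u v f dR by (simp add: u'_def b_simps)
    have dd: "d \<otimes> (\<one> \<ominus> d) = \<zero>"
      using dR \<open>d \<otimes> d = d\<close> by (simp add: R.minus_eq R.r_distr R.r_minus R.r_neg)
    have "d \<in> I \<or> \<one> \<ominus> d \<in> I" using dd P.I_prime[of d "\<one> \<ominus> d"] dR by simp
    then have "d \<in> I \<and> b u f \<in> I \<or> \<one> \<ominus> d \<in> I \<and> d \<otimes> b v f \<in> I"
    proof
      assume d: "d \<in> I"
      have "(\<one> \<ominus> d) \<otimes> b u f \<in> I"
        using I.add_memD[OF u'f I.I_r_closed[OF d c(4)]] dR c by simp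
      then have "b u f \<ominus> d \<otimes> b u f \<in> I"
        using dR c by (simp add: R.minus_eq R.l_distr R.l_minus)
      then have "b u f \<in> I" using I.minus_memD I.I_r_closed[OF d c(2)] c by blast
      then show ?thesis using d by simp
    next
      assume d: "\<one> \<ominus> d \<in> I"
      have "d \<otimes> b v f \<oplus> (\<one> \<ominus> d) \<otimes> b u f \<in> I"
        using u'f dR c by (simp add: R.a_comm)
      then have "d \<otimes> b v f \<in> I"
        using I.add_memD I.I_r_closed[OF d c(2)] dR c by blast
      then show ?thesis using d by simp
    qed
    then have "a \<in> I"
    proof
      assume "d \<in> I \<and> b u f \<in> I"
      then have "a \<otimes> (b u f \<otimes> b v e) \<oplus> d \<in> I"
        using a c by (intro I.a_closed I.I_l_closed I.I_r_closed) auto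
      then show "a \<in> I" using a_sum by simp
    next
      assume h: "\<one> \<ominus> d \<in> I \<and> d \<otimes> b v f \<in> I"
      have "d \<otimes> d \<in> I"
      proof -
        have "d \<otimes> d = (a \<otimes> b u e) \<otimes> (d \<otimes> b v f)"
          by (subst (1) d_def) (use a c dR in \<open>simp add: R.m_ac\<close>)
        then show ?thesis using h a c I.I_l_closed by simp
      qed
      then have "d \<in> I" using \<open>d \<otimes> d = d\<close> by simp
      then have "\<one> \<in> I" using I.minus_memD[of \<one> d] h by simp
      then show "a \<in> I" using I.one_imp_carrier I.I_notcarr by simp
    qed
    then show ?thesis using False by simp
  qed
  obtain w where w: "w \<in> carrier M" "q w = \<zero>" "b e w = \<one>" "b u' w \<in> Units R"
    using unit_partner[OF LG e f qe qf ef u'M v'M mix(3) g span good] by auto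
  have "perp_isometric u' v' u' w"
    using w by (intro perp_isometric_common u'M v'M mix) (auto simp: mix)
  moreover have "perp_isometric w u' w e"
    using w e u'M by (intro perp_isometric_common) (auto simp: b_commute[of w])
  moreover have "perp_isometric e w e f"
    using w e f qe ef by (intro perp_isometric_common) auto
  ultimately show ?thesis
    unfolding mix(4) perp_commute[of w u'] perp_commute[of w e]
    by (blast intro: isometric_trans)
qed

end

section \<open>Nonsingular forms modulo a maximal ideal\<close>

lemma (in abelian_group) add_minus_minus:
  assumes "x \<in> carrier G" "y \<in> carrier G" shows "x \<oplus> y \<ominus> x \<ominus> y = \<zero>"
proof -
  have "x \<oplus> y \<ominus> x \<ominus> y = (x \<oplus> y) \<oplus> \<ominus> (x \<oplus> y)"
    unfolding minus_add[OF assms] using assms by (simp add: minus_eq a_assoc)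
  then show ?thesis using assms by (simp add: r_neg)
qed

text \<open>
  The residue field \<open>R/I\<close> has to be realised with carrier in \<^typ>\<open>'a list\<close>, the type over which
  the fields in \<^const>\<open>nonsingular_form\<close> range: a coset becomes the one-element list of a chosen
  representative.
\<close>

lemma (in cring) residue_field_algebra:
  assumes I: "maximalideal I R"
  obtains F :: "('a, 'a list) module" and h
  where "algebra R F" "field F" "h \<in> ring_hom R F" "h ` carrier R = carrier F"
    "\<And>x. x \<in> carrier R \<Longrightarrow> h x = \<zero>\<^bsub>F\<^esub> \<longleftrightarrow> x \<in> I"
    "\<And>r t. r \<in> carrier R \<Longrightarrow> r \<odot>\<^bsub>F\<^esub> t = h r \<otimes>\<^bsub>F\<^esub> t"
proof -
  have z: "\<zero>\<^bsub>R Quot I\<^esub> = I" by (simp add: FactRing_def)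
  interpret I: maximalideal I R by fact
  interpret Q: field "R Quot I" using I.quotient_is_field is_cring by blast
  interpret p: ring_hom_cring R "R Quot I" "(+>) I"
    using I.rcos_ring_hom_cring is_cring by blast
  have onto: "((+>) I) ` carrier R = carrier (R Quot I)"
    by (auto simp: FactRing_def A_RCOSETS_def' a_r_coset_def' RCOSETS_def)
  have repr: "\<exists>x \<in> carrier R. C = I +> x" if "C \<in> carrier (R Quot I)" for C
    using that unfolding onto[symmetric] by auto
  \<comment> \<open>\<open>j\<close> is the encoding of cosets, \<open>k\<close> its inverse, along which the field operations are carried\<close>
  define j :: "'a set \<Rightarrow> 'a list" where "j C = [SOME y. y \<in> C]" for C
  define k where "k = inv_into (carrier (R Quot I)) j"
  define F :: "('a, 'a list) module" where "F =
    \<lparr>carrier = j ` carrier (R Quot I), monoid.mult = (\<lambda>s t. j (k s \<otimes>\<^bsub>R Quot I\<^esub> k t)),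
     monoid.one = j \<one>\<^bsub>R Quot I\<^esub>, ring.zero = j \<zero>\<^bsub>R Quot I\<^esub>,
     ring.add = (\<lambda>s t. j (k s \<oplus>\<^bsub>R Quot I\<^esub> k t)),
     module.smult = (\<lambda>r t. j ((I +> r) \<otimes>\<^bsub>R Quot I\<^esub> k t))\<rparr>"
  have some_in: "(SOME y. y \<in> C) \<in> C" if C: "C \<in> carrier (R Quot I)" for C
  proof -
    obtain x where "x \<in> carrier R" "C = I +> x" using repr[OF C] by auto
    then have "x \<in> C" using I.a_rcos_self[of x] by simp
    then show ?thesis by (rule someI)
  qed
  have inj: "inj_on j (carrier (R Quot I))"
  proof (rule inj_onI)
    fix C D assume C: "C \<in> carrier (R Quot I)" and D: "D \<in> carrier (R Quot I)" and "j C = j D"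
    then have s: "(SOME y. y \<in> C) \<in> C" "(SOME y. y \<in> C) \<in> D"
      using some_in[OF C] some_in[OF D] by (auto simp: j_def)
    obtain x y where x: "x \<in> carrier R" "C = I +> x" and y: "y \<in> carrier R" "D = I +> y"
      using repr[OF C] repr[OF D] by auto
    have sub: "subgroup I (add_monoid R)" using I.a_subgroup .
    show "C = D"
      using a_repr_independence[OF _ x(1) sub] a_repr_independence[OF _ y(1) sub] s x y by metis
  qed
  have kj: "k (j C) = C" if "C \<in> carrier (R Quot I)" for C
    using inj that by (simp add: k_def)
  have iso: "j \<in> ring_iso (R Quot I) F"
    using inj kj by (auto simp: ring_iso_def ring_hom_def F_def bij_betw_def)
  have F: "field F"
    using Q.ring_iso_imp_img_field[OF iso] by (simp add: F_def)
  interpret F: field F by fact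
  define h where "h x = j (I +> x)" for x
  have Qc: "I +> x \<in> carrier (R Quot I)" if "x \<in> carrier R" for x using that by (rule p.hom_closed)
  have h: "h \<in> ring_hom R F"
    using ring_hom_trans[OF I.rcos_ring_hom, of j F] iso by (auto simp: h_def[abs_def] comp_def ring_iso_def)
  interpret h: ring_hom_cring R F h
    using is_cring F.is_cring h by (intro ring_hom_cring.intro ring_hom_cring_axioms.intro)
  have sm: "r \<odot>\<^bsub>F\<^esub> t = h r \<otimes>\<^bsub>F\<^esub> t" if "r \<in> carrier R" for r t
    using kj[OF Qc[OF that]] by (simp add: F_def h_def)
  have sm_closed: "r \<odot>\<^bsub>F\<^esub> t \<in> carrier F" if "r \<in> carrier R" "t \<in> carrier F" for r t
    using that by (simp add: sm)
  have "algebra R F"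
    by (rule algebraI[OF is_cring F.is_cring])
      (auto simp: sm F.l_distr F.r_distr F.m_assoc)
  moreover have "h ` carrier R = carrier F"
    using onto by (auto simp: h_def F_def image_image[symmetric])
  moreover have "h x = \<zero>\<^bsub>F\<^esub> \<longleftrightarrow> x \<in> I" if x: "x \<in> carrier R" for x
  proof -
    have "h x = \<zero>\<^bsub>F\<^esub> \<longleftrightarrow> I +> x = \<zero>\<^bsub>R Quot I\<^esub>"
      using inj_on_eq_iff[OF inj Qc[OF x] Q.zero_closed] by (simp add: h_def F_def)
    then show ?thesis
      unfolding z using I.rcos_const_imp_mem[OF x] a_coset_join2[OF x I.a_subgroup] by argo
  qed
  ultimately show thesis by (intro that[of F h]) (assumption | rule F h sm)+
qed

lemma generate_free_Abelian_subset:
  assumes "rel \<subseteq> A" "A \<subseteq> carrier (free_Abelian_group S)" "0 \<in> A"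
    and "\<And>x y. \<lbrakk>x \<in> A; y \<in> A\<rbrakk> \<Longrightarrow> x + y \<in> A" "\<And>x. x \<in> A \<Longrightarrow> - x \<in> A"
  shows "generate (free_Abelian_group S) rel \<subseteq> A"
proof
  fix x assume "x \<in> generate (free_Abelian_group S) rel"
  then show "x \<in> A"
  proof induction
    case (inv h)
    then have h: "h \<in> A" "h \<in> carrier (free_Abelian_group S)" using assms(1,2) by blast+
    then show ?case using assms(5) by simp
  qed (use assms in auto)
qed

lemma tensor_relation_cases [consumes 1, case_names add_left add_right balanced]:
  assumes "x \<in> tensor_relations R M T"
  obtains m m' t where "m \<in> carrier M" "m' \<in> carrier M" "t \<in> carrier T"
      "x = frag_of (m \<oplus>\<^bsub>M\<^esub> m', t) - frag_of (m, t) - frag_of (m', t)"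
    | m t t' where "m \<in> carrier M" "t \<in> carrier T" "t' \<in> carrier T"
      "x = frag_of (m, t \<oplus>\<^bsub>T\<^esub> t') - frag_of (m, t) - frag_of (m, t')"
    | r m t where "r \<in> carrier R" "m \<in> carrier M" "t \<in> carrier T"
      "x = frag_of (r \<odot>\<^bsub>M\<^esub> m, t) - frag_of (m, r \<odot>\<^bsub>T\<^esub> t)"
  using assms unfolding tensor_relations_def by (elim UnE CollectE exE conjE) (rule that; assumption)+

lemma tensor_relation_add_left:
  "\<lbrakk>m \<in> carrier M; m' \<in> carrier M; t \<in> carrier T\<rbrakk> \<Longrightarrow>
    frag_of (m \<oplus>\<^bsub>M\<^esub> m', t) - frag_of (m, t) - frag_of (m', t) \<in> tensor_relations R M T"
  unfolding tensor_relations_def by (rule UnI1, rule UnI1) fast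

lemma tensor_relation_add_right:
  "\<lbrakk>m \<in> carrier M; t \<in> carrier T; t' \<in> carrier T\<rbrakk> \<Longrightarrow>
    frag_of (m, t \<oplus>\<^bsub>T\<^esub> t') - frag_of (m, t) - frag_of (m, t') \<in> tensor_relations R M T"
  unfolding tensor_relations_def by (rule UnI1, rule UnI2) fast

lemma tensor_relation_balanced:
  "\<lbrakk>r \<in> carrier R; m \<in> carrier M; t \<in> carrier T\<rbrakk> \<Longrightarrow>
    frag_of (r \<odot>\<^bsub>M\<^esub> m, t) - frag_of (m, r \<odot>\<^bsub>T\<^esub> t) \<in> tensor_relations R M T"
  unfolding tensor_relations_def by (rule UnI2) fast

text \<open>
  Only what is needed of \<open>M \<otimes>\<^sub>R F\<close> is developed: closure under the operations, reduction to tensors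
  \<open>m \<otimes> 1\<close>, and the maps to \<open>F\<close> induced by linear forms on \<open>M\<close>.
\<close>

locale base_change = X: "module" R M + F: algebra R F
  for R (structure) and M :: "('a, 'm) module" and F :: "('a, 't) module"
begin

abbreviation G where "G \<equiv> tensor_free M F"
abbreviation K where "K \<equiv> tensor_kernel R M F"
abbreviation N where "N \<equiv> base_change_module R M F"

lemma carrier_G: "c \<in> carrier G \<longleftrightarrow> Poly_Mapping.keys c \<subseteq> carrier M \<times> carrier F"
  by (simp add: tensor_free_def)

lemma G_simps [simp]: "\<one>\<^bsub>G\<^esub> = 0" "x \<otimes>\<^bsub>G\<^esub> y = x + y"
  by (simp_all add: tensor_free_def)

lemma comm_group_G: "comm_group G"
  unfolding tensor_free_def by (rule abelian_free_Abelian_group)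

interpretation G: comm_group G by (rule comm_group_G)

lemma keys_diff_le: "\<lbrakk>Poly_Mapping.keys x \<subseteq> S; Poly_Mapping.keys y \<subseteq> S\<rbrakk> \<Longrightarrow>
    Poly_Mapping.keys (x - y :: _ \<Rightarrow>\<^sub>0 int) \<subseteq> S"
  using keys_diff by fastforce

lemma relations_subset: "tensor_relations R M F \<subseteq> carrier G"
  unfolding tensor_relations_def
  by (auto simp: carrier_G dest!: set_mp[OF keys_diff])

lemma subgroup_K: "subgroup K G"
  unfolding tensor_kernel_def using relations_subset by (rule G.generate_is_subgroup)

lemma normal_K: "K \<lhd> G"
  using subgroup_K by (rule G.subgroup_imp_normal)

lemma K_add: "\<lbrakk>x \<in> K; y \<in> K\<rbrakk> \<Longrightarrow> x + y \<in> K"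
  using subgroup.m_closed[OF subgroup_K] by simp

lemma K_minus: "x \<in> K \<Longrightarrow> - x \<in> K"
  using subgroup.m_inv_closed[OF subgroup_K, of x] subgroup.mem_carrier[OF subgroup_K, of x]
  by (simp add: tensor_free_def)

lemma K_diff: "\<lbrakk>x \<in> K; y \<in> K\<rbrakk> \<Longrightarrow> x - y \<in> K"
  using K_add[OF _ K_minus] by fastforce

lemma relation_K: "x \<in> tensor_relations R M F \<Longrightarrow> x \<in> K"
  unfolding tensor_kernel_def by (rule generate.incl)

lemma K_subset:
  assumes "tensor_relations R M F \<subseteq> A" "A \<subseteq> carrier G" "0 \<in> A"
    and "\<And>x y. \<lbrakk>x \<in> A; y \<in> A\<rbrakk> \<Longrightarrow> x + y \<in> A" "\<And>x. x \<in> A \<Longrightarrow> - x \<in> A"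
  shows "K \<subseteq> A"
  unfolding tensor_kernel_def tensor_free_def
  by (rule generate_free_Abelian_subset) (use assms in \<open>simp_all add: tensor_free_def\<close>)

lemma coset_eq: "K #>\<^bsub>G\<^esub> c = {k + c | k. k \<in> K}"
  by (auto simp: r_coset_def)

lemma coset_eqI: assumes "c - d \<in> K" shows "K #>\<^bsub>G\<^esub> c = K #>\<^bsub>G\<^esub> d"
proof -
  have "x \<in> {k + d | k. k \<in> K}" if x: "x \<in> {k + c | k. k \<in> K}" for x
  proof -
    obtain k where k: "k \<in> K" "x = k + c" using x by auto
    then have "x = (k + (c - d)) + d" by simp
    then show ?thesis using K_add[OF k(1) assms] by blast
  qed
  moreover have "x \<in> {k + c | k. k \<in> K}" if x: "x \<in> {k + d | k. k \<in> K}" for x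
  proof -
    obtain k where k: "k \<in> K" "x = k + d" using x by auto
    then have "x = (k - (c - d)) + c" by simp
    then show ?thesis using K_diff[OF k(1) assms] by blast
  qed
  ultimately show ?thesis unfolding coset_eq by blast
qed

lemma carrier_N: "carrier N = {K #>\<^bsub>G\<^esub> c | c. c \<in> carrier G}"
  by (auto simp: base_change_module_def tensor_group_def FactGroup_def RCOSETS_def)

lemma N_add_closed: assumes "C \<in> carrier N" "D \<in> carrier N" shows "C \<oplus>\<^bsub>N\<^esub> D \<in> carrier N"
proof -
  obtain c d where c: "c \<in> carrier G" "C = K #>\<^bsub>G\<^esub> c" and d: "d \<in> carrier G" "D = K #>\<^bsub>G\<^esub> d"
    using assms unfolding carrier_N by auto
  have "C \<oplus>\<^bsub>N\<^esub> D = K #>\<^bsub>G\<^esub> (c \<otimes>\<^bsub>G\<^esub> d)"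
    using normal.rcos_sum[OF normal_K c(1) d(1)] c d
    by (simp add: base_change_module_def tensor_group_def FactGroup_def)
  then show ?thesis unfolding carrier_N using G.m_closed[OF c(1) d(1)] by blast
qed

text \<open>
  Scalar multiplication is defined as a union over representatives. The map \<open>\<sigma>\<close> on
  representatives preserves the tensor relations, so the union is a single coset.
\<close>

lemma N_smult_closed: assumes s: "s \<in> carrier F" and C: "C \<in> carrier N" shows "s \<odot>\<^bsub>N\<^esub> C \<in> carrier N"
proof -
  define \<sigma> where "\<sigma> = frag_extend (\<lambda>(m, t). frag_of (m :: 'm, s \<otimes>\<^bsub>F\<^esub> t))"
  obtain c where c: "c \<in> carrier G" "C = K #>\<^bsub>G\<^esub> c" using C unfolding carrier_N by auto
  have \<sigma>G: "\<sigma> x \<in> carrier G" if "x \<in> carrier G" for x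
  proof -
    have "Poly_Mapping.keys (\<sigma> x) \<subseteq> (\<Union>p \<in> Poly_Mapping.keys x.
        Poly_Mapping.keys ((\<lambda>(m, t). frag_of (m :: 'm, s \<otimes>\<^bsub>F\<^esub> t)) p))"
      unfolding \<sigma>_def by (rule keys_frag_extend)
    also have "\<dots> \<subseteq> carrier M \<times> carrier F"
      using that s by (auto simp: carrier_G)
    finally show ?thesis by (simp add: carrier_G)
  qed
  have "K \<subseteq> {x \<in> carrier G. \<sigma> x \<in> K}"
  proof (rule K_subset)
    show "tensor_relations R M F \<subseteq> {x \<in> carrier G. \<sigma> x \<in> K}"
    proof
      fix x assume x: "x \<in> tensor_relations R M F"
      then have "\<sigma> x \<in> tensor_relations R M F"
      proof (cases rule: tensor_relation_cases)
        case (add_left m m' t)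
        have "\<sigma> x = frag_of (m \<oplus>\<^bsub>M\<^esub> m', s \<otimes>\<^bsub>F\<^esub> t) - frag_of (m, s \<otimes>\<^bsub>F\<^esub> t) - frag_of (m', s \<otimes>\<^bsub>F\<^esub> t)"
          using add_left by (simp add: \<sigma>_def frag_extend_diff)
        then show ?thesis using add_left s tensor_relation_add_left[of m M m' "s \<otimes>\<^bsub>F\<^esub> t" F R] by simp
      next
        case (add_right m t t')
        have "\<sigma> x = frag_of (m, s \<otimes>\<^bsub>F\<^esub> t \<oplus>\<^bsub>F\<^esub> s \<otimes>\<^bsub>F\<^esub> t') - frag_of (m, s \<otimes>\<^bsub>F\<^esub> t) - frag_of (m, s \<otimes>\<^bsub>F\<^esub> t')"
          using add_right s by (simp add: \<sigma>_def frag_extend_diff F.r_distr)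
        moreover have "s \<otimes>\<^bsub>F\<^esub> t \<in> carrier F" "s \<otimes>\<^bsub>F\<^esub> t' \<in> carrier F" using add_right s by auto
        ultimately show ?thesis using tensor_relation_add_right[OF add_right(1)] by simp
      next
        case (balanced r m t)
        have "s \<otimes>\<^bsub>F\<^esub> (r \<odot>\<^bsub>F\<^esub> t) = r \<odot>\<^bsub>F\<^esub> (s \<otimes>\<^bsub>F\<^esub> t)"
          using balanced s F.smult_assoc2[of r t s] by (simp add: F.m_comm)
        then have "\<sigma> x = frag_of (r \<odot>\<^bsub>M\<^esub> m, s \<otimes>\<^bsub>F\<^esub> t) - frag_of (m, r \<odot>\<^bsub>F\<^esub> (s \<otimes>\<^bsub>F\<^esub> t))"
          using balanced s by (simp add: \<sigma>_def frag_extend_diff)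
        moreover have "s \<otimes>\<^bsub>F\<^esub> t \<in> carrier F" using balanced s by auto
        ultimately show ?thesis using tensor_relation_balanced[OF balanced(1,2)] by simp
      qed
      then show "x \<in> {x \<in> carrier G. \<sigma> x \<in> K}"
        using x relations_subset relation_K by auto
    qed
  next
    show "0 \<in> {x \<in> carrier G. \<sigma> x \<in> K}"
      using subgroup.one_closed[OF subgroup_K] G.one_closed by (simp add: \<sigma>_def)
    fix x assume x: "x \<in> {x \<in> carrier G. \<sigma> x \<in> K}"
    then show "- x \<in> {x \<in> carrier G. \<sigma> x \<in> K}"
      using K_minus[of "\<sigma> x"] by (simp add: \<sigma>_def frag_extend_minus carrier_G)
    fix y assume "y \<in> {x \<in> carrier G. \<sigma> x \<in> K}"
    then show "x + y \<in> {x \<in> carrier G. \<sigma> x \<in> K}"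
      using x K_add[of "\<sigma> x" "\<sigma> y"] G.m_closed[of x y] by (simp add: \<sigma>_def frag_extend_add)
  qed auto
  then have \<sigma>K: "\<sigma> k \<in> K" if "k \<in> K" for k using that by auto
  have "s \<odot>\<^bsub>N\<^esub> C = (\<Union>c' \<in> C. K #>\<^bsub>G\<^esub> \<sigma> c')"
    by (simp add: base_change_module_def \<sigma>_def)
  also have "\<dots> = K #>\<^bsub>G\<^esub> \<sigma> c"
  proof -
    have "K #>\<^bsub>G\<^esub> \<sigma> c' = K #>\<^bsub>G\<^esub> \<sigma> c" if c': "c' \<in> C" for c'
    proof -
      obtain k where "k \<in> K" "c' = k + c" using c' unfolding c(2) coset_eq by auto
      then show ?thesis using \<sigma>K by (intro coset_eqI) (simp add: \<sigma>_def frag_extend_add)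
    qed
    moreover have "C \<noteq> {}" unfolding c(2) coset_eq using subgroup.one_closed[OF subgroup_K] by auto
    ultimately show ?thesis by auto
  qed
  finally show ?thesis unfolding carrier_N using \<sigma>G[OF c(1)] by blast
qed

lemma pure_tensor_closed: "\<lbrakk>m \<in> carrier M; t \<in> carrier F\<rbrakk> \<Longrightarrow> pure_tensor R M F m t \<in> carrier N"
  unfolding pure_tensor_def carrier_N by (intro CollectI exI[of _ "frag_of (m, t)"]) (auto simp: carrier_G)

text \<open>If \<open>R\<close> maps onto \<open>F\<close>, every scalar of \<open>F\<close> can be moved across the tensor sign.\<close>

lemma N_pure:
  assumes surj: "\<And>t. t \<in> carrier F \<Longrightarrow> \<exists>r \<in> carrier R. t = r \<odot>\<^bsub>F\<^esub> \<one>\<^bsub>F\<^esub>" and C: "C \<in> carrier N"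
  shows "\<exists>m \<in> carrier M. C = pure_tensor R M F m \<one>\<^bsub>F\<^esub>"
proof -
  have *: "\<exists>m \<in> carrier M. c - frag_of (m, \<one>\<^bsub>F\<^esub>) \<in> K" if "c \<in> carrier G" for c
    using that unfolding carrier_G
  proof (rule free_Abelian_group_induct)
    have "frag_of (\<zero>\<^bsub>M\<^esub> \<oplus>\<^bsub>M\<^esub> \<zero>\<^bsub>M\<^esub>, \<one>\<^bsub>F\<^esub>) - frag_of (\<zero>\<^bsub>M\<^esub>, \<one>\<^bsub>F\<^esub>) - frag_of (\<zero>\<^bsub>M\<^esub>, \<one>\<^bsub>F\<^esub>) \<in> K"
      by (intro relation_K tensor_relation_add_left X.M.zero_closed F.one_closed)
    then show "\<exists>m \<in> carrier M. 0 - frag_of (m, \<one>\<^bsub>F\<^esub>) \<in> K"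
      by (intro bexI[of _ "\<zero>\<^bsub>M\<^esub>"]) auto
  next
    fix x y assume "\<exists>m \<in> carrier M. x - frag_of (m, \<one>\<^bsub>F\<^esub>) \<in> K" "\<exists>m \<in> carrier M. y - frag_of (m, \<one>\<^bsub>F\<^esub>) \<in> K"
    then obtain m m' where m: "m \<in> carrier M" "x - frag_of (m, \<one>\<^bsub>F\<^esub>) \<in> K"
      and m': "m' \<in> carrier M" "y - frag_of (m', \<one>\<^bsub>F\<^esub>) \<in> K" by auto
    let ?n = "m \<ominus>\<^bsub>M\<^esub> m'"
    have n: "?n \<in> carrier M" using m m' by simp
    have "?n \<oplus>\<^bsub>M\<^esub> m' = m" using m m' by (simp add: X.M.minus_eq X.M.a_assoc X.M.l_neg)
    moreover have "frag_of (?n \<oplus>\<^bsub>M\<^esub> m', \<one>\<^bsub>F\<^esub>) - frag_of (?n, \<one>\<^bsub>F\<^esub>) - frag_of (m', \<one>\<^bsub>F\<^esub>) \<in> K"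
      by (intro relation_K tensor_relation_add_left n m' F.one_closed)
    ultimately have "frag_of (m, \<one>\<^bsub>F\<^esub>) - frag_of (?n, \<one>\<^bsub>F\<^esub>) - frag_of (m', \<one>\<^bsub>F\<^esub>) \<in> K" by simp
    from K_add[OF K_diff[OF m(2) m'(2)] this] have "x - y - frag_of (?n, \<one>\<^bsub>F\<^esub>) \<in> K"
      by (simp add: algebra_simps)
    then show "\<exists>m \<in> carrier M. x - y - frag_of (m, \<one>\<^bsub>F\<^esub>) \<in> K" using n by blast
  next
    fix a assume "a \<in> carrier M \<times> carrier F"
    then obtain m t where a: "a = (m, t)" "m \<in> carrier M" "t \<in> carrier F" by auto
    then obtain r where r: "r \<in> carrier R" "t = r \<odot>\<^bsub>F\<^esub> \<one>\<^bsub>F\<^esub>" using surj by auto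
    have "frag_of (r \<odot>\<^bsub>M\<^esub> m, \<one>\<^bsub>F\<^esub>) - frag_of (m, r \<odot>\<^bsub>F\<^esub> \<one>\<^bsub>F\<^esub>) \<in> K"
      by (intro relation_K tensor_relation_balanced r a F.one_closed)
    from K_minus[OF this] show "\<exists>m \<in> carrier M. frag_of a - frag_of (m, \<one>\<^bsub>F\<^esub>) \<in> K"
      using r a by (intro bexI[of _ "r \<odot>\<^bsub>M\<^esub> m"]) auto
  qed
  obtain c where c: "c \<in> carrier G" "C = K #>\<^bsub>G\<^esub> c" using C unfolding carrier_N by auto
  then show ?thesis using *[OF c(1)] coset_eqI unfolding pure_tensor_def by blast
qed

text \<open>
  The linear form \<open>\<phi>\<close> induces the additive map \<open>m \<otimes> t \<mapsto> \<phi>(m) t\<close> from \<open>M \<otimes>\<^sub>R F\<close> to \<open>F\<close>; here it is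
  obtained on the free abelian group and shown to kill the tensor relations.
\<close>

lemma linear_form_pure_zero:
  assumes \<phi>: "linear_map R M (self_module R) \<phi>" and m: "m \<in> carrier M"
    and z: "pure_tensor R M F m \<one>\<^bsub>F\<^esub> = \<zero>\<^bsub>N\<^esub>"
  shows "\<phi> m \<odot>\<^bsub>F\<^esub> \<one>\<^bsub>F\<^esub> = \<zero>\<^bsub>F\<^esub>"
proof -
  have \<phi>R: "\<phi> x \<in> carrier R" if "x \<in> carrier M" for x
    using \<phi> that by (auto simp: linear_map_def self_module_def)
  have "(\<lambda>(m, t). \<phi> m \<odot>\<^bsub>F\<^esub> t) ` (carrier M \<times> carrier F) \<subseteq> carrier (add_monoid F)"
    using \<phi>R by auto
  from comm_group.free_Abelian_group_universal[OF F.M.a_comm_group this]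
  obtain H where H: "H \<in> hom (free_Abelian_group (carrier M \<times> carrier F)) (add_monoid F)"
    and Hof: "\<And>x. x \<in> carrier M \<times> carrier F \<Longrightarrow> H (frag_of x) = (\<lambda>(m, t). \<phi> m \<odot>\<^bsub>F\<^esub> t) x"
    by metis
  have H': "H \<in> hom G (add_monoid F)" using H by (simp add: tensor_free_def)
  interpret H: group_hom G "add_monoid F" H
    using H' by unfold_locales
  have Hadd: "H (x + y) = H x \<oplus>\<^bsub>F\<^esub> H y" if "x \<in> carrier G" "y \<in> carrier G" for x y
    using H.hom_mult[OF that] by simp
  have H0: "H 0 = \<zero>\<^bsub>F\<^esub>" using H.hom_one by simp
  have Hneg: "H (- x) = \<ominus>\<^bsub>F\<^esub> H x" if "x \<in> carrier G" for x
    using H.hom_inv[OF that] that by (simp add: tensor_free_def a_inv_def)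
  have Hdiff: "H (x - y) = H x \<ominus>\<^bsub>F\<^esub> H y" if "x \<in> carrier G" "y \<in> carrier G" for x y
    using Hadd[of x "- y"] Hneg[of y] that by (simp add: a_minus_def carrier_G)
  have of_G: "frag_of (a, t) \<in> carrier G" if "a \<in> carrier M" "t \<in> carrier F" for a t
    using that by (simp add: carrier_G)
  have Hpure: "H (frag_of (a, t)) = \<phi> a \<odot>\<^bsub>F\<^esub> t" if "a \<in> carrier M" "t \<in> carrier F" for a t
    using Hof[of "(a, t)"] that by simp
  have diff_G: "x - y \<in> carrier G" if "x \<in> carrier G" "y \<in> carrier G" for x y
    using that keys_diff_le unfolding carrier_G by blast
  have "K \<subseteq> {x \<in> carrier G. H x = \<zero>\<^bsub>F\<^esub>}"
  proof (rule K_subset)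
    show "tensor_relations R M F \<subseteq> {x \<in> carrier G. H x = \<zero>\<^bsub>F\<^esub>}"
    proof
      fix x assume x: "x \<in> tensor_relations R M F"
      then have "H x = \<zero>\<^bsub>F\<^esub>"
      proof (cases rule: tensor_relation_cases)
        case (add_left m m' t)
        have "\<phi> (m \<oplus>\<^bsub>M\<^esub> m') = \<phi> m \<oplus> \<phi> m'" using \<phi> add_left by (simp add: linear_map_def self_module_def)
        then show ?thesis using add_left \<phi>R
          by (simp add: Hdiff diff_G of_G Hpure F.smult_l_distr F.M.add_minus_minus)
      next
        case (add_right m t t')
        then show ?thesis using \<phi>R
          by (simp add: Hdiff diff_G of_G Hpure F.smult_r_distr F.M.add_minus_minus)
      next
        case (balanced r m t)
        have "\<phi> (r \<odot>\<^bsub>M\<^esub> m) = r \<otimes> \<phi> m" using \<phi> balanced by (simp add: linear_map_def self_module_def)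
        then show ?thesis using balanced \<phi>R F.smult_assoc1[of "\<phi> m" r t]
          by (simp add: Hdiff diff_G of_G Hpure F.M.minus_eq X.R.m_comm F.M.r_neg)
      qed
      then show "x \<in> {x \<in> carrier G. H x = \<zero>\<^bsub>F\<^esub>}" using x relations_subset by auto
    qed
  next
    show "0 \<in> {x \<in> carrier G. H x = \<zero>\<^bsub>F\<^esub>}" using H0 G.one_closed by simp
    fix x assume x: "x \<in> {x \<in> carrier G. H x = \<zero>\<^bsub>F\<^esub>}"
    then show "- x \<in> {x \<in> carrier G. H x = \<zero>\<^bsub>F\<^esub>}" using Hneg[of x] by (simp add: carrier_G)
    fix y assume "y \<in> {x \<in> carrier G. H x = \<zero>\<^bsub>F\<^esub>}"
    then show "x + y \<in> {x \<in> carrier G. H x = \<zero>\<^bsub>F\<^esub>}"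
      using x Hadd[of x y] G.m_closed[of x y] by simp
  qed auto
  moreover have "frag_of (m, \<one>\<^bsub>F\<^esub>) \<in> K"
  proof -
    have "K #>\<^bsub>G\<^esub> frag_of (m, \<one>\<^bsub>F\<^esub>) = K"
      using z by (simp add: pure_tensor_def base_change_module_def tensor_group_def FactGroup_def)
    then show ?thesis by (rule G.coset_join1) (use m subgroup_K of_G in auto)
  qed
  ultimately show ?thesis using Hpure[OF m F.one_closed] by auto
qed

end

text \<open>
  If \<open>q\<close> vanishes modulo \<open>I\<close>, then the zero form is the base change of \<open>q\<close> to \<open>R/I\<close>. Its radical is
  everything, so \<open>M \<otimes>\<^sub>R R/I = 0\<close> by nonsingularity. For a projective module this is the same as the
  stated conclusion that every linear form on \<open>M\<close> takes its values in \<open>I\<close>.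
\<close>

theorem nonsingular_form_zero_mod_maximal:
  fixes R :: "('a, 'r) ring_scheme" and M :: "('a, 'm) module"
  assumes ns: "nonsingular_form R M q" and I: "maximalideal I R"
    and q0: "\<And>x. x \<in> carrier M \<Longrightarrow> q x \<in> I"
    and \<phi>: "linear_map R M (self_module R) \<phi>" and m: "m \<in> carrier M"
  shows "\<phi> m \<in> I"
proof -
  have "module R M" and "quadratic_map R M q"
    using ns by (auto simp: nonsingular_form_def quadratic_form_def)
  then interpret M: quadratic_space R M q by (simp add: quadratic_space_def quadratic_space_axioms_def)
  interpret I: maximalideal I R by fact
  obtain F :: "('a, 'a list) module" and h
    where alg: "algebra R F" and F: "field F" and h: "h \<in> ring_hom R F"
    and surj: "h ` carrier R = carrier F"
    and ker: "\<And>x. x \<in> carrier R \<Longrightarrow> h x = \<zero>\<^bsub>F\<^esub> \<longleftrightarrow> x \<in> I"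
    and sm: "\<And>r t. r \<in> carrier R \<Longrightarrow> r \<odot>\<^bsub>F\<^esub> t = h r \<otimes>\<^bsub>F\<^esub> t"
    using M.R.residue_field_algebra[OF I] by blast
  interpret F: field F by fact
  interpret B: base_change R M F
    using alg M.module_axioms by (simp add: base_change_def)
  have hc: "h x \<in> carrier F" if "x \<in> carrier R" for x using ring_hom_closed[OF h that] .
  have smc: "r \<odot>\<^bsub>F\<^esub> t = \<zero>\<^bsub>F\<^esub>" if "r \<in> I" "t \<in> carrier F" for r t
    using that ker[of r] sm[of r t] I.a_subset by auto
  have gen: "\<exists>r \<in> carrier R. t = r \<odot>\<^bsub>F\<^esub> \<one>\<^bsub>F\<^esub>" if "t \<in> carrier F" for t
    using that surj hc by (auto simp: sm)
  have pol: "polar R M q x y \<in> I" if "x \<in> carrier M" "y \<in> carrier M" for x y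
    using that q0 unfolding polar_def M.R.minus_eq by (intro I.a_closed I.a_inv_closed) auto
  define Z where "Z = (\<lambda>C \<in> carrier B.N. \<zero>\<^bsub>F\<^esub>)"
  have polZ: "polar F B.N Z C D = \<zero>\<^bsub>F\<^esub>" if "C \<in> carrier B.N" "D \<in> carrier B.N" for C D
    using that B.N_add_closed by (simp add: polar_def Z_def F.minus_eq)
  have Z_quad: "quadratic_map F B.N Z"
    unfolding quadratic_map_def bilinear_form_def linear_map_def
    using polZ B.N_add_closed B.N_smult_closed
    by (auto simp: Z_def self_module_def)
  have "base_change_form R M q F = Z"
    unfolding base_change_form_def
  proof (rule the_equality)
    show "Z \<in> extensional (carrier B.N) \<and> quadratic_map F B.N Z \<and>
      (\<forall>m \<in> carrier M. \<forall>t \<in> carrier F.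
        Z (pure_tensor R M F m t) = q m \<odot>\<^bsub>F\<^esub> (t [^]\<^bsub>F\<^esub> (2::nat))) \<and>
      (\<forall>m \<in> carrier M. \<forall>m' \<in> carrier M. \<forall>t \<in> carrier F. \<forall>t' \<in> carrier F.
        polar F B.N Z (pure_tensor R M F m t) (pure_tensor R M F m' t')
          = polar R M q m m' \<odot>\<^bsub>F\<^esub> (t \<otimes>\<^bsub>F\<^esub> t'))"
      using Z_quad polZ B.pure_tensor_closed smc q0 pol by (auto simp: Z_def)
  next
    fix Q assume Q: "Q \<in> extensional (carrier B.N) \<and> quadratic_map F B.N Q \<and>
      (\<forall>m \<in> carrier M. \<forall>t \<in> carrier F.
        Q (pure_tensor R M F m t) = q m \<odot>\<^bsub>F\<^esub> (t [^]\<^bsub>F\<^esub> (2::nat))) \<and>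
      (\<forall>m \<in> carrier M. \<forall>m' \<in> carrier M. \<forall>t \<in> carrier F. \<forall>t' \<in> carrier F.
        polar F B.N Q (pure_tensor R M F m t) (pure_tensor R M F m' t')
          = polar R M q m m' \<odot>\<^bsub>F\<^esub> (t \<otimes>\<^bsub>F\<^esub> t'))"
    show "Q = Z"
    proof (rule extensionalityI)
      show "Q \<in> extensional (carrier B.N)" using Q by simp
      show "Z \<in> extensional (carrier B.N)" by (simp add: Z_def)
      fix C assume C: "C \<in> carrier B.N"
      then obtain m where "m \<in> carrier M" "C = pure_tensor R M F m \<one>\<^bsub>F\<^esub>"
        using B.N_pure[OF gen] by blast
      then show "Q C = Z C" using Q smc q0 C by (simp add: Z_def)
    qed
  qed
  moreover have "radical F B.N (base_change_form R M q F) = {\<zero>\<^bsub>B.N\<^esub>}"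
    using ns alg F unfolding nonsingular_form_def by blast
  ultimately have "carrier B.N \<subseteq> {\<zero>\<^bsub>B.N\<^esub>}"
    using polZ by (auto simp: radical_def Z_def)
  then have "pure_tensor R M F m \<one>\<^bsub>F\<^esub> = \<zero>\<^bsub>B.N\<^esub>"
    using B.pure_tensor_closed[OF m F.one_closed] by blast
  then have "\<phi> m \<odot>\<^bsub>F\<^esub> \<one>\<^bsub>F\<^esub> = \<zero>\<^bsub>F\<^esub>" by (rule B.linear_form_pure_zero[OF \<phi> m])
  moreover have "\<phi> m \<in> carrier R" using \<phi> m by (auto simp: linear_map_def self_module_def)
  ultimately show ?thesis using ker sm hc by simp
qed

section \<open>Dual bases and the support of a projective module\<close>

lemma linear_map_closed: "\<lbrakk>linear_map R M N f; x \<in> carrier M\<rbrakk> \<Longrightarrow> f x \<in> carrier N"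
  by (auto simp: linear_map_def)

lemma linear_map_add: "\<lbrakk>linear_map R M N f; x \<in> carrier M; y \<in> carrier M\<rbrakk> \<Longrightarrow>
    f (x \<oplus>\<^bsub>M\<^esub> y) = f x \<oplus>\<^bsub>N\<^esub> f y"
  by (auto simp: linear_map_def)

lemma linear_map_smult: "\<lbrakk>linear_map R M N f; r \<in> carrier R; x \<in> carrier M\<rbrakk> \<Longrightarrow>
    f (r \<odot>\<^bsub>M\<^esub> x) = r \<odot>\<^bsub>N\<^esub> f x"
  by (auto simp: linear_map_def)

lemma linear_formD:
  assumes "linear_map R M (self_module R) f"
  shows "x \<in> carrier M \<Longrightarrow> f x \<in> carrier R"
    and "\<lbrakk>x \<in> carrier M; y \<in> carrier M\<rbrakk> \<Longrightarrow> f (x \<oplus>\<^bsub>M\<^esub> y) = f x \<oplus>\<^bsub>R\<^esub> f y"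
    and "\<lbrakk>r \<in> carrier R; x \<in> carrier M\<rbrakk> \<Longrightarrow> f (r \<odot>\<^bsub>M\<^esub> x) = r \<otimes>\<^bsub>R\<^esub> f x"
  using assms by (auto simp: linear_map_def self_module_def)

context "module"
begin

lemma lincomb_add:
  "\<lbrakk>g \<in> {..<n} \<rightarrow> carrier M; x \<in> {..<n} \<rightarrow> carrier R; y \<in> {..<n} \<rightarrow> carrier R\<rbrakk> \<Longrightarrow>
    lincomb n g (\<lambda>i. x i \<oplus> y i) = lincomb n g x \<oplus>\<^bsub>M\<^esub> lincomb n g y"
proof (induction n)
  case (Suc n)
  then have c: "g n \<in> carrier M" "x n \<in> carrier R" "y n \<in> carrier R"
    "lincomb n g x \<in> carrier M" "lincomb n g y \<in> carrier M"
    by (auto intro!: lincomb_closed)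
  have "lincomb n g (\<lambda>i. x i \<oplus> y i) = lincomb n g x \<oplus>\<^bsub>M\<^esub> lincomb n g y"
    using Suc by (auto simp: Pi_def)
  then show ?case using c by (simp add: smult_l_distr M.a_ac)
qed simp

lemma lincomb_smult:
  "\<lbrakk>g \<in> {..<n} \<rightarrow> carrier M; x \<in> {..<n} \<rightarrow> carrier R; r \<in> carrier R\<rbrakk> \<Longrightarrow>
    lincomb n g (\<lambda>i. r \<otimes> x i) = r \<odot>\<^bsub>M\<^esub> lincomb n g x"
proof (induction n)
  case (Suc n)
  then have c: "g n \<in> carrier M" "x n \<in> carrier R" "lincomb n g x \<in> carrier M"
    by (auto intro!: lincomb_closed)
  have "lincomb n g (\<lambda>i. r \<otimes> x i) = r \<odot>\<^bsub>M\<^esub> lincomb n g x"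
    using Suc by (auto simp: Pi_def)
  then show ?case using c Suc.prems by (simp add: smult_r_distr smult_assoc1)
qed simp

lemma lincomb_cong:
  "(\<And>i. i < n \<Longrightarrow> g i = g' i \<and> x i = x' i) \<Longrightarrow> lincomb n g x = lincomb n g' x'"
  by (induction n) auto

end

text \<open>
  Linear maps and the conditions on quadratic forms are stated for the plain record type
  \<^typ>\<open>('a, 'c) module\<close>, which this locale fixes.
\<close>

locale plain_module = "module" R M for R (structure) and M :: "('a, 'c) module" (structure)
begin

definition dual_basis :: "nat \<Rightarrow> (nat \<Rightarrow> 'c) \<Rightarrow> (nat \<Rightarrow> 'c \<Rightarrow> 'a) \<Rightarrow> bool" where
  "dual_basis n g \<phi> \<longleftrightarrow> g \<in> {..<n} \<rightarrow> carrier M \<and>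
    (\<forall>i < n. linear_map R M (self_module R) (\<phi> i)) \<and>
    (\<forall>x \<in> carrier M. lincomb n g (\<lambda>i. \<phi> i x) = x)"

text \<open>
  Let \<open>T\<close> be the trace ideal, generated by the values of all \<open>\<phi>\<^sub>i\<close>. The dual basis shows \<open>M = T M\<close>.
  As in Nakayama's lemma, the generators are eliminated one after the other, which yields
  \<open>a \<in> 1 + T\<close> with \<open>a M = 0\<close>. Then \<open>a T = 0\<close>, in particular \<open>a (1 - a) = 0\<close>; and \<open>a\<close> cannot
  lie in a proper ideal that contains \<open>T\<close>.
\<close>

lemma annihilating_idempotent:
  assumes db: "dual_basis n g \<phi>"
  shows "\<exists>a \<in> carrier R. a \<otimes> a = a \<and> (\<forall>x \<in> carrier M. a \<odot>\<^bsub>M\<^esub> x = \<zero>\<^bsub>M\<^esub>) \<and>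
    (\<forall>I. maximalideal I R \<longrightarrow> a \<in> I \<longrightarrow> (\<exists>i < n. \<exists>x \<in> carrier M. \<phi> i x \<notin> I))"
proof -
  have g: "g \<in> {..<n} \<rightarrow> carrier M" and lin: "\<And>i. i < n \<Longrightarrow> linear_map R M (self_module R) (\<phi> i)"
    and db': "\<And>x. x \<in> carrier M \<Longrightarrow> lincomb n g (\<lambda>i. \<phi> i x) = x"
    using db by (auto simp: dual_basis_def)
  define V where "V = {\<phi> i x | i x. i < n \<and> x \<in> carrier M}"
  define T where "T = Idl V"
  have VR: "V \<subseteq> carrier R" using linear_formD(1)[OF lin] by (auto simp: V_def)
  interpret T: ideal T R unfolding T_def by (rule R.genideal_ideal[OF VR])
  have VT: "V \<subseteq> T" unfolding T_def by (rule R.genideal_self[OF VR])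
  have TR: "t \<in> T \<Longrightarrow> t \<in> carrier R" for t using T.a_subset by auto
  have "\<exists>a \<in> carrier R. \<one> \<ominus> a \<in> T \<and> (\<forall>x \<in> carrier M. \<exists>t \<in> {..<0} \<rightarrow> T. a \<odot>\<^bsub>M\<^esub> x = lincomb 0 g t)"
  proof (rule inc_induct[of 0 n])
    have "\<exists>t \<in> {..<n} \<rightarrow> T. \<one> \<odot>\<^bsub>M\<^esub> x = lincomb n g t" if x: "x \<in> carrier M" for x
      using x db' VT by (intro bexI[of _ "\<lambda>i. \<phi> i x"]) (auto simp: V_def)
    moreover have "\<one> \<ominus> \<one> \<in> T" by (simp add: R.minus_eq R.r_neg)
    ultimately show "\<exists>a \<in> carrier R. \<one> \<ominus> a \<in> T \<and>
        (\<forall>x \<in> carrier M. \<exists>t \<in> {..<n} \<rightarrow> T. a \<odot>\<^bsub>M\<^esub> x = lincomb n g t)"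
      by (intro bexI[of _ \<one>]) auto
  next
    fix k assume k: "k < n" and "\<exists>a \<in> carrier R. \<one> \<ominus> a \<in> T \<and>
        (\<forall>x \<in> carrier M. \<exists>t \<in> {..<Suc k} \<rightarrow> T. a \<odot>\<^bsub>M\<^esub> x = lincomb (Suc k) g t)"
    then obtain a where a: "a \<in> carrier R" "\<one> \<ominus> a \<in> T"
      and ax: "\<And>x. x \<in> carrier M \<Longrightarrow> \<exists>t \<in> {..<Suc k} \<rightarrow> T. a \<odot>\<^bsub>M\<^esub> x = lincomb (Suc k) g t"
      by auto
    have gk: "g k \<in> carrier M" and gk': "g \<in> {..<k} \<rightarrow> carrier M" using g k by auto
    obtain s where s: "s \<in> {..<Suc k} \<rightarrow> T" and as: "a \<odot>\<^bsub>M\<^esub> g k = s k \<odot>\<^bsub>M\<^esub> g k \<oplus>\<^bsub>M\<^esub> lincomb k g s"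
      using ax[OF gk] by auto
    have sk: "s k \<in> T" "s k \<in> carrier R" and s': "s \<in> {..<k} \<rightarrow> carrier R" using s by (auto intro!: TR)
    have ls: "lincomb k g s \<in> carrier M" using s' gk' by (rule lincomb_closed)
    define d where "d = a \<ominus> s k"
    have d: "d \<in> carrier R" using a sk by (simp add: d_def)
    have dg: "d \<odot>\<^bsub>M\<^esub> g k = lincomb k g s"
    proof -
      have "d \<odot>\<^bsub>M\<^esub> g k = a \<odot>\<^bsub>M\<^esub> g k \<oplus>\<^bsub>M\<^esub> \<ominus>\<^bsub>M\<^esub> (s k \<odot>\<^bsub>M\<^esub> g k)"
        using a sk gk by (simp add: d_def R.minus_eq smult_l_distr smult_l_minus)
      also have "\<dots> = lincomb k g s"
        using sk gk ls by (simp add: as M.a_comm[of "s k \<odot>\<^bsub>M\<^esub> g k"] M.a_assoc M.r_neg)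
      finally show ?thesis .
    qed
    have "\<exists>t \<in> {..<k} \<rightarrow> T. (d \<otimes> a) \<odot>\<^bsub>M\<^esub> x = lincomb k g t" if x: "x \<in> carrier M" for x
    proof -
      obtain t where t: "t \<in> {..<Suc k} \<rightarrow> T" and at: "a \<odot>\<^bsub>M\<^esub> x = t k \<odot>\<^bsub>M\<^esub> g k \<oplus>\<^bsub>M\<^esub> lincomb k g t"
        using ax[OF x] by auto
      have tk: "t k \<in> T" "t k \<in> carrier R" and t': "t \<in> {..<k} \<rightarrow> carrier R" using t by (auto intro!: TR)
      have lt: "lincomb k g t \<in> carrier M" using t' gk' by (rule lincomb_closed)
      have "(d \<otimes> a) \<odot>\<^bsub>M\<^esub> x = t k \<odot>\<^bsub>M\<^esub> (d \<odot>\<^bsub>M\<^esub> g k) \<oplus>\<^bsub>M\<^esub> d \<odot>\<^bsub>M\<^esub> lincomb k g t"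
        using smult_assoc1[OF d a(1) x] smult_assoc1[OF d tk(2) gk] smult_assoc1[OF tk(2) d gk]
          R.m_comm[OF d tk(2)] d tk gk lt by (simp add: at smult_r_distr)
      also have "\<dots> = lincomb k g (\<lambda>i. t k \<otimes> s i \<oplus> d \<otimes> t i)"
        unfolding dg using gk' s' t' tk d
        by (subst lincomb_add) (auto simp: lincomb_smult Pi_def)
      finally show ?thesis
        using s t tk d by (intro bexI[of _ "\<lambda>i. t k \<otimes> s i \<oplus> d \<otimes> t i"]) (auto intro!: T.a_closed T.I_l_closed)
    qed
    moreover have "\<one> \<ominus> d \<otimes> a \<in> T"
    proof -
      have "\<one> \<ominus> d \<otimes> a = (\<one> \<ominus> a) \<oplus> (\<one> \<ominus> a) \<otimes> a \<oplus> s k \<otimes> a"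
        using a sk unfolding d_def
        by (simp add: R.minus_eq R.l_distr R.l_minus R.minus_add R.a_assoc R.r_neg1 R.r_neg2)
      then show ?thesis using a sk by (auto intro!: T.a_closed T.I_r_closed)
    qed
    ultimately show "\<exists>a \<in> carrier R. \<one> \<ominus> a \<in> T \<and>
        (\<forall>x \<in> carrier M. \<exists>t \<in> {..<k} \<rightarrow> T. a \<odot>\<^bsub>M\<^esub> x = lincomb k g t)"
      using d a by (intro bexI[of _ "d \<otimes> a"]) auto
  qed simp
  then obtain a where a: "a \<in> carrier R" "\<one> \<ominus> a \<in> T" and ann: "\<And>x. x \<in> carrier M \<Longrightarrow> a \<odot>\<^bsub>M\<^esub> x = \<zero>\<^bsub>M\<^esub>"
    by auto
  have "T \<subseteq> {t \<in> carrier R. a \<otimes> t = \<zero>}"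
    unfolding T_def
  proof (rule R.genideal_minimal)
    show "ideal {t \<in> carrier R. a \<otimes> t = \<zero>} R"
    proof (rule idealI)
      show "subgroup {t \<in> carrier R. a \<otimes> t = \<zero>} (add_monoid R)"
        using a by unfold_locales (auto simp: R.r_distr R.r_minus a_inv_def[symmetric])
      fix t x assume t: "t \<in> {t \<in> carrier R. a \<otimes> t = \<zero>}" and x: "x \<in> carrier R"
      then have "a \<otimes> (t \<otimes> x) = \<zero>" using R.m_assoc[of a t x] a by simp
      then show "t \<otimes> x \<in> {t \<in> carrier R. a \<otimes> t = \<zero>}" "x \<otimes> t \<in> {t \<in> carrier R. a \<otimes> t = \<zero>}"
        using t x by (auto simp: R.m_comm)
    qed (rule R.ring_axioms)
    show "V \<subseteq> {t \<in> carrier R. a \<otimes> t = \<zero>}"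
    proof
      fix t assume "t \<in> V"
      then obtain i x where i: "i < n" and x: "x \<in> carrier M" and t: "t = \<phi> i x" by (auto simp: V_def)
      note L = linear_formD[OF lin[OF i]]
      have "a \<otimes> \<phi> i x = \<phi> i \<zero>\<^bsub>M\<^esub>" using L(3)[OF a(1) x] ann[OF x] by simp
      also have "\<dots> = \<zero>" using L(3)[of \<zero> "\<zero>\<^bsub>M\<^esub>"] L(1)[of "\<zero>\<^bsub>M\<^esub>"] by simp
      finally show "t \<in> {t \<in> carrier R. a \<otimes> t = \<zero>}" using t L(1)[OF x] by simp
    qed
  qed
  then have "a \<otimes> (\<one> \<ominus> a) = \<zero>" using a(2) by blast
  then have "a \<otimes> (\<one> \<ominus> a) \<oplus> a \<otimes> a = a \<otimes> a" using a(1) by simp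
  then have "a \<otimes> (\<one> \<ominus> a \<oplus> a) = a \<otimes> a" using a(1) by (simp add: R.r_distr)
  then have aa: "a \<otimes> a = a" using a(1) by (simp add: R.minus_eq R.a_assoc R.l_neg)
  have "\<exists>i < n. \<exists>x \<in> carrier M. \<phi> i x \<notin> I" if I: "maximalideal I R" and aI: "a \<in> I" for I
  proof (rule ccontr)
    assume "\<not> ?thesis"
    then have VI: "V \<subseteq> I" by (auto simp: V_def)
    interpret I: maximalideal I R by fact
    have "T \<subseteq> I" unfolding T_def by (rule R.genideal_minimal[OF I.is_ideal VI])
    then have "\<one> \<in> I" using I.minus_memD[of \<one> a] a aI by auto
    then show False using I.one_imp_carrier I.I_notcarr by simp
  qed
  then show ?thesis using a aa ann by blast
qed

text \<open>
  The free module of which \<open>M\<close> is a summand may have infinite rank, but the coordinates of the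
  finitely many generators of \<open>M\<close> involve only a finite set \<open>J\<close> of basis vectors, and so do those of
  all elements of \<open>M\<close>.
\<close>

lemma dual_basis_exists:
  assumes fg: "finitely_generated_module R M" and pr: "projective_module R M"
  shows "\<exists>n g \<phi>. dual_basis n g \<phi>"
proof -
  obtain S where S: "finite S" "S \<subseteq> carrier M"
    and gen: "\<And>x. x \<in> carrier M \<Longrightarrow> \<exists>c \<in> S \<rightarrow> carrier R. x = (\<Oplus>\<^bsub>M\<^esub>s \<in> S. c s \<odot>\<^bsub>M\<^esub> s)"
    using fg by (auto simp: finitely_generated_module_def)
  obtain B :: "'c set" and i p where i: "linear_map R M (free_module R B) i"
    and p: "linear_map R (free_module R B) M p" and pi: "\<And>x. x \<in> carrier M \<Longrightarrow> p (i x) = x"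
    using pr by (auto simp: projective_module_def)
  note free = free_module_def
  have ic: "i x \<in> B \<rightarrow>\<^sub>E carrier R" "finite {j \<in> B. i x j \<noteq> \<zero>}" if "x \<in> carrier M" for x
    using linear_map_closed[OF i that] by (auto simp: free)
  have ixj: "i x j \<in> carrier R" if "x \<in> carrier M" "j \<in> B" for x j using ic(1)[OF that(1)] that(2) by auto
  have i_add: "i (x \<oplus>\<^bsub>M\<^esub> y) j = i x j \<oplus> i y j" if "x \<in> carrier M" "y \<in> carrier M" "j \<in> B" for x y j
    using linear_map_add[OF i that(1,2)] that(3) by (simp add: free)
  have i_smult: "i (r \<odot>\<^bsub>M\<^esub> x) j = r \<otimes> i x j" if "r \<in> carrier R" "x \<in> carrier M" "j \<in> B" for r x j
    using linear_map_smult[OF i that(1,2)] that(3) by (simp add: free)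
  have i_zero: "i \<zero>\<^bsub>M\<^esub> j = \<zero>" if "j \<in> B" for j
    using i_smult[of \<zero> "\<zero>\<^bsub>M\<^esub>" j] that ixj[of "\<zero>\<^bsub>M\<^esub>" j] by simp
  define J where "J = (\<Union>s \<in> S. {j \<in> B. i s j \<noteq> \<zero>})"
  have J: "finite J" "J \<subseteq> B" using S ic(2) by (auto simp: J_def)
  have supp: "i x j = \<zero>" if x: "x \<in> carrier M" and j: "j \<in> B - J" for x j
  proof -
    obtain c where c: "c \<in> S \<rightarrow> carrier R" "x = (\<Oplus>\<^bsub>M\<^esub>s \<in> S. c s \<odot>\<^bsub>M\<^esub> s)" using gen[OF x] by auto
    have "i (\<Oplus>\<^bsub>M\<^esub>s \<in> U. c s \<odot>\<^bsub>M\<^esub> s) j = \<zero>" if "finite U" "U \<subseteq> S" for U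
      using that
    proof (induction U)
      case empty
      then show ?case using i_zero j by simp
    next
      case (insert s U)
      have sM: "s \<in> carrier M" "c s \<in> carrier R" "(\<lambda>s. c s \<odot>\<^bsub>M\<^esub> s) \<in> U \<rightarrow> carrier M"
        using insert.prems S c by (auto simp: Pi_def)
      have "i s j = \<zero>" using insert.prems j by (auto simp: J_def)
      then show ?case using insert sM j
        by (simp add: i_add i_smult M.finsum_insert)
    qed
    then show ?thesis using S c by auto
  qed
  obtain n and e :: "nat \<Rightarrow> 'c" where e: "bij_betw e {..<n} J"
    using ex_bij_betw_nat_finite[OF J(1)] by (auto simp: atLeast0LessThan)
  define \<delta> where "\<delta> k = (\<lambda>j \<in> B. if j = k then \<one> else \<zero>)" for k
  have \<delta>: "\<delta> k \<in> carrier (free_module R B)" for k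
    by (auto simp: \<delta>_def free intro: finite_subset[of _ "{k}"])
  define g where "g k = p (\<delta> (e k))" for k
  have eB: "e k \<in> B" if "k < n" for k using e that J by (auto simp: bij_betw_def)
  have gM: "g \<in> {..<n} \<rightarrow> carrier M" using linear_map_closed[OF p \<delta>] by (auto simp: g_def)
  have p_zero: "p (\<lambda>j \<in> B. \<zero>) = \<zero>\<^bsub>M\<^esub>"
  proof -
    have z: "(\<lambda>j \<in> B. \<zero>) \<in> carrier (free_module R B)" by (auto simp: free)
    have "p (\<lambda>j \<in> B. \<zero>) = p (\<zero> \<odot>\<^bsub>free_module R B\<^esub> (\<lambda>j \<in> B. \<zero>))"
      by (rule arg_cong[of _ _ p]) (auto simp: free)
    also have "\<dots> = \<zero>\<^bsub>M\<^esub>"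
      using linear_map_smult[OF p _ z, of \<zero>] linear_map_closed[OF p z] by simp
    finally show ?thesis .
  qed
  have expand: "k \<le> n \<Longrightarrow> v \<in> carrier (free_module R B) \<Longrightarrow> (\<And>j. j \<in> B - e ` {..<k} \<Longrightarrow> v j = \<zero>) \<Longrightarrow>
      p v = lincomb k g (\<lambda>l. v (e l))" for k v
  proof (induction k arbitrary: v)
    case 0
    then have "v = (\<lambda>j \<in> B. \<zero>)" by (auto simp: free fun_eq_iff PiE_def extensional_def)
    then show ?case by (simp only: lincomb.simps p_zero)
  next
    case (Suc k)
    have vB: "v \<in> B \<rightarrow>\<^sub>E carrier R" "finite {j \<in> B. v j \<noteq> \<zero>}" using Suc.prems by (auto simp: free)
    have ek: "e k \<in> B" "v (e k) \<in> carrier R" using eB[of k] Suc.prems vB by auto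
    define v' where "v' = (\<lambda>j \<in> B. if j = e k then \<zero> else v j)"
    have v': "v' \<in> carrier (free_module R B)"
      using vB by (auto simp: v'_def free intro: finite_subset[of _ "{j \<in> B. v j \<noteq> \<zero>}"])
    have sm: "v (e k) \<odot>\<^bsub>free_module R B\<^esub> \<delta> (e k) \<in> carrier (free_module R B)"
      using ek by (auto simp: free \<delta>_def intro: finite_subset[of _ "{e k}"])
    have "v = v (e k) \<odot>\<^bsub>free_module R B\<^esub> \<delta> (e k) \<oplus>\<^bsub>free_module R B\<^esub> v'"
      using vB ek by (auto simp: free \<delta>_def v'_def fun_eq_iff PiE_def Pi_def extensional_def)
    then have "p v = p (v (e k) \<odot>\<^bsub>free_module R B\<^esub> \<delta> (e k) \<oplus>\<^bsub>free_module R B\<^esub> v')" by simp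
    also have "\<dots> = v (e k) \<odot>\<^bsub>M\<^esub> g k \<oplus>\<^bsub>M\<^esub> p v'"
      using linear_map_add[OF p sm v'] linear_map_smult[OF p ek(2) \<delta>] by (simp add: g_def)
    also have "p v' = lincomb k g (\<lambda>l. v' (e l))"
    proof (rule Suc.IH[OF _ v'])
      fix j assume j: "j \<in> B - e ` {..<k}"
      show "v' j = \<zero>"
      proof (cases "j = e k")
        case False
        then have "j \<in> B - e ` {..<Suc k}" using j by (auto simp: lessThan_Suc)
        then show ?thesis using Suc.prems(3) by (auto simp: v'_def)
      qed (use j in \<open>simp add: v'_def\<close>)
    qed (use Suc.prems in simp)
    also have "\<dots> = lincomb k g (\<lambda>l. v (e l))"
    proof (rule lincomb_cong)
      fix l assume l: "l < k"
      then have "e l \<noteq> e k" using e Suc.prems(1) inj_onD[of e "{..<n}" l k] by (auto simp: bij_betw_def)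
      then show "g l = g l \<and> v' (e l) = v (e l)" using eB[of l] l Suc.prems(1) by (simp add: v'_def)
    qed
    finally show ?case by simp
  qed
  have "dual_basis n g (\<lambda>k x. i x (e k))"
    unfolding dual_basis_def
  proof (intro conjI allI impI ballI gM)
    fix k assume k: "k < n"
    show "linear_map R M (self_module R) (\<lambda>x. i x (e k))"
      using ixj i_add i_smult eB[OF k] by (auto simp: linear_map_def self_module_def)
  next
    fix x assume x: "x \<in> carrier M"
    have "e ` {..<n} = J" using e by (simp add: bij_betw_def)
    then have "p (i x) = lincomb n g (\<lambda>l. i x (e l))"
      using supp[OF x] linear_map_closed[OF i x] by (intro expand) auto
    then show "lincomb n g (\<lambda>k. i x (e k)) = x" using pi[OF x] by simp
  qed
  then show ?thesis by blast
qed

end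

section \<open>Absorbing a regular form into hyperbolic planes\<close>

lemma (in abelian_group) add_add_minus_minus:
  assumes "x \<in> carrier G" "y \<in> carrier G" "z \<in> carrier G"
  shows "x \<oplus> y \<oplus> z \<ominus> x \<ominus> y = z"
proof -
  have "x \<oplus> y \<oplus> z \<ominus> x \<ominus> y = (z \<oplus> (x \<oplus> y)) \<oplus> \<ominus> (x \<oplus> y)"
    unfolding minus_add[OF assms(1,2)] using assms by (simp add: minus_eq a_comm[of z] a_assoc)
  then show ?thesis using assms by (simp add: a_assoc[of z] r_neg)
qed

lemma quadratic_spaceI:
  fixes R (structure) and M :: "('a, 'c) module"
  assumes M: "module R M"
    and q: "\<And>x. x \<in> carrier M \<Longrightarrow> q x \<in> carrier R"
    and q_smult: "\<And>r x. \<lbrakk>r \<in> carrier R; x \<in> carrier M\<rbrakk> \<Longrightarrow> q (r \<odot>\<^bsub>M\<^esub> x) = r [^] (2::nat) \<otimes> q x"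
    and q_add: "\<And>x y. \<lbrakk>x \<in> carrier M; y \<in> carrier M\<rbrakk> \<Longrightarrow> q (x \<oplus>\<^bsub>M\<^esub> y) = q x \<oplus> q y \<oplus> B x y"
    and B: "\<And>x y. \<lbrakk>x \<in> carrier M; y \<in> carrier M\<rbrakk> \<Longrightarrow> B x y \<in> carrier R"
    and B_comm: "\<And>x y. \<lbrakk>x \<in> carrier M; y \<in> carrier M\<rbrakk> \<Longrightarrow> B x y = B y x"
    and B_add: "\<And>x y z. \<lbrakk>x \<in> carrier M; y \<in> carrier M; z \<in> carrier M\<rbrakk> \<Longrightarrow>
      B (x \<oplus>\<^bsub>M\<^esub> y) z = B x z \<oplus> B y z"
    and B_smult: "\<And>r x y. \<lbrakk>r \<in> carrier R; x \<in> carrier M; y \<in> carrier M\<rbrakk> \<Longrightarrow>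
      B (r \<odot>\<^bsub>M\<^esub> x) y = r \<otimes> B x y"
  shows "quadratic_space R M q"
    and "\<And>x y. \<lbrakk>x \<in> carrier M; y \<in> carrier M\<rbrakk> \<Longrightarrow> polar R M q x y = B x y"
proof -
  interpret M: "module" R M by (rule M)
  show polar: "polar R M q x y = B x y" if "x \<in> carrier M" "y \<in> carrier M" for x y
  proof -
    have "q x \<in> carrier R" "q y \<in> carrier R" "B x y \<in> carrier R" using that q B by auto
    then show ?thesis unfolding polar_def using that
      by (simp add: q_add M.R.add_add_minus_minus)
  qed
  have "bilinear_form R M (polar R M q)"
    unfolding bilinear_form_def linear_map_def self_module_def
    using polar B B_add B_smult B_comm by (auto simp: Pi_def)
  then have "quadratic_map R M q" using q q_smult by (auto simp: quadratic_map_def)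
  then show "quadratic_space R M q"
    using M by (simp add: quadratic_space_def quadratic_space_axioms_def)
qed

lemma direct_sum_simps [simp]:
  "carrier (direct_sum M N) = carrier M \<times> carrier N"
  "(x, y) \<oplus>\<^bsub>direct_sum M N\<^esub> (x', y') = (x \<oplus>\<^bsub>M\<^esub> x', y \<oplus>\<^bsub>N\<^esub> y')"
  "\<zero>\<^bsub>direct_sum M N\<^esub> = (\<zero>\<^bsub>M\<^esub>, \<zero>\<^bsub>N\<^esub>)"
  "r \<odot>\<^bsub>direct_sum M N\<^esub> (x, y) = (r \<odot>\<^bsub>M\<^esub> x, r \<odot>\<^bsub>N\<^esub> y)"
  by (simp_all add: direct_sum_def)

lemma orthogonal_sum_apply [simp]: "orthogonal_sum R q q' (x, y) = q x \<oplus>\<^bsub>R\<^esub> q' y"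
  by (simp add: orthogonal_sum_def)

lemma module_direct_sum:
  assumes "module R M" "module R N" shows "module R (direct_sum M N)"
proof -
  interpret M: "module" R M by fact
  interpret N: "module" R N by fact
  show ?thesis
  proof (rule moduleI)
    show "abelian_group (direct_sum M N)"
    proof (rule abelian_groupI)
      fix x assume "x \<in> carrier (direct_sum M N)"
      then show "\<exists>y \<in> carrier (direct_sum M N). y \<oplus>\<^bsub>direct_sum M N\<^esub> x = \<zero>\<^bsub>direct_sum M N\<^esub>"
        by (intro bexI[of _ "(\<ominus>\<^bsub>M\<^esub> fst x, \<ominus>\<^bsub>N\<^esub> snd x)"]) (auto simp: M.M.l_neg N.M.l_neg)
    qed (auto simp: M.M.a_ac N.M.a_ac)
  qed (auto simp: M.R.is_cring M.smult_l_distr N.smult_l_distr M.smult_r_distr N.smult_r_distr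
      M.smult_assoc1 N.smult_assoc1)
qed

lemma quadratic_space_direct_sum:
  fixes R (structure)
  assumes "quadratic_space R M q" "quadratic_space R N q'"
  shows "quadratic_space R (direct_sum M N) (orthogonal_sum R q q')"
    and "\<lbrakk>x \<in> carrier M; y \<in> carrier N; x' \<in> carrier M; y' \<in> carrier N\<rbrakk> \<Longrightarrow>
      polar R (direct_sum M N) (orthogonal_sum R q q') (x, y) (x', y') =
      polar R M q x x' \<oplus> polar R N q' y y'"
proof -
  interpret M: quadratic_space R M q by fact
  interpret N: quadratic_space R N q' by fact
  let ?B = "\<lambda>u v. polar R M q (fst u) (fst v) \<oplus> polar R N q' (snd u) (snd v)"
  note I = quadratic_spaceI[where B = ?B and q = "orthogonal_sum R q q'",
    OF module_direct_sum[OF M.module_axioms N.module_axioms]]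
  have *: "quadratic_space R (direct_sum M N) (orthogonal_sum R q q') \<and>
    (\<forall>x \<in> carrier (direct_sum M N). \<forall>y \<in> carrier (direct_sum M N).
      polar R (direct_sum M N) (orthogonal_sum R q q') x y = ?B x y)"
    by (intro conjI ballI I)
      (auto simp: M.q_smult N.q_smult M.q_add N.q_add M.b_simps N.b_simps M.R.r_distr M.R.a_ac
        M.b_commute N.b_commute)
  show "quadratic_space R (direct_sum M N) (orthogonal_sum R q q')" using * by simp
  show "polar R (direct_sum M N) (orthogonal_sum R q q') (x, y) (x', y') =
      polar R M q x x' \<oplus> polar R N q' y y'"
    if "x \<in> carrier M" "y \<in> carrier N" "x' \<in> carrier M" "y' \<in> carrier N"
    using * that by simp
qed

text \<open>
  Vectors of length \<open>n\<close> are padded with zeros, so that the carriers for growing \<open>n\<close> are nested and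
  the operations do not depend on \<open>n\<close>. This makes \<open>H\<^sup>n\<close> literally the complement of the last plane
  of \<open>H\<^sup>n\<^sup>+\<^sup>1\<close>, which the induction on the number of planes relies on.
\<close>

definition coordinate_module :: "('a, 'r) ring_scheme \<Rightarrow> nat \<Rightarrow> ('a, nat \<Rightarrow> 'a) module" where
  "coordinate_module R n =
    \<lparr>carrier = {x. (\<forall>i < n. x i \<in> carrier R) \<and> (\<forall>i \<ge> n. x i = \<zero>\<^bsub>R\<^esub>)},
     monoid.mult = undefined, monoid.one = undefined,
     ring.zero = (\<lambda>i. \<zero>\<^bsub>R\<^esub>), ring.add = (\<lambda>x y i. x i \<oplus>\<^bsub>R\<^esub> y i),
     module.smult = (\<lambda>r x i. r \<otimes>\<^bsub>R\<^esub> x i)\<rparr>"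

primrec dot :: "('a, 'r) ring_scheme \<Rightarrow> nat \<Rightarrow> (nat \<Rightarrow> 'a) \<Rightarrow> (nat \<Rightarrow> 'a) \<Rightarrow> 'a" where
  "dot R 0 x y = \<zero>\<^bsub>R\<^esub>"
| "dot R (Suc n) x y = x n \<otimes>\<^bsub>R\<^esub> y n \<oplus>\<^bsub>R\<^esub> dot R n x y"

abbreviation hyperbolic_module :: "('a, 'r) ring_scheme \<Rightarrow> nat \<Rightarrow> ('a, (nat \<Rightarrow> 'a) \<times> (nat \<Rightarrow> 'a)) module" where
  "hyperbolic_module R n \<equiv> direct_sum (coordinate_module R n) (coordinate_module R n)"

definition hyperbolic_form :: "('a, 'r) ring_scheme \<Rightarrow> nat \<Rightarrow> (nat \<Rightarrow> 'a) \<times> (nat \<Rightarrow> 'a) \<Rightarrow> 'a" where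
  "hyperbolic_form R n = (\<lambda>(x, y). dot R n x y)"

lemma hyperbolic_form_apply [simp]: "hyperbolic_form R n (x, y) = dot R n x y"
  by (simp add: hyperbolic_form_def)

context cring
begin

lemma coordinate_module_simps [simp]:
  "x \<oplus>\<^bsub>coordinate_module R n\<^esub> y = (\<lambda>i. x i \<oplus> y i)"
  "\<zero>\<^bsub>coordinate_module R n\<^esub> = (\<lambda>i. \<zero>)"
  "r \<odot>\<^bsub>coordinate_module R n\<^esub> x = (\<lambda>i. r \<otimes> x i)"
  by (simp_all add: coordinate_module_def)

lemma coordinate_closed: "x \<in> carrier (coordinate_module R n) \<Longrightarrow> x i \<in> carrier R"
  by (cases "i < n") (auto simp: coordinate_module_def)

lemma coordinate_iff:
  "x \<in> carrier (coordinate_module R n) \<longleftrightarrow> (\<forall>i. x i \<in> carrier R) \<and> (\<forall>i \<ge> n. x i = \<zero>)"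
  using coordinate_closed by (auto simp: coordinate_module_def)

lemma module_coordinate: "module R (coordinate_module R n)"
proof (rule moduleI[OF is_cring])
  show "abelian_group (coordinate_module R n)"
  proof (rule abelian_groupI)
    fix x assume "x \<in> carrier (coordinate_module R n)"
    then show "\<exists>y \<in> carrier (coordinate_module R n). y \<oplus>\<^bsub>coordinate_module R n\<^esub> x = \<zero>\<^bsub>coordinate_module R n\<^esub>"
      by (intro bexI[of _ "\<lambda>i. \<ominus> x i"]) (auto simp: coordinate_iff l_neg)
  qed (auto simp: coordinate_iff fun_eq_iff a_ac)
qed (auto simp: coordinate_iff fun_eq_iff l_distr r_distr m_assoc)

lemma dot_closed: "\<lbrakk>\<And>i. x i \<in> carrier R; \<And>i. y i \<in> carrier R\<rbrakk> \<Longrightarrow> dot R n x y \<in> carrier R"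
  by (induction n) auto

lemma dot_add: "\<lbrakk>\<And>i. x i \<in> carrier R; \<And>i. y i \<in> carrier R; \<And>i. z i \<in> carrier R\<rbrakk> \<Longrightarrow>
    dot R n (\<lambda>i. x i \<oplus> y i) z = dot R n x z \<oplus> dot R n y z"
  by (induction n) (auto simp: l_distr a_ac dot_closed)

lemma dot_add_right: "\<lbrakk>\<And>i. x i \<in> carrier R; \<And>i. y i \<in> carrier R; \<And>i. z i \<in> carrier R\<rbrakk> \<Longrightarrow>
    dot R n z (\<lambda>i. x i \<oplus> y i) = dot R n z x \<oplus> dot R n z y"
  by (induction n) (auto simp: r_distr a_ac dot_closed)

lemma dot_smult: "\<lbrakk>\<And>i. x i \<in> carrier R; \<And>i. y i \<in> carrier R; r \<in> carrier R\<rbrakk> \<Longrightarrow>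
    dot R n (\<lambda>i. r \<otimes> x i) y = r \<otimes> dot R n x y"
  by (induction n) (auto simp: r_distr m_assoc dot_closed)

lemma dot_smult_right: "\<lbrakk>\<And>i. x i \<in> carrier R; \<And>i. y i \<in> carrier R; r \<in> carrier R\<rbrakk> \<Longrightarrow>
    dot R n x (\<lambda>i. r \<otimes> y i) = r \<otimes> dot R n x y"
  by (induction n) (auto simp: r_distr m_lcomm dot_closed)

lemma quadratic_space_hyperbolic:
  shows "quadratic_space R (hyperbolic_module R n) (hyperbolic_form R n)"
    and "\<lbrakk>(x, y) \<in> carrier (hyperbolic_module R n); (x', y') \<in> carrier (hyperbolic_module R n)\<rbrakk> \<Longrightarrow>
      polar R (hyperbolic_module R n) (hyperbolic_form R n) (x, y) (x', y')
        = dot R n x y' \<oplus> dot R n x' y"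
proof -
  let ?B = "\<lambda>u v. dot R n (fst u) (snd v) \<oplus> dot R n (fst v) (snd u)"
  note I = quadratic_spaceI[where B = ?B and q = "hyperbolic_form R n",
    OF module_direct_sum[OF module_coordinate module_coordinate]]
  have *: "quadratic_space R (hyperbolic_module R n) (hyperbolic_form R n) \<and>
    (\<forall>x \<in> carrier (hyperbolic_module R n). \<forall>y \<in> carrier (hyperbolic_module R n).
      polar R (hyperbolic_module R n) (hyperbolic_form R n) x y = ?B x y)"
    by (intro conjI ballI I)
      (auto simp: coordinate_iff dot_closed dot_add dot_add_right dot_smult dot_smult_right
        r_distr a_ac m_ac numeral_2_eq_2)
  show "quadratic_space R (hyperbolic_module R n) (hyperbolic_form R n)" using * by simp
  show "polar R (hyperbolic_module R n) (hyperbolic_form R n) (x, y) (x', y')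
        = dot R n x y' \<oplus> dot R n x' y"
    if "(x, y) \<in> carrier (hyperbolic_module R n)" "(x', y') \<in> carrier (hyperbolic_module R n)"
    using * that by simp
qed

end

lemma isometry_polar:
  assumes "isometry R M q N q' f" "x \<in> carrier M" "y \<in> carrier M" "module R M"
  shows "polar R N q' (f x) (f y) = polar R M q x y"
proof -
  interpret M: "module" R M by fact
  show ?thesis using assms(1-3) unfolding isometry_def linear_map_def polar_def
    by (metis M.M.a_closed)
qed

text \<open>
  Building up \<open>x = \<Sum>\<^sub>i \<phi>\<^sub>i(x) g\<^sub>i\<close> term by term, step \<open>i\<close> adds to \<open>q\<close> the square term and the cross term
  with the previous partial sum. Both contain the factor \<open>\<phi>\<^sub>i(x)\<close>, and the cofactor \<open>\<psi>\<^sub>i(x)\<close> is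
  linear in \<open>x\<close>.
\<close>

lemma regular_embeds_hyperbolic:
  assumes "quadratic_space R M q" and db: "plain_module.dual_basis R M n g \<phi>"
  shows "\<exists>\<gamma>. linear_map R M (hyperbolic_module R n) \<gamma> \<and>
    (\<forall>x \<in> carrier M. hyperbolic_form R n (\<gamma> x) = q x)"
proof -
  interpret M: quadratic_space R M q by fact
  interpret P: plain_module R M by unfold_locales
  have g: "g \<in> {..<n} \<rightarrow> carrier M" and lin: "\<And>i. i < n \<Longrightarrow> linear_map R M (self_module R) (\<phi> i)"
    and db': "\<And>x. x \<in> carrier M \<Longrightarrow> M.lincomb n g (\<lambda>i. \<phi> i x) = x"
    using db by (auto simp: P.dual_basis_def)
  have gi: "i < n \<Longrightarrow> g i \<in> carrier M" "i \<le> n \<Longrightarrow> g \<in> {..<i} \<rightarrow> carrier M" for i using g by auto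
  note L = linear_formD[OF lin]
  have Lpi: "i \<le> n \<Longrightarrow> x \<in> carrier M \<Longrightarrow> (\<lambda>j. \<phi> j x) \<in> {..<i} \<rightarrow> carrier R" for i x
    using L(1) by auto
  have lc: "i \<le> n \<Longrightarrow> x \<in> carrier M \<Longrightarrow> M.lincomb i g (\<lambda>j. \<phi> j x) \<in> carrier M" for i x
    by (rule M.lincomb_closed[OF Lpi gi(2)])
  define \<psi> where "\<psi> i x = q (g i) \<otimes>\<^bsub>R\<^esub> \<phi> i x \<oplus>\<^bsub>R\<^esub> polar R M q (g i) (M.lincomb i g (\<lambda>j. \<phi> j x))" for i x
  have \<psi>R: "\<psi> i x \<in> carrier R" if "i < n" "x \<in> carrier M" for i x
    using that L(1) gi lc by (auto simp: \<psi>_def)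
  have lc_add: "M.lincomb i g (\<lambda>j. \<phi> j (x \<oplus>\<^bsub>M\<^esub> y))
      = M.lincomb i g (\<lambda>j. \<phi> j x) \<oplus>\<^bsub>M\<^esub> M.lincomb i g (\<lambda>j. \<phi> j y)"
    if "i \<le> n" "x \<in> carrier M" "y \<in> carrier M" for i x y
  proof -
    have "M.lincomb i g (\<lambda>j. \<phi> j (x \<oplus>\<^bsub>M\<^esub> y)) = M.lincomb i g (\<lambda>j. \<phi> j x \<oplus>\<^bsub>R\<^esub> \<phi> j y)"
      using that L(2) by (intro M.lincomb_cong) auto
    then show ?thesis using M.lincomb_add[OF gi(2) Lpi Lpi] that by simp
  qed
  have lc_smult: "M.lincomb i g (\<lambda>j. \<phi> j (r \<odot>\<^bsub>M\<^esub> x)) = r \<odot>\<^bsub>M\<^esub> M.lincomb i g (\<lambda>j. \<phi> j x)"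
    if "i \<le> n" "r \<in> carrier R" "x \<in> carrier M" for i r x
  proof -
    have "M.lincomb i g (\<lambda>j. \<phi> j (r \<odot>\<^bsub>M\<^esub> x)) = M.lincomb i g (\<lambda>j. r \<otimes>\<^bsub>R\<^esub> \<phi> j x)"
      using that L(3) by (intro M.lincomb_cong) auto
    then show ?thesis using M.lincomb_smult[OF gi(2) Lpi] that by simp
  qed
  have \<psi>_add: "\<psi> i (x \<oplus>\<^bsub>M\<^esub> y) = \<psi> i x \<oplus>\<^bsub>R\<^esub> \<psi> i y" if "i < n" "x \<in> carrier M" "y \<in> carrier M" for i x y
    using that L gi lc lc_add by (simp add: \<psi>_def M.b_simps M.R.r_distr M.R.a_ac)
  have \<psi>_smult: "\<psi> i (r \<odot>\<^bsub>M\<^esub> x) = r \<otimes>\<^bsub>R\<^esub> \<psi> i x" if "i < n" "r \<in> carrier R" "x \<in> carrier M" for i r x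
    using that L gi lc lc_smult by (simp add: \<psi>_def M.b_simps M.R.r_distr M.R.m_ac)
  define \<gamma> where "\<gamma> x = (\<lambda>i. if i < n then \<phi> i x else \<zero>\<^bsub>R\<^esub>, \<lambda>i. if i < n then \<psi> i x else \<zero>\<^bsub>R\<^esub>)" for x
  have "linear_map R M (hyperbolic_module R n) \<gamma>"
    unfolding linear_map_def \<gamma>_def
    using L \<psi>R \<psi>_add \<psi>_smult by (auto simp: M.R.coordinate_iff fun_eq_iff)
  moreover have "hyperbolic_form R n (\<gamma> x) = q x" if x: "x \<in> carrier M" for x
  proof -
    have "k \<le> n \<Longrightarrow> dot R k (fst (\<gamma> x)) (snd (\<gamma> x)) = q (M.lincomb k g (\<lambda>i. \<phi> i x))" for k
    proof (induction k)
      case (Suc k)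
      then have c: "\<phi> k x \<in> carrier R" "g k \<in> carrier M" "M.lincomb k g (\<lambda>i. \<phi> i x) \<in> carrier M"
        using L(1) x gi lc by auto
      have "dot R (Suc k) (fst (\<gamma> x)) (snd (\<gamma> x)) = \<phi> k x \<otimes>\<^bsub>R\<^esub> \<psi> k x \<oplus>\<^bsub>R\<^esub> q (M.lincomb k g (\<lambda>i. \<phi> i x))"
        using Suc by (simp add: \<gamma>_def)
      then show ?case using c
        by (simp add: \<psi>_def M.q_add M.q_smult M.b_simps M.R.r_distr M.R.m_ac M.R.a_ac numeral_2_eq_2)
    qed (simp add: \<gamma>_def)
    from this[of n] show ?thesis using db'[OF x] by (simp add: hyperbolic_form_def split_beta)
  qed
  ultimately show ?thesis by blast
qed

text \<open>The adjoint \<open>\<pi>\<close> of \<open>\<gamma>\<close> makes \<open>\<gamma>\<pi>\<close> the orthogonal projection onto the image of \<open>\<gamma>\<close>.\<close>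

lemma regular_adjoint:
  fixes R (structure)
  assumes H: "quadratic_space R H h" and reg: "regular_form R M q"
    and \<gamma>: "linear_map R M H \<gamma>" and iso: "\<And>x. x \<in> carrier M \<Longrightarrow> h (\<gamma> x) = q x"
  obtains \<pi> where "linear_map R H M \<pi>"
    "\<And>x. x \<in> carrier M \<Longrightarrow> \<pi> (\<gamma> x) = x"
    "\<And>z y. \<lbrakk>z \<in> carrier H; y \<in> carrier M\<rbrakk> \<Longrightarrow> polar R H h z (\<gamma> y) = polar R M q (\<pi> z) y"
proof -
  interpret H: quadratic_space R H h by fact
  interpret M: quadratic_space R M q
    using reg by (auto simp: regular_form_def quadratic_form_def quadratic_space_def quadratic_space_axioms_def)
  note \<gamma>' = linear_map_closed[OF \<gamma>] linear_map_add[OF \<gamma>] linear_map_smult[OF \<gamma>]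
  have bij: "bij_betw (\<lambda>x. \<lambda>y \<in> carrier M. M.b x y) (carrier M) (dual_carrier R M)"
    using reg by (simp add: regular_form_def)
  have uniq: "x = x'" if "x \<in> carrier M" "x' \<in> carrier M" "\<And>y. y \<in> carrier M \<Longrightarrow> M.b x y = M.b x' y" for x x'
  proof (rule inj_onD[OF bij_betw_imp_inj_on[OF bij]])
    show "(\<lambda>y \<in> carrier M. M.b x y) = (\<lambda>y \<in> carrier M. M.b x' y)" using that(3) by (rule restrict_ext)
  qed (use that in auto)
  have ex: "\<exists>p \<in> carrier M. \<forall>y \<in> carrier M. H.b z (\<gamma> y) = M.b p y" if z: "z \<in> carrier H" for z
  proof -
    have "(\<lambda>y \<in> carrier M. H.b z (\<gamma> y)) \<in> dual_carrier R M"
      using z \<gamma>' by (auto simp: dual_carrier_def linear_map_def self_module_def H.b_simps)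
    then obtain p where "p \<in> carrier M" "(\<lambda>y \<in> carrier M. H.b z (\<gamma> y)) = (\<lambda>y \<in> carrier M. M.b p y)"
      using bij_betw_imp_surj_on[OF bij] by (metis (no_types, lifting) imageE)
    then show ?thesis by (intro bexI[of _ p]) (auto simp: fun_eq_iff restrict_def, metis)
  qed
  then obtain \<pi> where \<pi>: "\<And>z. z \<in> carrier H \<Longrightarrow> \<pi> z \<in> carrier M"
    "\<And>z y. \<lbrakk>z \<in> carrier H; y \<in> carrier M\<rbrakk> \<Longrightarrow> H.b z (\<gamma> y) = M.b (\<pi> z) y"
    by metis
  have "linear_map R H M \<pi>"
    unfolding linear_map_def
  proof (intro conjI ballI)
    show "\<pi> \<in> carrier H \<rightarrow> carrier M" using \<pi>(1) by auto
  next
    fix x y assume xy: "x \<in> carrier H" "y \<in> carrier H"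
    show "\<pi> (x \<oplus>\<^bsub>H\<^esub> y) = \<pi> x \<oplus>\<^bsub>M\<^esub> \<pi> y"
      using xy \<pi>(1) \<gamma>' by (intro uniq) (auto simp: M.b_simps H.b_simps \<pi>(2)[symmetric])
  next
    fix r x assume rx: "r \<in> carrier R" "x \<in> carrier H"
    show "\<pi> (r \<odot>\<^bsub>H\<^esub> x) = r \<odot>\<^bsub>M\<^esub> \<pi> x"
      using rx \<pi>(1) \<gamma>' by (intro uniq) (auto simp: M.b_simps H.b_simps \<pi>(2)[symmetric])
  qed
  moreover have "\<pi> (\<gamma> x) = x" if x: "x \<in> carrier M" for x
  proof (rule uniq)
    fix y assume y: "y \<in> carrier M"
    have "H.b (\<gamma> x) (\<gamma> y) = M.b x y"
      using x y iso \<gamma>'(2)[OF x y, symmetric] by (simp add: polar_def)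
    then show "M.b (\<pi> (\<gamma> x)) y = M.b x y" using \<pi>(2)[OF \<gamma>'(1)[OF x] y] by simp
  qed (use x \<pi>(1) \<gamma>'(1) in auto)
  ultimately show thesis using \<pi>(2) by (rule that)
qed

text \<open>
  The space \<open>H\<close> is the orthogonal sum of the image of \<open>\<gamma>\<close> and the image of the projection
  \<open>\<rho> = 1 - \<gamma>\<pi>\<close>. The given isometry is applied to the first part along \<open>\<gamma>\<close>, and the second part is
  left alone.
\<close>

lemma isometric_orthogonal_sum_enlarge:
  fixes R (structure)
  assumes M1: "quadratic_space R M1 q1" and M2: "quadratic_space R M2 q2"
    and H: "quadratic_space R H h" and reg: "regular_form R M3 q3"
    and \<gamma>: "linear_map R M3 H \<gamma>" and iso: "\<And>x. x \<in> carrier M3 \<Longrightarrow> h (\<gamma> x) = q3 x"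
    and isom: "isometric R (direct_sum M1 M3) (orthogonal_sum R q1 q3)
      (direct_sum M2 M3) (orthogonal_sum R q2 q3)"
  shows "isometric R (direct_sum M1 H) (orthogonal_sum R q1 h) (direct_sum M2 H) (orthogonal_sum R q2 h)"
proof -
  interpret H: quadratic_space R H h by fact
  interpret M1: quadratic_space R M1 q1 by fact
  interpret M2: quadratic_space R M2 q2 by fact
  interpret M3: quadratic_space R M3 q3
    using reg by (auto simp: regular_form_def quadratic_form_def quadratic_space_def quadratic_space_axioms_def)
  note g = linear_map_closed[OF \<gamma>] linear_map_add[OF \<gamma>] linear_map_smult[OF \<gamma>]
  obtain \<pi> where \<pi>: "linear_map R H M3 \<pi>" and \<pi>\<gamma>: "\<And>x. x \<in> carrier M3 \<Longrightarrow> \<pi> (\<gamma> x) = x"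
    and adj: "\<And>z y. \<lbrakk>z \<in> carrier H; y \<in> carrier M3\<rbrakk> \<Longrightarrow> H.b z (\<gamma> y) = M3.b (\<pi> z) y"
    using regular_adjoint[OF H reg \<gamma> iso] by blast
  note p = linear_map_closed[OF \<pi>] linear_map_add[OF \<pi>] linear_map_smult[OF \<pi>]
  define \<rho> where "\<rho> z = z \<oplus>\<^bsub>H\<^esub> (\<ominus> \<one>) \<odot>\<^bsub>H\<^esub> \<gamma> (\<pi> z)" for z
  have \<rho>c: "\<rho> z \<in> carrier H" if "z \<in> carrier H" for z using that p g by (simp add: \<rho>_def)
  have \<rho>_add: "\<rho> (z \<oplus>\<^bsub>H\<^esub> z') = \<rho> z \<oplus>\<^bsub>H\<^esub> \<rho> z'" if "z \<in> carrier H" "z' \<in> carrier H" for z z'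
    using that p g by (simp add: \<rho>_def H.smult_r_distr H.M.a_ac)
  have \<rho>_smult: "\<rho> (r \<odot>\<^bsub>H\<^esub> z) = r \<odot>\<^bsub>H\<^esub> \<rho> z" if "r \<in> carrier R" "z \<in> carrier H" for r z
    using that p g H.smult_assoc1[of "\<ominus> \<one>" r "\<gamma> (\<pi> z)"] H.smult_assoc1[of r "\<ominus> \<one>" "\<gamma> (\<pi> z)"]
    by (simp add: \<rho>_def H.smult_r_distr H.R.l_minus H.R.r_minus)
  have \<pi>\<rho>: "\<pi> (\<rho> z) = \<zero>\<^bsub>M3\<^esub>" if "z \<in> carrier H" for z
    using that p g by (simp add: \<rho>_def \<pi>\<gamma> M3.smult_l_minus M3.M.r_neg)
  have \<rho>\<gamma>: "\<rho> (\<gamma> y) = \<zero>\<^bsub>H\<^esub>" if "y \<in> carrier M3" for y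
    using that g by (simp add: \<rho>_def \<pi>\<gamma> H.smult_l_minus H.M.r_neg)
  have split: "\<rho> z \<oplus>\<^bsub>H\<^esub> \<gamma> (\<pi> z) = z" if "z \<in> carrier H" for z
    using that p g by (simp add: \<rho>_def H.smult_l_minus H.M.a_assoc H.M.l_neg)
  have h_split: "h (\<rho> z \<oplus>\<^bsub>H\<^esub> \<gamma> y) = h (\<rho> z) \<oplus> q3 y" if "z \<in> carrier H" "y \<in> carrier M3" for z y
    using that \<rho>c g \<pi>\<rho> by (simp add: H.q_add adj iso)
  have \<rho>\<rho>: "\<rho> (\<rho> z) = \<rho> z" if z: "z \<in> carrier H" for z
    using split[OF \<rho>c[OF z]] \<rho>\<gamma>[of "\<zero>\<^bsub>M3\<^esub>"] \<pi>\<rho>[OF z] \<rho>c[OF \<rho>c[OF z]] linear_map_smult[OF \<gamma>, of \<zero> "\<zero>\<^bsub>M3\<^esub>"] g(1)[of "\<zero>\<^bsub>M3\<^esub>"]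
    by simp
  obtain f where f: "isometry R (direct_sum M1 M3) (orthogonal_sum R q1 q3)
      (direct_sum M2 M3) (orthogonal_sum R q2 q3) f"
    using isom by (auto simp: isometric_def)
  let ?N1 = "direct_sum M1 M3" and ?N2 = "direct_sum M2 M3"
  have f_lin: "linear_map R ?N1 ?N2 f" and f_bij: "bij_betw f (carrier ?N1) (carrier ?N2)"
    and f_q: "\<And>x. x \<in> carrier ?N1 \<Longrightarrow> orthogonal_sum R q2 q3 (f x) = orthogonal_sum R q1 q3 x"
    using f by (auto simp: isometry_def)
  define f1 where "f1 m y = fst (f (m, y))" for m y
  define f2 where "f2 m y = snd (f (m, y))" for m y
  have f_eq: "f (m, y) = (f1 m y, f2 m y)" for m y by (simp add: f1_def f2_def)
  have fc: "f1 m y \<in> carrier M2" "f2 m y \<in> carrier M3" if "m \<in> carrier M1" "y \<in> carrier M3" for m y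
    using linear_map_closed[OF f_lin, of "(m, y)"] that by (auto simp: f_eq)
  have f_add: "f1 (m \<oplus>\<^bsub>M1\<^esub> m') (y \<oplus>\<^bsub>M3\<^esub> y') = f1 m y \<oplus>\<^bsub>M2\<^esub> f1 m' y'"
    "f2 (m \<oplus>\<^bsub>M1\<^esub> m') (y \<oplus>\<^bsub>M3\<^esub> y') = f2 m y \<oplus>\<^bsub>M3\<^esub> f2 m' y'"
    if "m \<in> carrier M1" "y \<in> carrier M3" "m' \<in> carrier M1" "y' \<in> carrier M3" for m y m' y'
    using linear_map_add[OF f_lin, of "(m, y)" "(m', y')"] that by (auto simp: f_eq)
  have f_smult: "f1 (r \<odot>\<^bsub>M1\<^esub> m) (r \<odot>\<^bsub>M3\<^esub> y) = r \<odot>\<^bsub>M2\<^esub> f1 m y"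
    "f2 (r \<odot>\<^bsub>M1\<^esub> m) (r \<odot>\<^bsub>M3\<^esub> y) = r \<odot>\<^bsub>M3\<^esub> f2 m y"
    if "r \<in> carrier R" "m \<in> carrier M1" "y \<in> carrier M3" for r m y
    using linear_map_smult[OF f_lin that(1), of "(m, y)"] that by (auto simp: f_eq)
  define E where "E = (\<lambda>(m, z). (f1 m (\<pi> z), \<rho> z \<oplus>\<^bsub>H\<^esub> \<gamma> (f2 m (\<pi> z))))"
  have E_simp: "E (m, z) = (f1 m (\<pi> z), \<rho> z \<oplus>\<^bsub>H\<^esub> \<gamma> (f2 m (\<pi> z)))" for m z by (simp add: E_def)
  have \<pi>_sum: "\<pi> (\<rho> z \<oplus>\<^bsub>H\<^esub> \<gamma> y) = y" and \<rho>_sum: "\<rho> (\<rho> z \<oplus>\<^bsub>H\<^esub> \<gamma> y) = \<rho> z"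
    if "z \<in> carrier H" "y \<in> carrier M3" for z y
    using that \<rho>c g p \<pi>\<rho> \<pi>\<gamma> by (simp_all add: \<rho>_add \<rho>\<rho> \<rho>\<gamma>)
  have "isometry R (direct_sum M1 H) (orthogonal_sum R q1 h) (direct_sum M2 H) (orthogonal_sum R q2 h) E"
    unfolding isometry_def linear_map_def
  proof (intro conjI ballI)
    show "E \<in> carrier (direct_sum M1 H) \<rightarrow> carrier (direct_sum M2 H)"
      using fc p g \<rho>c by (auto simp: E_simp)
    fix x assume "x \<in> carrier (direct_sum M1 H)"
    then obtain m z where x: "x = (m, z)" and m: "m \<in> carrier M1" and z: "z \<in> carrier H" by auto
    have "q2 (f1 m (\<pi> z)) \<oplus> q3 (f2 m (\<pi> z)) = q1 m \<oplus> q3 (\<pi> z)"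
      using f_q[of "(m, \<pi> z)"] m z p by (simp add: f_eq)
    moreover have "h z = h (\<rho> z) \<oplus> q3 (\<pi> z)" using h_split[OF z p(1)[OF z]] split[OF z] by simp
    ultimately show "orthogonal_sum R q2 h (E x) = orthogonal_sum R q1 h x"
      using m z fc[OF m p(1)[OF z]] \<rho>c[OF z] p(1)[OF z]
      by (simp add: x E_simp h_split H.R.a_lcomm[of _ "h (\<rho> z)"])
    fix r assume r: "r \<in> carrier R"
    show "E (r \<odot>\<^bsub>direct_sum M1 H\<^esub> x) = r \<odot>\<^bsub>direct_sum M2 H\<^esub> E x"
      using r m z fc p g \<rho>c by (simp add: x E_simp f_smult \<rho>_smult H.smult_r_distr)
  next
    fix x y assume "x \<in> carrier (direct_sum M1 H)" "y \<in> carrier (direct_sum M1 H)"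
    then obtain m z m' z' where x: "x = (m, z)" "y = (m', z')" and c: "m \<in> carrier M1" "z \<in> carrier H"
      "m' \<in> carrier M1" "z' \<in> carrier H" by auto
    then show "E (x \<oplus>\<^bsub>direct_sum M1 H\<^esub> y) = E x \<oplus>\<^bsub>direct_sum M2 H\<^esub> E y"
      using fc p g \<rho>c by (simp add: x E_simp f_add \<rho>_add) (simp add: H.M.a_ac)
  next
    show "bij_betw E (carrier (direct_sum M1 H)) (carrier (direct_sum M2 H))"
    proof (rule bij_betw_imageI)
      show "inj_on E (carrier (direct_sum M1 H))"
      proof (rule inj_onI)
        fix x y assume xc: "x \<in> carrier (direct_sum M1 H)" and yc: "y \<in> carrier (direct_sum M1 H)"
          and eq: "E x = E y"
        obtain m z m' z' where x: "x = (m, z)" "y = (m', z')" and c: "m \<in> carrier M1" "z \<in> carrier H"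
          "m' \<in> carrier M1" "z' \<in> carrier H" using xc yc by auto
        have eq1: "f1 m (\<pi> z) = f1 m' (\<pi> z')"
          and eq2: "\<rho> z \<oplus>\<^bsub>H\<^esub> \<gamma> (f2 m (\<pi> z)) = \<rho> z' \<oplus>\<^bsub>H\<^esub> \<gamma> (f2 m' (\<pi> z'))"
          using eq by (auto simp: x E_simp)
        have "f2 m (\<pi> z) = f2 m' (\<pi> z')" "\<rho> z = \<rho> z'"
          using arg_cong[OF eq2, of \<pi>] arg_cong[OF eq2, of \<rho>] c fc p by (simp_all add: \<pi>_sum \<rho>_sum)
        then have "f (m, \<pi> z) = f (m', \<pi> z')" using eq1 by (simp add: f_eq)
        then have "(m, \<pi> z) = (m', \<pi> z')"
          using c p by (intro inj_onD[OF bij_betw_imp_inj_on[OF f_bij]]) auto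
        then have m: "m = m'" and \<pi>z: "\<pi> z = \<pi> z'" by auto
        have "z = \<rho> z \<oplus>\<^bsub>H\<^esub> \<gamma> (\<pi> z)" by (rule split[OF c(2), symmetric])
        also have "\<dots> = z'" unfolding \<open>\<rho> z = \<rho> z'\<close> \<pi>z by (rule split[OF c(4)])
        finally show "x = y" using m by (simp add: x)
      qed
      show "E ` carrier (direct_sum M1 H) = carrier (direct_sum M2 H)"
      proof (intro equalityI subsetI)
        fix x assume "x \<in> E ` carrier (direct_sum M1 H)"
        then show "x \<in> carrier (direct_sum M2 H)" using fc p g \<rho>c by (auto simp: E_simp)
      next
        fix x assume "x \<in> carrier (direct_sum M2 H)"
        then obtain n w where x: "x = (n, w)" and n: "n \<in> carrier M2" and w: "w \<in> carrier H" by auto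
        have "(n, \<pi> w) \<in> f ` carrier ?N1" using n w p bij_betw_imp_surj_on[OF f_bij] by simp
        then obtain my where "my \<in> carrier ?N1" and "f my = (n, \<pi> w)" by (elim imageE) simp
        then obtain m y where m: "m \<in> carrier M1" and y: "y \<in> carrier M3" and fm: "f (m, y) = (n, \<pi> w)"
          by (cases my) auto
        have "E (m, \<rho> w \<oplus>\<^bsub>H\<^esub> \<gamma> y) = x"
          using fm w y by (simp add: E_simp \<pi>_sum \<rho>_sum f_eq x split)
        moreover have "(m, \<rho> w \<oplus>\<^bsub>H\<^esub> \<gamma> y) \<in> carrier (direct_sum M1 H)" using m w y g \<rho>c by simp
        ultimately show "x \<in> E ` carrier (direct_sum M1 H)" by blast
      qed
    qed
  qed
  then show ?thesis by (auto simp: isometric_def)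
qed

section \<open>Cancelling all hyperbolic planes\<close>

lemma isometric_perp:
  assumes "quadratic_space R N q" "quadratic_space R N' q'"
    and F: "isometry R N q N' q' F" and e: "e \<in> carrier N" and f: "f \<in> carrier N"
  shows "isometric R (N\<lparr>carrier := quadratic_space.perp R N q e f\<rparr>) q
    (N'\<lparr>carrier := quadratic_space.perp R N' q' (F e) (F f)\<rparr>) q'"
proof -
  interpret N: quadratic_space R N q by fact
  interpret N': quadratic_space R N' q' by fact
  have lin: "linear_map R N N' F" and bij: "bij_betw F (carrier N) (carrier N')"
    and q: "\<And>x. x \<in> carrier N \<Longrightarrow> q' (F x) = q x"
    using F by (auto simp: isometry_def)
  note pol = isometry_polar[OF F _ _ N.module_axioms]
  have Fx: "F x \<in> N'.perp (F e) (F f) \<longleftrightarrow> x \<in> N.perp e f" if "x \<in> carrier N" for x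
    using that e f pol linear_map_closed[OF lin that] by (simp add: N.perp_def N'.perp_def)
  have "F ` N.perp e f = N'.perp (F e) (F f)"
  proof (intro equalityI subsetI)
    fix y assume y: "y \<in> N'.perp (F e) (F f)"
    then have "y \<in> F ` carrier N" using bij by (auto simp: N'.perp_def bij_betw_def)
    then obtain x where "x \<in> carrier N" "y = F x" by auto
    then show "y \<in> F ` N.perp e f" using y Fx by auto
  qed (use Fx N.perp_subset in auto)
  moreover have "inj_on F (N.perp e f)"
    using bij N.perp_subset by (auto simp: bij_betw_def intro: inj_on_subset)
  ultimately have "isometry R (N\<lparr>carrier := N.perp e f\<rparr>) q (N'\<lparr>carrier := N'.perp (F e) (F f)\<rparr>) q' F"
    using lin q N.perp_subset[of e f] by (auto simp: isometry_def linear_map_def bij_betw_def subset_iff)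
  then show ?thesis by (auto simp: isometric_def)
qed

lemma isometric_cong:
  assumes "isometric R M q N q'" "\<And>x. x \<in> carrier M \<Longrightarrow> q x = p x" "\<And>y. y \<in> carrier N \<Longrightarrow> q' y = p' y"
  shows "isometric R M p N p'"
  using assms by (auto simp: isometric_def isometry_def linear_map_def Pi_def)

definition unit_coordinate :: "('a, 'r) ring_scheme \<Rightarrow> nat \<Rightarrow> nat \<Rightarrow> 'a" where
  "unit_coordinate R n = (\<lambda>i. if i = n then \<one>\<^bsub>R\<^esub> else \<zero>\<^bsub>R\<^esub>)"

context quadratic_space
begin

definition extension :: "nat \<Rightarrow> ('a, 'c \<times> ((nat \<Rightarrow> 'a) \<times> (nat \<Rightarrow> 'a))) module" where
  "extension n = direct_sum M (hyperbolic_module R n)"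

definition extension_form :: "nat \<Rightarrow> 'c \<times> ((nat \<Rightarrow> 'a) \<times> (nat \<Rightarrow> 'a)) \<Rightarrow> 'a" where
  "extension_form n = orthogonal_sum R q (hyperbolic_form R n)"

definition plane_e where "plane_e n = (\<zero>\<^bsub>M\<^esub>, (unit_coordinate R n, \<lambda>i. \<zero>))"
definition plane_f where "plane_f n = (\<zero>\<^bsub>M\<^esub>, (\<lambda>i. \<zero>, unit_coordinate R n))"

lemma extension_space: "quadratic_space R (extension n) (extension_form n)"
  unfolding extension_def extension_form_def
  by (intro quadratic_space_direct_sum quadratic_space_axioms R.quadratic_space_hyperbolic)

lemma in_extension: "(m, (x, y)) \<in> carrier (extension n) \<longleftrightarrow> m \<in> carrier M \<and> (\<forall>i. x i \<in> carrier R) \<and>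
    (\<forall>i \<ge> n. x i = \<zero>) \<and> (\<forall>i. y i \<in> carrier R) \<and> (\<forall>i \<ge> n. y i = \<zero>)"
  by (auto simp: extension_def R.coordinate_iff)

lemma extension_ops [simp]:
  "(m, (x, y)) \<oplus>\<^bsub>extension n\<^esub> (m', (x', y')) = (m \<oplus>\<^bsub>M\<^esub> m', (\<lambda>i. x i \<oplus> x' i, \<lambda>i. y i \<oplus> y' i))"
  "\<zero>\<^bsub>extension n\<^esub> = (\<zero>\<^bsub>M\<^esub>, (\<lambda>i. \<zero>, \<lambda>i. \<zero>))"
  "r \<odot>\<^bsub>extension n\<^esub> (m, (x, y)) = (r \<odot>\<^bsub>M\<^esub> m, (\<lambda>i. r \<otimes> x i, \<lambda>i. r \<otimes> y i))"
  by (simp_all add: extension_def)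

lemma extension_form_apply [simp]: "extension_form n (m, (x, y)) = q m \<oplus> dot R n x y"
  by (simp add: extension_form_def)

lemma extension_polar:
  assumes "(m, (x, y)) \<in> carrier (extension n)" "(m', (x', y')) \<in> carrier (extension n)"
  shows "polar R (extension n) (extension_form n) (m, (x, y)) (m', (x', y')) = b m m' \<oplus> (dot R n x y' \<oplus> dot R n x' y)"
  using assms quadratic_space_direct_sum(2)[OF quadratic_space_axioms R.quadratic_space_hyperbolic(1)[of n],
      of m "(x, y)" m' "(x', y')"] R.quadratic_space_hyperbolic(2)[of x y n x' y']
  by (simp add: extension_def extension_form_def)

lemma unit_coordinate_closed [simp]: "unit_coordinate R n i \<in> carrier R"
  by (simp add: unit_coordinate_def)

lemma dot_zero_left: "\<lbrakk>\<And>i. i < n \<Longrightarrow> x i = \<zero>; \<And>i. y i \<in> carrier R\<rbrakk> \<Longrightarrow> dot R n x y = \<zero>"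
  by (induction n) auto

lemma dot_zero_right: "\<lbrakk>\<And>i. i < n \<Longrightarrow> y i = \<zero>; \<And>i. x i \<in> carrier R\<rbrakk> \<Longrightarrow> dot R n x y = \<zero>"
  by (induction n) auto

lemma dot_unit [simp]:
  assumes "\<And>i. y i \<in> carrier R"
  shows "dot R (Suc n) (unit_coordinate R n) y = y n" "dot R (Suc n) y (unit_coordinate R n) = y n"
  using assms by (simp_all add: dot_zero_left dot_zero_right unit_coordinate_def)

lemma plane_e_closed: "plane_e n \<in> carrier (extension (Suc n))" and plane_f_closed: "plane_f n \<in> carrier (extension (Suc n))"
  by (auto simp: plane_e_def plane_f_def in_extension unit_coordinate_def)

lemma form_plane_e: "extension_form k (plane_e n) = \<zero>" and form_plane_f: "extension_form k (plane_f n) = \<zero>"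
  by (simp_all add: plane_e_def plane_f_def dot_zero_left dot_zero_right)

lemma polar_plane: "polar R (extension (Suc n)) (extension_form (Suc n)) (plane_e n) (plane_f n) = \<one>"
proof -
  have "polar R (extension (Suc n)) (extension_form (Suc n)) (plane_e n) (plane_f n)
      = b \<zero>\<^bsub>M\<^esub> \<zero>\<^bsub>M\<^esub> \<oplus> (dot R (Suc n) (unit_coordinate R n) (unit_coordinate R n) \<oplus>
        dot R (Suc n) (\<lambda>i. \<zero>) (\<lambda>i. \<zero>))"
    using plane_e_closed[of n] plane_f_closed[of n] unfolding plane_e_def plane_f_def by (rule extension_polar)
  also have "\<dots> = \<one>" by (simp del: dot.simps add: dot_zero_left) (simp add: unit_coordinate_def)
  finally show ?thesis .
qed

lemma perp_plane: "quadratic_space.perp R (extension (Suc n)) (extension_form (Suc n)) (plane_e n) (plane_f n) = carrier (extension n)"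
proof -
  interpret N: quadratic_space R "extension (Suc n)" "extension_form (Suc n)" by (rule extension_space)
  have "(m, (x, y)) \<in> N.perp (plane_e n) (plane_f n) \<longleftrightarrow> (m, (x, y)) \<in> carrier (extension n)" for m x y
  proof (cases "(m, (x, y)) \<in> carrier (extension (Suc n))")
    case True
    then have c: "m \<in> carrier M" "\<And>i. x i \<in> carrier R" "\<And>i. y i \<in> carrier R" by (auto simp: in_extension)
    have "N.b (plane_e n) (m, (x, y)) = y n"
      using extension_polar[OF plane_e_closed[unfolded plane_e_def] True] c
      by (simp del: dot.simps add: plane_e_def dot_zero_left dot_zero_right)
    moreover have "N.b (plane_f n) (m, (x, y)) = x n"
      using extension_polar[OF plane_f_closed[unfolded plane_f_def] True] c
      by (simp del: dot.simps add: plane_f_def dot_zero_left dot_zero_right)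
    moreover have "(\<forall>i \<ge> n. z i = \<zero>) \<longleftrightarrow> z n = \<zero> \<and> (\<forall>i \<ge> Suc n. z i = \<zero>)" for z
      by (metis Suc_leD le_antisym not_less_eq_eq order_refl)
    ultimately show ?thesis using True by (auto simp: N.perp_def in_extension)
  next
    case False
    then show ?thesis by (auto simp: N.perp_def in_extension)
  qed
  then show ?thesis by auto
qed

lemma extension_restrict: "(extension k)\<lparr>carrier := carrier (extension n)\<rparr> = extension n"
  by (simp add: extension_def direct_sum_def coordinate_module_def)

lemma extension_form_restrict: "x \<in> carrier (extension n) \<Longrightarrow> extension_form (Suc n) x = extension_form n x"
  by (cases x; cases "snd x") (auto simp: in_extension R.dot_closed)

lemma extension_spanned:
  assumes db: "plain_module.dual_basis R M k\<^sub>0 g \<phi>"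
  shows "\<exists>k G. G \<in> {..<k} \<rightarrow> carrier (extension n) \<and> (\<forall>s \<in> carrier (extension n). \<exists>c \<in> {..<k} \<rightarrow> carrier R.
    s = module.lincomb (extension p) k G c)"
proof -
  interpret N: quadratic_space R "extension p" "extension_form p" by (rule extension_space)
  interpret P: plain_module R M by unfold_locales
  show ?thesis
  proof (induction n)
    case 0
    have g: "g \<in> {..<k\<^sub>0} \<rightarrow> carrier M" and lin: "\<And>i. i < k\<^sub>0 \<Longrightarrow> linear_map R M (self_module R) (\<phi> i)"
      and db': "\<And>x. x \<in> carrier M \<Longrightarrow> lincomb k\<^sub>0 g (\<lambda>i. \<phi> i x) = x"
      using db by (auto simp: P.dual_basis_def)
    define G where "G i = (g i, (\<lambda>i. \<zero>, \<lambda>i. \<zero>) :: (nat \<Rightarrow> 'a) \<times> (nat \<Rightarrow> 'a))" for i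
    have G: "N.lincomb k G c = (lincomb k g c, (\<lambda>i. \<zero>, \<lambda>i. \<zero>))" if "c \<in> {..<k} \<rightarrow> carrier R" for k c
      using that by (induction k) (auto simp: G_def Pi_def)
    have "\<exists>c \<in> {..<k\<^sub>0} \<rightarrow> carrier R. s = N.lincomb k\<^sub>0 G c" if s: "s \<in> carrier (extension 0)" for s
    proof -
      obtain m x y where s': "s = (m, (x, y))" by (cases s; cases "snd s") auto
      have m: "m \<in> carrier M" and xy: "x = (\<lambda>i. \<zero>)" "y = (\<lambda>i. \<zero>)" using s by (auto simp: s' in_extension)
      have c: "(\<lambda>i. \<phi> i m) \<in> {..<k\<^sub>0} \<rightarrow> carrier R" using linear_formD(1)[OF lin] m by auto
      then show ?thesis using G[OF c] db'[OF m] by (intro bexI[OF _ c]) (simp add: s' xy)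
    qed
    moreover have "G \<in> {..<k\<^sub>0} \<rightarrow> carrier (extension 0)" using g by (auto simp: G_def in_extension)
    ultimately show ?case by blast
  next
    case (Suc n)
    then obtain k G where G: "G \<in> {..<k} \<rightarrow> carrier (extension n)"
      and span: "\<And>s. s \<in> carrier (extension n) \<Longrightarrow> \<exists>c \<in> {..<k} \<rightarrow> carrier R. s = N.lincomb k G c" by auto
    define G' where "G' = G(k := plane_e n, Suc k := plane_f n)"
    have sub: "carrier (extension n) \<subseteq> carrier (extension (Suc n))" by (auto simp: in_extension)
    have "\<exists>c \<in> {..<Suc (Suc k)} \<rightarrow> carrier R. s = N.lincomb (Suc (Suc k)) G' c"
      if s: "s \<in> carrier (extension (Suc n))" for s
    proof -
      obtain m x y where s': "s = (m, (x, y))" by (cases s; cases "snd s") auto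
      have c: "m \<in> carrier M" "\<And>i. x i \<in> carrier R" "\<And>i. y i \<in> carrier R" using s by (auto simp: s' in_extension)
      have "(m, (x(n := \<zero>), y(n := \<zero>))) \<in> carrier (extension n)"
        using s by (auto simp: s' in_extension)
      then obtain d where d: "d \<in> {..<k} \<rightarrow> carrier R"
        and md: "(m, (x(n := \<zero>), y(n := \<zero>))) = N.lincomb k G d" using span by blast
      define d' where "d' = d(k := x n, Suc k := y n)"
      have "N.lincomb k G' d' = N.lincomb k G d" by (rule N.lincomb_cong) (auto simp: G'_def d'_def)
      then have "N.lincomb (Suc (Suc k)) G' d' = s"
        using c by (auto simp: md[symmetric] G'_def d'_def s' plane_e_def plane_f_def unit_coordinate_def fun_eq_iff)
      moreover have "d' \<in> {..<Suc (Suc k)} \<rightarrow> carrier R"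
        using d c by (auto simp: d'_def less_Suc_eq)
      ultimately show ?thesis by blast
    qed
    moreover have "G' \<in> {..<Suc (Suc k)} \<rightarrow> carrier (extension (Suc n))"
    proof -
      have "G \<in> {..<k} \<rightarrow> carrier (extension (Suc n))" using G sub by blast
      then show ?thesis using plane_e_closed plane_f_closed by (auto simp: G'_def less_Suc_eq)
    qed
    ultimately show ?case by blast
  qed
qed

end

text \<open>
  An isometry \<open>F\<close> carries the last plane of the first sum to a hyperbolic pair of the second, whose
  complement is compared with that of the last plane there. As long as other planes remain, \<open>q\<close>
  takes the value \<open>1\<close> on this complement, and \<open>0\<close> serves as the idempotent.
\<close>

lemma cancel_hyperbolic_planes:
  fixes R (structure) and M1 :: "('a, 'm1) module" and M2 :: "('a, 'm2) module"
  assumes LG: "LG_ring R" and M1: "quadratic_space R M1 q1" and M2: "quadratic_space R M2 q2"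
    and db: "plain_module.dual_basis R M2 k g \<phi>"
    and a: "a \<in> carrier R" "a \<otimes> a = a" and ann: "\<And>x. x \<in> carrier M2 \<Longrightarrow> a \<odot>\<^bsub>M2\<^esub> x = \<zero>\<^bsub>M2\<^esub>"
    and supp: "\<And>I. \<lbrakk>maximalideal I R; a \<in> I\<rbrakk> \<Longrightarrow> \<exists>x \<in> carrier M2. q2 x \<notin> I"
  shows "isometric R (direct_sum M1 (hyperbolic_module R n)) (orthogonal_sum R q1 (hyperbolic_form R n))
      (direct_sum M2 (hyperbolic_module R n)) (orthogonal_sum R q2 (hyperbolic_form R n)) \<Longrightarrow>
    isometric R (direct_sum M1 (hyperbolic_module R 0)) (orthogonal_sum R q1 (hyperbolic_form R 0))
      (direct_sum M2 (hyperbolic_module R 0)) (orthogonal_sum R q2 (hyperbolic_form R 0))"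
proof (induction n)
  case (Suc n)
  interpret M1: quadratic_space R M1 q1 by (rule M1)
  interpret M2: quadratic_space R M2 q2 by (rule M2)
  interpret N1: quadratic_space R "M1.extension (Suc n)" "M1.extension_form (Suc n)" by (rule M1.extension_space)
  interpret N2: quadratic_space R "M2.extension (Suc n)" "M2.extension_form (Suc n)" by (rule M2.extension_space)
  obtain F where F: "isometry R (M1.extension (Suc n)) (M1.extension_form (Suc n)) (M2.extension (Suc n)) (M2.extension_form (Suc n)) F"
    using Suc.prems by (auto simp: isometric_def M1.extension_def M2.extension_def M1.extension_form_def M2.extension_form_def)
  let ?u = "F (M1.plane_e n)" and ?v = "F (M1.plane_f n)"
  have Fc: "F x \<in> carrier (M2.extension (Suc n))" and FQ: "M2.extension_form (Suc n) (F x) = M1.extension_form (Suc n) x"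
    if "x \<in> carrier (M1.extension (Suc n))" for x using F that by (auto simp: isometry_def linear_map_def)
  have "isometric R (M1.extension n) (M1.extension_form (Suc n)) ((M2.extension (Suc n))\<lparr>carrier := N2.perp ?u ?v\<rparr>) (M2.extension_form (Suc n))"
    using isometric_perp[OF N1.quadratic_space_axioms N2.quadratic_space_axioms F M1.plane_e_closed M1.plane_f_closed]
    by (simp add: M1.perp_plane M1.extension_restrict)
  moreover have "isometric R ((M2.extension (Suc n))\<lparr>carrier := N2.perp ?u ?v\<rparr>) (M2.extension_form (Suc n)) (M2.extension n) (M2.extension_form (Suc n))"
  proof -
    obtain l G where G: "G \<in> {..<l} \<rightarrow> carrier (M2.extension n)"
      and span: "\<And>s. s \<in> carrier (M2.extension n) \<Longrightarrow> \<exists>c \<in> {..<l} \<rightarrow> carrier R. s = N2.lincomb l G c"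
      using M2.extension_spanned[OF db] by blast
    have "\<exists>a \<in> carrier R. a \<otimes> a = a \<and> (\<forall>x \<in> carrier (M2.extension n). a \<odot>\<^bsub>M2.extension (Suc n)\<^esub> x = \<zero>\<^bsub>M2.extension (Suc n)\<^esub>) \<and>
      (\<forall>I. maximalideal I R \<longrightarrow> a \<in> I \<longrightarrow> (\<exists>x \<in> carrier (M2.extension n). M2.extension_form (Suc n) x \<notin> I))"
    proof (cases n)
      case 0
      have "a \<odot>\<^bsub>M2.extension (Suc n)\<^esub> x = \<zero>\<^bsub>M2.extension (Suc n)\<^esub>" if x: "x \<in> carrier (M2.extension n)" for x
      proof -
        obtain m y z where x': "x = (m, (y, z))" by (cases x; cases "snd x") auto
        then have "m \<in> carrier M2" "y = (\<lambda>i. \<zero>)" "z = (\<lambda>i. \<zero>)" using x by (auto simp: M2.in_extension 0)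
        then show ?thesis using a ann by (simp add: x')
      qed
      moreover have "\<exists>x \<in> carrier (M2.extension n). M2.extension_form (Suc n) x \<notin> I" if I: "maximalideal I R" "a \<in> I" for I
      proof -
        obtain x where x: "x \<in> carrier M2" "q2 x \<notin> I" using supp[OF I] by auto
        then show ?thesis
          by (intro bexI[of _ "(x, (\<lambda>i. \<zero>, \<lambda>i. \<zero>))"]) (auto simp: M2.in_extension M2.dot_zero_left)
      qed
      ultimately show ?thesis using a by blast
    next
      case n: (Suc n')
      let ?x = "(\<zero>\<^bsub>M2\<^esub>, (unit_coordinate R n', unit_coordinate R n'))"
      have x: "?x \<in> carrier (M2.extension n)" by (auto simp: M2.in_extension n unit_coordinate_def)
      have "M2.extension_form n ?x = \<one>" by (simp add: n M2.dot_unit del: dot.simps) (simp add: unit_coordinate_def)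
      then have Qx: "M2.extension_form (Suc n) ?x = \<one>" using M2.extension_form_restrict[OF x] by simp
      have "\<exists>x \<in> carrier (M2.extension n). M2.extension_form (Suc n) x \<notin> I" if I: "maximalideal I R" for I
      proof -
        interpret I: maximalideal I R by fact
        show ?thesis using x Qx I.one_imp_carrier I.I_notcarr by (intro bexI[of _ ?x]) auto
      qed
      moreover have "\<zero> \<odot>\<^bsub>M2.extension (Suc n)\<^esub> x = \<zero>\<^bsub>M2.extension (Suc n)\<^esub>" if "x \<in> carrier (M2.extension n)" for x
        using that M2.perp_plane[of n] N2.perp_subset[of "M2.plane_e n" "M2.plane_f n"] by (intro N2.smult_l_null) auto
      ultimately show ?thesis by (intro bexI[of _ \<zero>]) auto
    qed
    then obtain a' where a': "a' \<in> carrier R" "a' \<otimes> a' = a'"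
      "\<And>x. x \<in> carrier (M2.extension n) \<Longrightarrow> a' \<odot>\<^bsub>M2.extension (Suc n)\<^esub> x = \<zero>\<^bsub>M2.extension (Suc n)\<^esub>"
      "\<And>I. \<lbrakk>maximalideal I R; a' \<in> I\<rbrakk> \<Longrightarrow> \<exists>x \<in> carrier (M2.extension n). M2.extension_form (Suc n) x \<notin> I"
      by auto
    have pe: "N2.perp (M2.plane_e n) (M2.plane_f n) = carrier (M2.extension n)" by (rule M2.perp_plane)
    have "N2.perp_isometric ?u ?v (M2.plane_e n) (M2.plane_f n)"
    proof (rule N2.hyperbolic_pair_complements_isometric[OF LG M2.plane_e_closed M2.plane_f_closed M2.form_plane_e M2.form_plane_f M2.polar_plane])
      show "?u \<in> carrier (M2.extension (Suc n))" "?v \<in> carrier (M2.extension (Suc n))"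
        using Fc M1.plane_e_closed M1.plane_f_closed by auto
      show "M2.extension_form (Suc n) ?u = \<zero>" "M2.extension_form (Suc n) ?v = \<zero>"
        using FQ[OF M1.plane_e_closed] FQ[OF M1.plane_f_closed] M1.form_plane_e M1.form_plane_f by auto
      show "N2.b ?u ?v = \<one>"
        using isometry_polar[OF F M1.plane_e_closed M1.plane_f_closed N1.module_axioms] M1.polar_plane by simp
      show "G \<in> {..<l} \<rightarrow> N2.perp (M2.plane_e n) (M2.plane_f n)" using G pe by simp
      show "\<exists>x \<in> {..<l} \<rightarrow> carrier R. s = N2.lincomb l G x" if "s \<in> N2.perp (M2.plane_e n) (M2.plane_f n)" for s
        using span that pe by simp
      show "a' \<in> carrier R" "a' \<otimes> a' = a'" by fact+
    qed (use a' pe in simp_all)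
    then show ?thesis by (simp add: pe M2.extension_restrict)
  qed
  ultimately have "isometric R (M1.extension n) (M1.extension_form (Suc n)) (M2.extension n) (M2.extension_form (Suc n))" by (rule isometric_trans)
  then have "isometric R (M1.extension n) (M1.extension_form n) (M2.extension n) (M2.extension_form n)"
    by (rule isometric_cong) (auto simp: M1.extension_form_restrict M2.extension_form_restrict)
  then show ?case using Suc.IH by (simp add: M1.extension_def M2.extension_def M1.extension_form_def M2.extension_form_def)
qed simp

theorem mainTheorem9:
  fixes R :: "('a, 'r) ring_scheme"
    and M\<^sub>1 :: "('a, 'm1) module" and M\<^sub>2 :: "('a, 'm2) module" and M\<^sub>3 :: "('a, 'm3) module"
    and q\<^sub>1 :: "'m1 \<Rightarrow> 'a" and q\<^sub>2 :: "'m2 \<Rightarrow> 'a" and q\<^sub>3 :: "'m3 \<Rightarrow> 'a"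
  assumes "LG_ring R"
    and "nonsingular_form R M\<^sub>1 q\<^sub>1"
    and "nonsingular_form R M\<^sub>2 q\<^sub>2"
    and "regular_form R M\<^sub>3 q\<^sub>3"
    and "isometric R (direct_sum M\<^sub>1 M\<^sub>3) (orthogonal_sum R q\<^sub>1 q\<^sub>3)
      (direct_sum M\<^sub>2 M\<^sub>3) (orthogonal_sum R q\<^sub>2 q\<^sub>3)"
  shows "isometric R M\<^sub>1 q\<^sub>1 M\<^sub>2 q\<^sub>2"
proof -
  have f1: "quadratic_form R M\<^sub>1 q\<^sub>1" and f2: "quadratic_form R M\<^sub>2 q\<^sub>2" and f3: "quadratic_form R M\<^sub>3 q\<^sub>3"
    using assms by (auto simp: nonsingular_form_def regular_form_def)
  interpret M1: quadratic_space R M\<^sub>1 q\<^sub>1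
    using f1 by (auto simp: quadratic_form_def quadratic_space_def quadratic_space_axioms_def)
  interpret M2: quadratic_space R M\<^sub>2 q\<^sub>2
    using f2 by (auto simp: quadratic_form_def quadratic_space_def quadratic_space_axioms_def)
  interpret M3: quadratic_space R M\<^sub>3 q\<^sub>3
    using f3 by (auto simp: quadratic_form_def quadratic_space_def quadratic_space_axioms_def)
  interpret P2: plain_module R M\<^sub>2 by unfold_locales
  interpret P3: plain_module R M\<^sub>3 by unfold_locales
  obtain n3 g3 \<phi>3 where db3: "P3.dual_basis n3 g3 \<phi>3"
    using P3.dual_basis_exists f3 by (auto simp: quadratic_form_def)
  obtain n g \<phi> where db: "P2.dual_basis n g \<phi>"
    using P2.dual_basis_exists f2 by (auto simp: quadratic_form_def)
  obtain a where a: "a \<in> carrier R" "a \<otimes>\<^bsub>R\<^esub> a = a" "\<And>x. x \<in> carrier M\<^sub>2 \<Longrightarrow> a \<odot>\<^bsub>M\<^sub>2\<^esub> x = \<zero>\<^bsub>M\<^sub>2\<^esub>"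
    and a_supp: "\<And>I. \<lbrakk>maximalideal I R; a \<in> I\<rbrakk> \<Longrightarrow> \<exists>i < n. \<exists>x \<in> carrier M\<^sub>2. \<phi> i x \<notin> I"
    using P2.annihilating_idempotent[OF db] by blast
  have supp: "\<exists>x \<in> carrier M\<^sub>2. q\<^sub>2 x \<notin> I" if I: "maximalideal I R" "a \<in> I" for I
  proof -
    obtain i x where i: "i < n" and x: "x \<in> carrier M\<^sub>2" "\<phi> i x \<notin> I" using a_supp[OF I] by auto
    have "linear_map R M\<^sub>2 (self_module R) (\<phi> i)" using db i by (simp add: P2.dual_basis_def)
    then show ?thesis
      using nonsingular_form_zero_mod_maximal[OF assms(3) I(1) _ _ x(1)] x(2) by blast
  qed
  obtain \<gamma> where \<gamma>: "linear_map R M\<^sub>3 (hyperbolic_module R n3) \<gamma>"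
    and \<gamma>q: "\<And>x. x \<in> carrier M\<^sub>3 \<Longrightarrow> hyperbolic_form R n3 (\<gamma> x) = q\<^sub>3 x"
    using regular_embeds_hyperbolic[OF M3.quadratic_space_axioms db3] by blast
  have "isometric R (direct_sum M\<^sub>1 (hyperbolic_module R n3)) (orthogonal_sum R q\<^sub>1 (hyperbolic_form R n3))
      (direct_sum M\<^sub>2 (hyperbolic_module R n3)) (orthogonal_sum R q\<^sub>2 (hyperbolic_form R n3))"
    using M1.quadratic_space_axioms M2.quadratic_space_axioms M1.R.quadratic_space_hyperbolic(1)
      assms(4) \<gamma> \<gamma>q assms(5)
    by (rule isometric_orthogonal_sum_enlarge)
  then have "isometric R (direct_sum M\<^sub>1 (hyperbolic_module R 0)) (orthogonal_sum R q\<^sub>1 (hyperbolic_form R 0))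
      (direct_sum M\<^sub>2 (hyperbolic_module R 0)) (orthogonal_sum R q\<^sub>2 (hyperbolic_form R 0))"
    using assms(1) M1.quadratic_space_axioms M2.quadratic_space_axioms db a supp
    by (intro cancel_hyperbolic_planes) auto
  moreover
  have zero: "carrier (coordinate_module R 0) = {\<lambda>i. \<zero>\<^bsub>R\<^esub>}"
    by (auto simp: M1.R.coordinate_iff fun_eq_iff)
  have "isometry R M\<^sub>1 q\<^sub>1 (direct_sum M\<^sub>1 (hyperbolic_module R 0))
      (orthogonal_sum R q\<^sub>1 (hyperbolic_form R 0)) (\<lambda>m. (m, (\<lambda>i. \<zero>\<^bsub>R\<^esub>, \<lambda>i. \<zero>\<^bsub>R\<^esub>)))"
    by (auto simp: zero isometry_def linear_map_def bij_betw_def inj_on_def)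
  then have "isometric R M\<^sub>1 q\<^sub>1 (direct_sum M\<^sub>1 (hyperbolic_module R 0))
      (orthogonal_sum R q\<^sub>1 (hyperbolic_form R 0))"
    by (rule isometricI)
  moreover
  have "isometry R (direct_sum M\<^sub>2 (hyperbolic_module R 0))
      (orthogonal_sum R q\<^sub>2 (hyperbolic_form R 0)) M\<^sub>2 q\<^sub>2 fst"
    by (auto simp: zero isometry_def linear_map_def bij_betw_def inj_on_def)
  then have "isometric R (direct_sum M\<^sub>2 (hyperbolic_module R 0))
      (orthogonal_sum R q\<^sub>2 (hyperbolic_form R 0)) M\<^sub>2 q\<^sub>2"
    by (rule isometricI)
  ultimately show ?thesis by (blast intro: isometric_trans)
qed

end
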